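(* Let $k$ be a number field, let $\mathcal{A}\subseteq k^\times$ be a finitely generated subgroup, and let $n$ be a positive integer. Let $\mathfrak{p}$ be an infinite prime of $k$ and let $f:k\to\mathbb{C}$ be the corresponding embedding. Then: (1) If $f$ is a real embedding, then $$m\big(\mathrm{Et}_{n/k_\mathfrak{p}}^{\mathcal{A}}\big)=\begin{cases}\displaystyle\sum_{s=0}^{\lfloor n/2\rfloor}\frac{1}{s!\,(n-2s)!\,2^s}&\text{if } f(\alpha)>0\text{ for all }\alpha\in\mathcal{A},\\[2mm] \displaystyle\sum_{s=0}^{\lceil n/2\rceil-1}\frac{1}{s!\,(n-2s)!\,2^s}&\text{otherwise.}\end{cases}$$ (2) If $f$ is a complex (non-real) embedding, then $m\big(\mathrm{Et}_{n/k_\mathfrak{p}}^{\mathcal{A}}\big)=\frac{1}{n!}$.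
   Context: For $F=\mathbb{R}$ or $\mathbb{C}$, $\mathrm{Et}_{n/F}$ is the set of isomorphism classes of degree $n$ étale algebras over $F$; for a subset $S$ its mass is $m(S)=\sum_{L\in S}\frac{1}{\#\mathrm{Aut}(L/F)}$, where $\mathrm{Aut}(L/F)$ is the group of $F$-algebra automorphisms. $\mathrm{Et}_{n/F}^{\mathcal{A}}$ is the set of $L\in\mathrm{Et}_{n/F}$ with $\mathcal{A}\subseteq N_{L/F}L^\times$. $k_\mathfrak{p}$ is the completion of $k$ at $\mathfrak{p}$, and $\mathcal{A}$ is viewed as a subgroup of $k_\mathfrak{p}^\times$. *)

theory Defs
  imports
    "Jordan_Normal_Form.VS_Connect"
    "HOL-Algebra.Generated_Groups"
    "HOL-Algebra.QuotRing"
    "HOL-Analysis.Abstract_Metric_Spaces"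
begin

text \<open>
  The number field and its completions are types of class \<open>field\<close>; they enter HOL-Algebra
  through \<open>class_ring\<close>. Algebras over them have explicit carriers, because sets of isomorphism
  classes of algebras are needed.
\<close>

section \<open>Number fields, infinite primes, completions\<close>

definition number_field :: "'k::field_char_0 itself \<Rightarrow> bool" where
  "number_field _ \<longleftrightarrow>
     (\<exists>B. finite_dimensional_vector_space (\<lambda>(q::rat) (x::'k). of_rat q * x) B)"

definition finitely_generated_subgroup :: "'a set \<Rightarrow> ('a, 'b) monoid_scheme \<Rightarrow> bool" where
  "finitely_generated_subgroup H G \<longleftrightarrow>
     subgroup H G \<and> (\<exists>S. finite S \<and> S \<subseteq> carrier G \<and> H = generate G S)"

definition absolute_value :: "('a::field \<Rightarrow> real) \<Rightarrow> bool" where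
  "absolute_value v \<longleftrightarrow>
     (\<forall>x. 0 \<le> v x) \<and> (\<forall>x. v x = 0 \<longleftrightarrow> x = 0) \<and>
     (\<forall>x y. v (x * y) = v x * v y) \<and> (\<forall>x y. v (x + y) \<le> v x + v y)"

definition archimedean :: "('a::field \<Rightarrow> real) \<Rightarrow> bool" where
  "archimedean v \<longleftrightarrow> \<not> (\<forall>x y. v (x + y) \<le> max (v x) (v y))"

definition equivalent_abs :: "('a::field \<Rightarrow> real) \<Rightarrow> ('a \<Rightarrow> real) \<Rightarrow> bool" where
  "equivalent_abs u v \<longleftrightarrow> (\<exists>s>0. \<forall>x. u x = v x powr s)"

definition infinite_prime :: "('k::field \<Rightarrow> real) set \<Rightarrow> bool" where
  "infinite_prime p \<longleftrightarrow>
     (\<exists>v. absolute_value v \<and> archimedean v \<and> p = {u. absolute_value u \<and> equivalent_abs u v})"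

text \<open>\<open>'c\<close> with the absolute value \<open>w\<close> and the embedding \<open>\<iota>\<close> is a completion of \<open>'k\<close> at \<open>p\<close>.\<close>

definition is_completion ::
  "('k::field \<Rightarrow> real) set \<Rightarrow> ('k \<Rightarrow> 'c::field) \<Rightarrow> ('c \<Rightarrow> real) \<Rightarrow> bool" where
  "is_completion p \<iota> w \<longleftrightarrow>
     absolute_value w \<and>
     field_hom \<iota> \<and>
     (\<lambda>x. w (\<iota> x)) \<in> p \<and>
     Metric_space.mcomplete UNIV (\<lambda>x y. w (x - y)) \<and>
     Metric_space.mtopology UNIV (\<lambda>x y. w (x - y)) closure_of range \<iota> = UNIV"


section \<open>Etale algebras\<close>

definition alg_iso :: "('c::field, 'l) module \<Rightarrow> ('c, 'm) module \<Rightarrow> ('l \<Rightarrow> 'm) set" where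
  "alg_iso L M =
     {\<phi> \<in> ring_iso L M. \<forall>a. \<forall>x\<in>carrier L. \<phi> (a \<odot>\<^bsub>L\<^esub> x) = a \<odot>\<^bsub>M\<^esub> \<phi> x}"

text \<open>Functions are restricted to the carrier, so that automorphisms are not counted repeatedly.\<close>

definition alg_aut :: "('c::field, 'l) module \<Rightarrow> ('l \<Rightarrow> 'l) set" where
  "alg_aut L = alg_iso L L \<inter> extensional (carrier L)"

definition prod_algebra :: "'i set \<Rightarrow> ('i \<Rightarrow> ('c::field, 'l) module) \<Rightarrow> ('c, 'i \<Rightarrow> 'l) module" where
  "prod_algebra I E =
     \<lparr> carrier = (\<Pi>\<^sub>E j\<in>I. carrier (E j)),
       mult = (\<lambda>x y. \<lambda>j\<in>I. x j \<otimes>\<^bsub>E j\<^esub> y j),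
       one = (\<lambda>j\<in>I. \<one>\<^bsub>E j\<^esub>),
       zero = (\<lambda>j\<in>I. \<zero>\<^bsub>E j\<^esub>),
       add = (\<lambda>x y. \<lambda>j\<in>I. x j \<oplus>\<^bsub>E j\<^esub> y j),
       smult = (\<lambda>a x. \<lambda>j\<in>I. a \<odot>\<^bsub>E j\<^esub> x j) \<rparr>"

definition alg_poly :: "('c::field, 'l) module \<Rightarrow> 'c poly \<Rightarrow> 'l \<Rightarrow> 'l" where
  "alg_poly E q x = (\<Oplus>\<^bsub>E\<^esub>i\<in>{..degree q}. coeff q i \<odot>\<^bsub>E\<^esub> (x [^]\<^bsub>E\<^esub> i))"

text \<open>The polynomial \<open>q\<close> below is, up to a constant factor, the minimal polynomial of \<open>x\<close>.\<close>

definition finite_separable_extension :: "('c::field, 'l) module \<Rightarrow> bool" where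
  "finite_separable_extension E \<longleftrightarrow>
     algebra class_ring E \<and> field E \<and> vectorspace.fin_dim class_ring E \<and>
     (\<forall>x\<in>carrier E. \<exists>q. Factorial_Ring.irreducible q \<and> alg_poly E q x = \<zero>\<^bsub>E\<^esub> \<and>
        coprime q (pderiv q))"

text \<open>
  The factors may be taken on the type of \<open>L\<close> itself: a factor of a product decomposition is
  isomorphic to an ideal of \<open>L\<close>.
\<close>

definition etale_algebra :: "('c::field, 'l) module \<Rightarrow> bool" where
  "etale_algebra L \<longleftrightarrow>
     algebra class_ring L \<and>
     (\<exists>(m::nat) (E :: nat \<Rightarrow> ('c, 'l) module).
        (\<forall>j<m. finite_separable_extension (E j)) \<and> alg_iso L (prod_algebra {..<m} E) \<noteq> {})"

text \<open>
  Isomorphism classes are formed among the algebras whose carrier is a subset of \<open>nat \<Rightarrow> 'c\<close>.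
  Every finite-dimensional algebra is isomorphic to one of these, by means of coordinates.
\<close>

definition etale_algebras :: "nat \<Rightarrow> ('c::field, nat \<Rightarrow> 'c) module set" where
  "etale_algebras n = {L. etale_algebra L \<and> vectorspace.dim class_ring L = n}"

definition Et :: "nat \<Rightarrow> ('c::field, nat \<Rightarrow> 'c) module set set" where
  "Et n = etale_algebras n //
     {(L, M). L \<in> etale_algebras n \<and> M \<in> etale_algebras n \<and> alg_iso L M \<noteq> {}}"

definition class_rep :: "'a set \<Rightarrow> 'a" where
  "class_rep C = (SOME L. L \<in> C)"

definition mass :: "('c::field, 'l) module set set \<Rightarrow> real" where
  "mass S = (\<Sum>C\<in>S. 1 / real (card (alg_aut (class_rep C))))"


section \<open>Norms\<close>

text \<open>\<open>M\<close> is the matrix of multiplication by \<open>x\<close> with respect to the ordered basis \<open>bs\<close>.\<close>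

definition mult_matrix :: "('c::field, 'l) module \<Rightarrow> 'l list \<Rightarrow> 'l \<Rightarrow> 'c mat \<Rightarrow> bool" where
  "mult_matrix L bs x M \<longleftrightarrow>
     distinct bs \<and> vectorspace.basis class_ring L (set bs) \<and>
     M \<in> carrier_mat (length bs) (length bs) \<and>
     (\<forall>j<length bs. x \<otimes>\<^bsub>L\<^esub> bs ! j = (\<Oplus>\<^bsub>L\<^esub>i\<in>{..<length bs}. M $$ (i, j) \<odot>\<^bsub>L\<^esub> bs ! i))"

definition alg_norm :: "('c::field, 'l) module \<Rightarrow> 'l \<Rightarrow> 'c" where
  "alg_norm L x = det (SOME M. \<exists>bs. mult_matrix L bs x M)"

definition Et_norm :: "nat \<Rightarrow> 'c::field set \<Rightarrow> ('c, nat \<Rightarrow> 'c) module set set" where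
  "Et_norm n A = {C \<in> Et n. A \<subseteq> alg_norm (class_rep C) ` Units (class_rep C)}"

end

theory Submission
  imports
    "HOL-Computational_Algebra.Fundamental_Theorem_Algebra"
    "HOL-Analysis.Complex_Analysis_Basics"
    "HOL-Combinatorics.Permutations"
    Defs
begin

text \<open>
  Since every absolute value in the class \<open>p\<close> is a power of \<open>\<lambda>x. cmod (f x)\<close>, the
  embedding \<open>f\<close> extends by continuity to an embedding \<open>h\<close> of the completion into the complex
  numbers, and its range is the closure of the range of \<open>f\<close>. That closure is \<open>\<real>\<close> if \<open>f\<close> is real and
  the whole plane otherwise (\<open>completion_embedding\<close>). All other arguments concern a field \<open>'c\<close>
  with an embedding \<open>h\<close> onto the real or the complex numbers: the locale \<open>real_or_complex_field\<close>.

  Over such a field an irreducible polynomial has degree at most two, so a finite separable extension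
  is \<open>'c\<close> itself or a copy of the complex numbers (\<open>finite_separable_extension_cases\<close>). An etale
  algebra of degree \<open>n\<close> is therefore isomorphic to \<open>\<real>\<^bsup>n-2s\<^esup> \<times> \<complex>\<^bsup>s\<^esup> \<close> for some \<open>s \<le> n/2\<close>, where only \<open>s = 0\<close>
  occurs over the complex numbers, read as \<open>\<complex>\<^bsup>n\<^esup> \<close>. These products are realised as algebras of
  complex-valued functions (\<open>model\<close>).

  A homomorphism from such a function algebra to the complex numbers is evaluation at a point,
  possibly followed by complex conjugation (\<open>model_character\<close>). Isomorphisms between models are
  thus permutations of the factors combined with conjugations of complex factors. It follows that
  \<open>s\<close> is an invariant of the algebra and that the algebra has \<open>s! (n-2s)! 2\<^sup>s\<close> automorphisms
  (\<open>card_aut_model\<close>).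

  It remains to decide which of these algebras have all of the given elements as norms. If there is a
  real factor (or a factor \<open>'c = \<complex>\<close>), every nonzero element is the norm of a unit that is trivial
  outside that factor. If all factors are proper complex extensions of the real field, every unit is
  a square, so its norm is a positive number; conversely a positive number is the norm of its real
  \<open>n\<close>-th root. Hence the condition excludes at most the signature \<open>n = 2s\<close>, and exactly when some
  given element is negative (\<open>norm_image_contains_iff\<close>). Summing the reciprocals of the automorphism
  numbers over the remaining values of \<open>s\<close> gives the formula (\<open>mass_Et_norm\<close>).
\<close>

section \<open>Commutative algebras over a field\<close>

text \<open>
  The axioms of the locale \<open>algebra\<close> mention the operations of the record \<open>class_ring\<close>. They are
  restated here in terms of the field operations of \<open>'c\<close>, which the simplifier handles better.
\<close>

locale class_algebra =
  fixes L :: "('c::field, 'l) module" (structure)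
  assumes algebra: "algebra class_ring L"
begin

sublocale cring L
  using algebra by (rule algebra.axioms)

lemma vectorspace: "vectorspace class_ring L"
  using algebra class_field by (auto simp: vectorspace_def intro: algebra.module)

lemma scale_closed [simp, intro]: "x \<in> carrier L \<Longrightarrow> a \<odot> x \<in> carrier L"
  and scale_add_left: "x \<in> carrier L \<Longrightarrow> (a + b) \<odot> x = a \<odot> x \<oplus> b \<odot> x"
  and scale_add_right: "\<lbrakk>x \<in> carrier L; y \<in> carrier L\<rbrakk> \<Longrightarrow> a \<odot> (x \<oplus> y) = a \<odot> x \<oplus> a \<odot> y"
  and scale_scale [simp]: "x \<in> carrier L \<Longrightarrow> a \<odot> (b \<odot> x) = (a * b) \<odot> x"
  and scale_one [simp]: "x \<in> carrier L \<Longrightarrow> 1 \<odot> x = x"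
  and scale_mult_left: "\<lbrakk>x \<in> carrier L; y \<in> carrier L\<rbrakk> \<Longrightarrow> (a \<odot> x) \<otimes> y = a \<odot> (x \<otimes> y)"
  using module.smult_closed[OF algebra.axioms(1)[OF algebra]]
    module.smult_l_distr[OF algebra.axioms(1)[OF algebra]]
    module.smult_r_distr[OF algebra.axioms(1)[OF algebra]]
    module.smult_assoc1[OF algebra.axioms(1)[OF algebra]]
    module.smult_one[OF algebra.axioms(1)[OF algebra]]
    algebra.smult_assoc2[OF algebra]
  by auto

lemma scale_mult_right: "\<lbrakk>x \<in> carrier L; y \<in> carrier L\<rbrakk> \<Longrightarrow> x \<otimes> (a \<odot> y) = a \<odot> (x \<otimes> y)"
  by (metis scale_closed scale_mult_left m_comm)

lemma scale_zero_left [simp]: "x \<in> carrier L \<Longrightarrow> 0 \<odot> x = \<zero>"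
  using module.smult_l_null[OF algebra.axioms(1)[OF algebra]] by auto

lemma scale_zero_right [simp]: "a \<odot> \<zero> = \<zero>"
  using module.smult_r_null[OF algebra.axioms(1)[OF algebra]] by auto

lemma scale_minus_left: "x \<in> carrier L \<Longrightarrow> (- a) \<odot> x = \<ominus> (a \<odot> x)"
proof -
  assume x: "x \<in> carrier L"
  have "(- a) \<odot> x \<oplus> a \<odot> x = \<zero>"
    using scale_add_left[OF x, of "- a" a] x by simp
  then show ?thesis
    using x by (intro minus_equality[symmetric]) auto
qed

lemma scale_sum:
  assumes "finite T" "f \<in> T \<rightarrow> carrier L"
  shows "a \<odot> finsum L f T = (\<Oplus>i\<in>T. a \<odot> f i)"
  using assms
proof (induction T rule: finite_induct)
  case (insert t T)
  then have "f \<in> T \<rightarrow> carrier L" "f t \<in> carrier L" "(\<lambda>i. a \<odot> f i) \<in> T \<rightarrow> carrier L" by auto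
  then show ?case using insert by (simp add: scale_add_right)
qed simp

lemma sum_scale:
  assumes "finite T" "x \<in> carrier L"
  shows "(\<Sum>i\<in>T. c i) \<odot> x = (\<Oplus>i\<in>T. c i \<odot> x)"
  using assms
proof (induction T rule: finite_induct)
  case (insert t T)
  then have "(\<lambda>i. c i \<odot> x) \<in> T \<rightarrow> carrier L" by auto
  then show ?case using insert by (simp add: scale_add_left)
qed simp

lemma finsum_delta:
  assumes "finite T" "b \<in> T \<rightarrow> carrier L" "s \<in> T"
  shows "(\<Oplus>i\<in>T. (if i = s then a else 0) \<odot> b i) = a \<odot> b s"
proof -
  have "(\<Oplus>i\<in>T. (if i = s then a else 0) \<odot> b i) = (\<Oplus>i\<in>T. (if s = i then a \<odot> b i else \<zero>))"
    using assms by (intro finsum_cong') (auto simp: Pi_iff)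
  also have "\<dots> = a \<odot> b s"
    using assms by (intro finsum_singleton) (auto simp: Pi_iff)
  finally show ?thesis .
qed

lemma finsum_swap:
  assumes "finite S" "finite T" "\<And>s t. s \<in> S \<Longrightarrow> t \<in> T \<Longrightarrow> f s t \<in> carrier L"
  shows "(\<Oplus>s\<in>S. \<Oplus>t\<in>T. f s t) = (\<Oplus>t\<in>T. \<Oplus>s\<in>S. f s t)"
  using assms(1,3)
proof (induction S rule: finite_induct)
  case empty
  have "(\<Oplus>t\<in>T. \<zero>) = \<zero>" using assms(2) by (intro finsum_zero) 
  then show ?case by simp
next
  case (insert s S)
  have "(\<Oplus>s'\<in>insert s S. \<Oplus>t\<in>T. f s' t) = (\<Oplus>t\<in>T. f s t) \<oplus> (\<Oplus>s'\<in>S. \<Oplus>t\<in>T. f s' t)"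
    using insert by (intro finsum_insert) (auto intro!: finsum_closed)
  also have "\<dots> = (\<Oplus>t\<in>T. f s t) \<oplus> (\<Oplus>t\<in>T. \<Oplus>s'\<in>S. f s' t)"
    using insert by auto
  also have "\<dots> = (\<Oplus>t\<in>T. f s t \<oplus> (\<Oplus>s'\<in>S. f s' t))"
    using insert assms(2) by (intro finsum_addf[symmetric]) (auto intro!: finsum_closed)
  also have "\<dots> = (\<Oplus>t\<in>T. \<Oplus>s'\<in>insert s S. f s' t)"
    using insert assms(2)
    by (intro finsum_cong' finsum_insert[symmetric]) (auto intro!: finsum_closed)
  finally show ?case .
qed

end

lemma class_algebra_iff: "class_algebra L \<longleftrightarrow> algebra class_ring L"
  by (auto simp: class_algebra_def)

section \<open>Isomorphisms and transport of structure\<close>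

lemma alg_iso_closed: "\<phi> \<in> alg_iso L M \<Longrightarrow> x \<in> carrier L \<Longrightarrow> \<phi> x \<in> carrier M"
  and alg_iso_mult: "\<phi> \<in> alg_iso L M \<Longrightarrow> x \<in> carrier L \<Longrightarrow> y \<in> carrier L \<Longrightarrow>
    \<phi> (x \<otimes>\<^bsub>L\<^esub> y) = \<phi> x \<otimes>\<^bsub>M\<^esub> \<phi> y"
  and alg_iso_add: "\<phi> \<in> alg_iso L M \<Longrightarrow> x \<in> carrier L \<Longrightarrow> y \<in> carrier L \<Longrightarrow>
    \<phi> (x \<oplus>\<^bsub>L\<^esub> y) = \<phi> x \<oplus>\<^bsub>M\<^esub> \<phi> y"
  and alg_iso_one: "\<phi> \<in> alg_iso L M \<Longrightarrow> \<phi> \<one>\<^bsub>L\<^esub> = \<one>\<^bsub>M\<^esub>"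
  and alg_iso_smult: "\<phi> \<in> alg_iso L M \<Longrightarrow> x \<in> carrier L \<Longrightarrow> \<phi> (a \<odot>\<^bsub>L\<^esub> x) = a \<odot>\<^bsub>M\<^esub> \<phi> x"
  and alg_iso_bij: "\<phi> \<in> alg_iso L M \<Longrightarrow> bij_betw \<phi> (carrier L) (carrier M)"
  by (auto simp: alg_iso_def dest: ring_iso_memE)

lemma alg_isoI:
  assumes "\<And>x. x \<in> carrier L \<Longrightarrow> \<phi> x \<in> carrier M"
    and "\<And>x y. x \<in> carrier L \<Longrightarrow> y \<in> carrier L \<Longrightarrow> \<phi> (x \<otimes>\<^bsub>L\<^esub> y) = \<phi> x \<otimes>\<^bsub>M\<^esub> \<phi> y"
    and "\<And>x y. x \<in> carrier L \<Longrightarrow> y \<in> carrier L \<Longrightarrow> \<phi> (x \<oplus>\<^bsub>L\<^esub> y) = \<phi> x \<oplus>\<^bsub>M\<^esub> \<phi> y"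
    and "\<phi> \<one>\<^bsub>L\<^esub> = \<one>\<^bsub>M\<^esub>"
    and "\<And>a x. x \<in> carrier L \<Longrightarrow> \<phi> (a \<odot>\<^bsub>L\<^esub> x) = a \<odot>\<^bsub>M\<^esub> \<phi> x"
    and "bij_betw \<phi> (carrier L) (carrier M)"
  shows "\<phi> \<in> alg_iso L M"
  using assms by (auto simp: alg_iso_def intro!: ring_iso_memI)

lemma alg_iso_id: "id \<in> alg_iso L L"
  by (rule alg_isoI) auto

lemma alg_iso_trans:
  assumes "\<phi> \<in> alg_iso L M" "\<psi> \<in> alg_iso M N"
  shows "\<psi> \<circ> \<phi> \<in> alg_iso L N"
  using assms
  by (intro alg_isoI)
    (auto simp: alg_iso_mult alg_iso_add alg_iso_one alg_iso_smult alg_iso_closed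
      intro: bij_betw_trans alg_iso_bij)

lemma alg_iso_cong:
  assumes "\<phi> \<in> alg_iso L M" "class_algebra L" "\<And>x. x \<in> carrier L \<Longrightarrow> \<psi> x = \<phi> x"
  shows "\<psi> \<in> alg_iso L M"
proof -
  interpret class_algebra L by fact
  have "bij_betw \<psi> (carrier L) (carrier M)"
    using alg_iso_bij[OF assms(1)] assms(3) by (simp cong: bij_betw_cong)
  with assms show ?thesis
    by (intro alg_isoI)
      (auto simp: alg_iso_mult alg_iso_add alg_iso_one alg_iso_smult alg_iso_closed)
qed

lemma alg_iso_sym:
  assumes "\<phi> \<in> alg_iso L M" "class_algebra L"
  shows "inv_into (carrier L) \<phi> \<in> alg_iso M L"
proof -
  interpret class_algebra L by fact
  let ?g = "inv_into (carrier L) \<phi>"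
  note bij = alg_iso_bij[OF assms(1)]
  have g: "?g y \<in> carrier L" "\<phi> (?g y) = y" if "y \<in> carrier M" for y
    using bij that by (auto simp: bij_betw_def f_inv_into_f inv_into_into)
  have gI: "?g y = x" if "x \<in> carrier L" "\<phi> x = y" for x y
    using bij that by (auto simp: bij_betw_def)
  show ?thesis
  proof (rule alg_isoI)
    show "bij_betw ?g (carrier M) (carrier L)" by (rule bij_betw_inv_into[OF bij])
  qed (use g assms in \<open>auto intro!: gI simp: alg_iso_mult alg_iso_add alg_iso_one alg_iso_smult\<close>)
qed

text \<open>
  The zero of \<open>M\<close> is assumed to be the image of zero, because a ring isomorphism in the sense of
  \<^const>\<open>ring_iso\<close> says nothing about zero as long as \<open>M\<close> is not known to be a ring.
\<close>

lemma alg_iso_algebra: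
  assumes \<phi>: "\<phi> \<in> alg_iso L M" and "class_algebra L" and zero: "\<phi> \<zero>\<^bsub>L\<^esub> = \<zero>\<^bsub>M\<^esub>"
  shows "class_algebra M"
proof -
  interpret class_algebra L by fact
  have "cring (M\<lparr>zero := \<phi> \<zero>\<^bsub>L\<^esub>\<rparr>)"
    using \<phi> by (intro ring_iso_imp_img_cring) (auto simp: alg_iso_def)
  then have M: "cring M" by (simp add: zero)
  have ex: "\<exists>x\<in>carrier L. y = \<phi> x" if "y \<in> carrier M" for y
    using alg_iso_bij[OF \<phi>] that by (auto simp: bij_betw_def)
  note [simp] = alg_iso_closed[OF \<phi>] alg_iso_mult[OF \<phi>, symmetric] alg_iso_add[OF \<phi>, symmetric]
    alg_iso_smult[OF \<phi>, symmetric]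
  have "algebra class_ring M"
    by (rule algebraI[OF class_cring.is_cring M])
      (auto dest!: ex simp: scale_add_left scale_add_right scale_mult_left)
  then show ?thesis by (simp add: class_algebra_iff)
qed

lemma alg_iso_zero:
  assumes "\<phi> \<in> alg_iso L M" "class_algebra L" "class_algebra M"
  shows "\<phi> \<zero>\<^bsub>L\<^esub> = \<zero>\<^bsub>M\<^esub>"
proof -
  interpret L: class_algebra L by fact
  interpret M: class_algebra M by fact
  show ?thesis
    using alg_iso_smult[OF assms(1) L.zero_closed, of 0] alg_iso_closed[OF assms(1) L.zero_closed]
    by simp
qed

lemma alg_iso_finsum:
  assumes "\<phi> \<in> alg_iso L M" "class_algebra L" "class_algebra M" "finite T" "f \<in> T \<rightarrow> carrier L"
  shows "\<phi> (finsum L f T) = (\<Oplus>\<^bsub>M\<^esub>i\<in>T. \<phi> (f i))"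
proof -
  interpret L: class_algebra L by fact
  interpret M: class_algebra M by fact
  show ?thesis using assms(4,5)
  proof (induction T rule: finite_induct)
    case (insert t T)
    then have "f \<in> T \<rightarrow> carrier L" "f t \<in> carrier L" "(\<lambda>i. \<phi> (f i)) \<in> T \<rightarrow> carrier M"
      using alg_iso_closed[OF assms(1)] by auto
    then show ?case using insert alg_iso_closed[OF assms(1)]
      by (simp add: alg_iso_add[OF assms(1)])
  qed (use assms alg_iso_zero in auto)
qed

text \<open>
  Conjugation with \<open>\<phi>\<close>. Automorphisms are restricted to carriers, so the conjugate has to be
  restricted again.
\<close>

lemma card_alg_aut_iso:
  assumes \<phi>: "\<phi> \<in> alg_iso L M" and L: "class_algebra L" and M: "class_algebra M"
  shows "card (alg_aut L) = card (alg_aut M)"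
proof -
  define \<psi> where "\<psi> = inv_into (carrier L) \<phi>"
  have \<psi>: "\<psi> \<in> alg_iso M L" unfolding \<psi>_def using \<phi> L by (rule alg_iso_sym)
  have inv1: "\<psi> (\<phi> x) = x" if "x \<in> carrier L" for x
    using alg_iso_bij[OF \<phi>] that by (auto simp: \<psi>_def bij_betw_def)
  have inv2: "\<phi> (\<psi> x) = x" if "x \<in> carrier M" for x
    using alg_iso_bij[OF \<phi>] that by (auto simp: \<psi>_def bij_betw_def f_inv_into_f)
  let ?F = "\<lambda>\<alpha>. restrict (\<phi> \<circ> \<alpha> \<circ> \<psi>) (carrier M)"
  let ?G = "\<lambda>\<beta>. restrict (\<psi> \<circ> \<beta> \<circ> \<phi>) (carrier L)"
  have "bij_betw ?F (alg_aut L) (alg_aut M)"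
  proof (rule bij_betwI[where g = ?G])
    show "?F \<in> alg_aut L \<rightarrow> alg_aut M"
    proof
      fix \<alpha> assume "\<alpha> \<in> alg_aut L"
      then have "\<phi> \<circ> \<alpha> \<circ> \<psi> \<in> alg_iso M M"
        using \<phi> \<psi> by (auto simp: alg_aut_def comp_assoc intro!: alg_iso_trans)
      then have "?F \<alpha> \<in> alg_iso M M" by (rule alg_iso_cong[OF _ M]) simp
      then show "?F \<alpha> \<in> alg_aut M" by (simp add: alg_aut_def)
    qed
    show "?G \<in> alg_aut M \<rightarrow> alg_aut L"
    proof
      fix \<beta> assume "\<beta> \<in> alg_aut M"
      then have "\<psi> \<circ> \<beta> \<circ> \<phi> \<in> alg_iso L L"
        using \<phi> \<psi> by (auto simp: alg_aut_def comp_assoc intro!: alg_iso_trans)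
      then have "?G \<beta> \<in> alg_iso L L" by (rule alg_iso_cong[OF _ L]) simp
      then show "?G \<beta> \<in> alg_aut L" by (simp add: alg_aut_def)
    qed
    show "?G (?F \<alpha>) = \<alpha>" if "\<alpha> \<in> alg_aut L" for \<alpha>
      using that inv1 alg_iso_closed[OF \<phi>]
      by (auto simp: alg_aut_def fun_eq_iff restrict_def extensional_def alg_iso_closed)
    show "?F (?G \<beta>) = \<beta>" if "\<beta> \<in> alg_aut M" for \<beta>
      using that inv2 alg_iso_closed[OF \<psi>]
      by (auto simp: alg_aut_def fun_eq_iff restrict_def extensional_def alg_iso_closed)
  qed
  then show ?thesis by (rule bij_betw_same_card)
qed

text \<open>
  Isomorphism classes are formed among algebras with carriers in a fixed type, so algebras of complex
  functions have to be moved there along an injection.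
\<close>

definition copy_algebra :: "('l \<Rightarrow> 'm) \<Rightarrow> ('c::field, 'l) module \<Rightarrow> ('c, 'm) module" where
  "copy_algebra g L = (let d = inv_into (carrier L) g in
     \<lparr> carrier = g ` carrier L,
       mult = (\<lambda>x y. g (d x \<otimes>\<^bsub>L\<^esub> d y)),
       one = g \<one>\<^bsub>L\<^esub>,
       zero = g \<zero>\<^bsub>L\<^esub>,
       add = (\<lambda>x y. g (d x \<oplus>\<^bsub>L\<^esub> d y)),
       smult = (\<lambda>a x. g (a \<odot>\<^bsub>L\<^esub> d x)) \<rparr>)"

lemma copy_algebra_iso:
  assumes "inj_on g (carrier L)"
  shows "g \<in> alg_iso L (copy_algebra g L)"
  using assms
  by (intro alg_isoI) (auto simp: copy_algebra_def Let_def bij_betw_def)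

lemma copy_algebra_algebra:
  assumes "inj_on g (carrier L)" "class_algebra L"
  shows "class_algebra (copy_algebra g L)"
  by (rule alg_iso_algebra[OF copy_algebra_iso[OF assms(1)] assms(2)])
    (simp add: copy_algebra_def Let_def)

lemma field_alg_iso:
  assumes "field L" "\<phi> \<in> alg_iso L M" "class_algebra L" "class_algebra M"
  shows "field M"
proof -
  have "field (M\<lparr>zero := \<phi> \<zero>\<^bsub>L\<^esub>\<rparr>)"
    using assms by (intro field.ring_iso_imp_img_field) (auto simp: alg_iso_def)
  then show ?thesis using alg_iso_zero[OF assms(2-4)] by simp
qed

lemma alg_poly_iso:
  assumes "\<phi> \<in> alg_iso L M" "class_algebra L" "class_algebra M" "x \<in> carrier L"
  shows "\<phi> (alg_poly L q x) = alg_poly M q (\<phi> x)"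
proof -
  interpret L: class_algebra L by fact
  interpret M: class_algebra M by fact
  have pow: "\<phi> (x [^]\<^bsub>L\<^esub> i) = \<phi> x [^]\<^bsub>M\<^esub> i" for i :: nat
    by (induction i) (use assms in \<open>auto simp: alg_iso_one alg_iso_mult\<close>)
  have "\<phi> (alg_poly L q x) = (\<Oplus>\<^bsub>M\<^esub>i\<in>{..degree q}. \<phi> (coeff q i \<odot>\<^bsub>L\<^esub> (x [^]\<^bsub>L\<^esub> i)))"
    unfolding alg_poly_def using assms by (intro alg_iso_finsum) auto
  also have "\<dots> = alg_poly M q (\<phi> x)"
    unfolding alg_poly_def using assms 
    by (intro M.finsum_cong') (auto simp: alg_iso_smult pow alg_iso_closed)
  finally show ?thesis .
qed

section \<open>Bases, dimension and the norm\<close>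

text \<open>
  A basis as an indexed family. Products of algebras and matrices both come with index sets, and
  indexed linear combinations avoid the sums over sets of vectors that occur in
  \<^const>\<open>vectorspace.basis\<close>; \<open>coordinates_iff_basis\<close> translates.
\<close>

definition coordinates :: "('c::field, 'l) module \<Rightarrow> 'i set \<Rightarrow> ('i \<Rightarrow> 'l) \<Rightarrow> bool" where
  "coordinates L T b \<longleftrightarrow> finite T \<and> b \<in> T \<rightarrow> carrier L \<and>
     (\<forall>v\<in>carrier L. \<exists>c. v = (\<Oplus>\<^bsub>L\<^esub>i\<in>T. c i \<odot>\<^bsub>L\<^esub> b i)) \<and>
     (\<forall>c. (\<Oplus>\<^bsub>L\<^esub>i\<in>T. c i \<odot>\<^bsub>L\<^esub> b i) = \<zero>\<^bsub>L\<^esub> \<longrightarrow> (\<forall>i\<in>T. c i = 0))"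

lemma coordinatesI:
  assumes "finite T" "\<And>i. i \<in> T \<Longrightarrow> b i \<in> carrier L"
    and "\<And>v. v \<in> carrier L \<Longrightarrow> \<exists>c. v = (\<Oplus>\<^bsub>L\<^esub>i\<in>T. c i \<odot>\<^bsub>L\<^esub> b i)"
    and "\<And>c i. (\<Oplus>\<^bsub>L\<^esub>i\<in>T. c i \<odot>\<^bsub>L\<^esub> b i) = \<zero>\<^bsub>L\<^esub> \<Longrightarrow> i \<in> T \<Longrightarrow> c i = 0"
  shows "coordinates L T b"
  unfolding coordinates_def by (intro conjI ballI allI impI Pi_I assms)

lemma
  assumes "coordinates L T b"
  shows coordinates_finite: "finite T"
    and coordinates_closed: "b \<in> T \<rightarrow> carrier L"
    and coordinates_span: "\<And>v. v \<in> carrier L \<Longrightarrow> \<exists>c. v = (\<Oplus>\<^bsub>L\<^esub>i\<in>T. c i \<odot>\<^bsub>L\<^esub> b i)"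
    and coordinates_indep: "\<And>c i. (\<Oplus>\<^bsub>L\<^esub>i\<in>T. c i \<odot>\<^bsub>L\<^esub> b i) = \<zero>\<^bsub>L\<^esub> \<Longrightarrow> i \<in> T \<Longrightarrow> c i = 0"
  using assms unfolding coordinates_def by simp_all

lemma coordinates_span_family:
  assumes "coordinates L T b" "\<And>j. j \<in> S \<Longrightarrow> v j \<in> carrier L"
  shows "\<exists>c. \<forall>j\<in>S. v j = (\<Oplus>\<^bsub>L\<^esub>i\<in>T. c j i \<odot>\<^bsub>L\<^esub> b i)"
proof -
  have "\<forall>j\<in>S. \<exists>c. v j = (\<Oplus>\<^bsub>L\<^esub>i\<in>T. c i \<odot>\<^bsub>L\<^esub> b i)"
    using coordinates_span[OF assms(1)] assms(2) by simp
  from bchoice[OF this] show ?thesis .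
qed

lemma (in class_algebra) coordinates_unique:
  assumes "coordinates L T b" "(\<Oplus>i\<in>T. c i \<odot> b i) = (\<Oplus>i\<in>T. d i \<odot> b i)" "i \<in> T"
  shows "c i = d i"
proof -
  have b: "finite T" "\<And>i. i \<in> T \<Longrightarrow> b i \<in> carrier L"
    using coordinates_finite[OF assms(1)] coordinates_closed[OF assms(1)] by auto
  have closed: "(\<Oplus>i\<in>T. e i \<odot> b i) \<in> carrier L" for e
    using b by (intro finsum_closed) auto
  have "(\<Oplus>i\<in>T. (c i - d i) \<odot> b i) \<oplus> (\<Oplus>i\<in>T. d i \<odot> b i) =
      (\<Oplus>i\<in>T. (c i - d i) \<odot> b i \<oplus> d i \<odot> b i)"
    using b by (intro finsum_addf[symmetric]) auto
  also have "\<dots> = (\<Oplus>i\<in>T. c i \<odot> b i)"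
    using b by (intro finsum_cong') (auto simp flip: scale_add_left)
  finally have "(\<Oplus>i\<in>T. (c i - d i) \<odot> b i) = \<zero>"
    using assms(2) closed by (metis add.r_cancel_one')
  from coordinates_indep[OF assms(1) this assms(3)] show ?thesis by simp
qed

lemma (in class_algebra) coordinates_inj:
  assumes "coordinates L T b"
  shows "inj_on b T"
proof
  fix s t assume st: "s \<in> T" "t \<in> T" "b s = b t"
  have b: "finite T" "b \<in> T \<rightarrow> carrier L"
    using coordinates_finite[OF assms(1)] coordinates_closed[OF assms(1)] by auto
  have "(\<Oplus>i\<in>T. (if i = s then 1 else 0) \<odot> b i) = (\<Oplus>i\<in>T. (if i = t then 1 else 0) \<odot> b i)"
    using st by (simp add: finsum_delta[OF b])
  from coordinates_unique[OF assms this st(1)] show "s = t"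
    by (simp split: if_splits)
qed

lemma ex1_implies_eq: "\<exists>!x. P x \<Longrightarrow> P y \<Longrightarrow> P z \<Longrightarrow> y = z"
  by blast

lemma (in class_algebra) coordinates_iff_basis:
  assumes T: "finite T" "b \<in> T \<rightarrow> carrier L" and inj: "inj_on b T"
  shows "coordinates L T b \<longleftrightarrow> vectorspace.basis class_ring L (b ` T)"
proof -
  note crit = vectorspace.basis_criterion[OF vectorspace, of "b ` T"]
  have "Module.module class_ring L" using vectorspace by (simp add: vectorspace_def)
  note lincomb_def = module.lincomb_def[OF this]
  have lc: "module.lincomb L a (b ` T) = (\<Oplus>i\<in>T. a (b i) \<odot> b i)" for a
    unfolding lincomb_def using T inj by (intro finsum_reindex) auto
  have lc': "module.lincomb L (restrict (\<lambda>y. c (inv_into T b y)) (b ` T)) (b ` T) =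
      (\<Oplus>i\<in>T. c i \<odot> b i)" for c
    unfolding lc using T inj by (intro finsum_cong') auto
  show ?thesis
  proof
    assume co: "coordinates L T b"
    have "\<exists>!a. a \<in> b ` T \<rightarrow>\<^sub>E UNIV \<and> module.lincomb L a (b ` T) = v" if "v \<in> carrier L" for v
    proof -
      obtain c where c: "v = (\<Oplus>i\<in>T. c i \<odot> b i)"
        using coordinates_span[OF co \<open>v \<in> carrier L\<close>] by (rule exE)
      show ?thesis
      proof (rule ex1I[of _ "restrict (\<lambda>y. c (inv_into T b y)) (b ` T)"])
        fix a assume a: "a \<in> b ` T \<rightarrow>\<^sub>E UNIV \<and> module.lincomb L a (b ` T) = v"
        then have "(\<Oplus>i\<in>T. a (b i) \<odot> b i) = (\<Oplus>i\<in>T. c i \<odot> b i)" by (simp add: lc c)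
        then have "a (b i) = c i" if "i \<in> T" for i by (rule coordinates_unique[OF co]) (fact that)
        then show "a = restrict (\<lambda>y. c (inv_into T b y)) (b ` T)"
          using a inj by (auto simp: fun_eq_iff restrict_def PiE_def extensional_def)
      qed (use c lc' in auto)
    qed
    then show "vectorspace.basis class_ring L (b ` T)"
      by (subst crit) (use T in auto)
  next
    assume "vectorspace.basis class_ring L (b ` T)"
    then have ex1: "\<exists>!a. a \<in> b ` T \<rightarrow>\<^sub>E UNIV \<and> module.lincomb L a (b ` T) = v"
      if "v \<in> carrier L" for v
      by (subst (asm) crit) (use T that in auto)
    have indep: "c i = 0" if c: "(\<Oplus>i\<in>T. c i \<odot> b i) = \<zero>" and i: "i \<in> T" for c i
    proof -
      have "(\<Oplus>i\<in>T. 0 \<odot> b i) = (\<Oplus>i\<in>T. \<zero>)"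
        using T by (intro finsum_cong') (auto simp: Pi_iff)
      then have 0: "(\<Oplus>i\<in>T. 0 \<odot> b i) = \<zero>" using T by simp
      have "restrict (\<lambda>y. c (inv_into T b y)) (b ` T) = restrict (\<lambda>y. 0) (b ` T)"
        by (rule ex1_implies_eq[OF ex1[OF zero_closed]])
          (use lc'[of c] lc'[of "\<lambda>_. 0"] c 0 in auto)
      from fun_cong[OF this, of "b i"] show ?thesis using i inj by simp
    qed
    show "coordinates L T b"
    proof (rule coordinatesI)
      fix v assume "v \<in> carrier L"
      from ex1_implies_ex[OF ex1[OF this]]
      obtain a where "a \<in> b ` T \<rightarrow>\<^sub>E UNIV \<and> module.lincomb L a (b ` T) = v" ..
      then show "\<exists>c. v = (\<Oplus>i\<in>T. c i \<odot> b i)"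
        by (intro exI[of _ "\<lambda>i. a (b i)"]) (simp add: lc)
    qed (use T indep in auto)
  qed
qed

lemma (in class_algebra) coordinates_basis:
  assumes "coordinates L T b"
  shows "vectorspace.basis class_ring L (b ` T)"
    and "vectorspace.dim class_ring L = card T"
    and "vectorspace.fin_dim class_ring L"
proof -
  have T: "finite T" "b \<in> T \<rightarrow> carrier L" using coordinates_finite[OF assms] coordinates_closed[OF assms] by auto
  note inj = coordinates_inj[OF assms]
  show basis: "vectorspace.basis class_ring L (b ` T)"
    using coordinates_iff_basis[OF T inj] assms by simp
  show "vectorspace.dim class_ring L = card T"
    using vectorspace.dim_basis[OF vectorspace _ basis] T card_image[OF inj] by simp
  show "vectorspace.fin_dim class_ring L"
    using basis T unfolding vectorspace.fin_dim_def[OF vectorspace] vectorspace.basis_def[OF vectorspace]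
    by blast
qed

lemma (in class_algebra) fin_dim_coordinates:
  assumes "vectorspace.fin_dim class_ring L"
  obtains bs where "coordinates L {..<length bs} ((!) bs)"
proof -
  obtain B where B: "finite B" "vectorspace.basis class_ring L B"
    using vectorspace.finite_basis_exists[OF vectorspace assms] by blast
  obtain bs where bs: "set bs = B" "distinct bs" using finite_distinct_list[OF B(1)] by blast
  have "(!) bs ` {..<length bs} = B" using bs by (auto simp: set_conv_nth)
  moreover have "B \<subseteq> carrier L" using B vectorspace.basis_def[OF vectorspace] by blast
  moreover have "inj_on ((!) bs) {..<length bs}" using bs by (auto intro: inj_on_nth)
  ultimately have "coordinates L {..<length bs} ((!) bs)"
    using B by (subst coordinates_iff_basis) auto
  then show ?thesis by (rule that)
qed

lemma coordinates_iso:
  assumes co: "coordinates L T b" and \<phi>: "\<phi> \<in> alg_iso L M"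
    and L: "class_algebra L" and M: "class_algebra M"
  shows "coordinates M T (\<lambda>i. \<phi> (b i))"
proof -
  interpret L: class_algebra L by fact
  interpret M: class_algebra M by fact
  have T: "finite T" "b \<in> T \<rightarrow> carrier L" using coordinates_finite[OF co] coordinates_closed[OF co] by auto
  have sum: "(\<Oplus>\<^bsub>M\<^esub>i\<in>T. c i \<odot>\<^bsub>M\<^esub> \<phi> (b i)) = \<phi> (\<Oplus>\<^bsub>L\<^esub>i\<in>T. c i \<odot>\<^bsub>L\<^esub> b i)" for c
  proof -
    have "\<phi> (\<Oplus>\<^bsub>L\<^esub>i\<in>T. c i \<odot>\<^bsub>L\<^esub> b i) = (\<Oplus>\<^bsub>M\<^esub>i\<in>T. \<phi> (c i \<odot>\<^bsub>L\<^esub> b i))"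
      using T by (intro alg_iso_finsum[OF \<phi> L M]) auto
    also have "\<dots> = (\<Oplus>\<^bsub>M\<^esub>i\<in>T. c i \<odot>\<^bsub>M\<^esub> \<phi> (b i))"
      using T by (intro M.finsum_cong') (auto simp: alg_iso_smult[OF \<phi>] alg_iso_closed[OF \<phi>] Pi_iff)
    finally show ?thesis by simp
  qed
  have bij: "bij_betw \<phi> (carrier L) (carrier M)" using \<phi> by (rule alg_iso_bij)
  show ?thesis
  proof (rule coordinatesI, unfold sum)
    fix v assume "v \<in> carrier M"
    then obtain u where u: "u \<in> carrier L" "v = \<phi> u" using bij by (auto simp: bij_betw_def)
    obtain c where "u = (\<Oplus>\<^bsub>L\<^esub>i\<in>T. c i \<odot>\<^bsub>L\<^esub> b i)" using coordinates_span[OF co u(1)] ..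
    then show "\<exists>c. v = \<phi> (\<Oplus>\<^bsub>L\<^esub>i\<in>T. c i \<odot>\<^bsub>L\<^esub> b i)" using u(2) by (intro exI[of _ c]) simp
  next
    fix c i assume c: "\<phi> (\<Oplus>\<^bsub>L\<^esub>i\<in>T. c i \<odot>\<^bsub>L\<^esub> b i) = \<zero>\<^bsub>M\<^esub>" and i: "i \<in> T"
    have "(\<Oplus>\<^bsub>L\<^esub>i\<in>T. c i \<odot>\<^bsub>L\<^esub> b i) \<in> carrier L" using T by (intro L.finsum_closed) auto
    then have "(\<Oplus>\<^bsub>L\<^esub>i\<in>T. c i \<odot>\<^bsub>L\<^esub> b i) = \<zero>\<^bsub>L\<^esub>"
      using inj_onD[OF bij_betw_imp_inj_on[OF bij], OF c[folded alg_iso_zero[OF \<phi> L M]]]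
      by (simp only: L.zero_closed)
    then show "c i = 0" using i by (rule coordinates_indep[OF co])
  qed (use T \<phi> in \<open>auto simp: alg_iso_closed Pi_iff\<close>)
qed

text \<open>
  Substituting one family of linear combinations into another multiplies the coefficient matrices.
\<close>

lemma (in class_algebra) lincomb_lincomb:
  assumes "finite S" "finite T" "b \<in> T \<rightarrow> carrier L"
  shows "(\<Oplus>j\<in>S. a j \<odot> (\<Oplus>i\<in>T. P i j \<odot> b i)) = (\<Oplus>i\<in>T. (\<Sum>j\<in>S. P i j * a j) \<odot> b i)"
proof -
  have "(\<Oplus>j\<in>S. a j \<odot> (\<Oplus>i\<in>T. P i j \<odot> b i)) = (\<Oplus>j\<in>S. \<Oplus>i\<in>T. (P i j * a j) \<odot> b i)"
  proof (intro finsum_cong')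
    fix j assume "j \<in> S"
    have "a j \<odot> (\<Oplus>i\<in>T. P i j \<odot> b i) = (\<Oplus>i\<in>T. a j \<odot> (P i j \<odot> b i))"
      using assms by (intro scale_sum) auto
    also have "\<dots> = (\<Oplus>i\<in>T. (P i j * a j) \<odot> b i)"
      using assms by (intro finsum_cong') (auto simp: mult.commute Pi_iff)
    finally show "a j \<odot> (\<Oplus>i\<in>T. P i j \<odot> b i) = (\<Oplus>i\<in>T. (P i j * a j) \<odot> b i)" .
  qed (use assms in \<open>auto intro!: finsum_closed\<close>)
  also have "\<dots> = (\<Oplus>i\<in>T. \<Oplus>j\<in>S. (P i j * a j) \<odot> b i)"
    using assms by (intro finsum_swap) auto
  also have "\<dots> = (\<Oplus>i\<in>T. (\<Sum>j\<in>S. P i j * a j) \<odot> b i)"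
    using assms by (intro finsum_cong') (auto simp: sum_scale Pi_iff)
  finally show ?thesis .
qed

lemma (in class_algebra) mult_lincomb:
  assumes "finite T" "b \<in> T \<rightarrow> carrier L" "x \<in> carrier L"
  shows "x \<otimes> (\<Oplus>j\<in>T. a j \<odot> b j) = (\<Oplus>j\<in>T. a j \<odot> (x \<otimes> b j))"
proof -
  have "x \<otimes> (\<Oplus>j\<in>T. a j \<odot> b j) = (\<Oplus>j\<in>T. x \<otimes> (a j \<odot> b j))"
    using assms by (intro finsum_rdistr) auto
  also have "\<dots> = (\<Oplus>j\<in>T. a j \<odot> (x \<otimes> b j))"
    using assms by (intro finsum_cong') (auto simp: scale_mult_right Pi_iff)
  finally show ?thesis .
qed

lemma (in class_algebra) mult_matrix_iff:
  "mult_matrix L bs x M \<longleftrightarrow> coordinates L {..<length bs} ((!) bs) \<and>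
     M \<in> carrier_mat (length bs) (length bs) \<and>
     (\<forall>j<length bs. x \<otimes> bs ! j = (\<Oplus>i\<in>{..<length bs}. M $$ (i, j) \<odot> bs ! i))"
proof -
  have img: "(!) bs ` {..<length bs} = set bs" by (auto simp: set_conv_nth)
  have dist: "distinct bs \<longleftrightarrow> inj_on ((!) bs) {..<length bs}"
    by (auto simp: distinct_conv_nth inj_on_def)
  have sub: "set bs \<subseteq> carrier L" if "vectorspace.basis class_ring L (set bs)"
    using that vectorspace.basis_def[OF vectorspace] by blast
  have "distinct bs \<and> vectorspace.basis class_ring L (set bs) \<longleftrightarrow>
      coordinates L {..<length bs} ((!) bs)"
    using coordinates_iff_basis[of "{..<length bs}" "(!) bs"] coordinates_basis(1)[of "{..<length bs}" "(!) bs"]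
      coordinates_inj[of "{..<length bs}" "(!) bs"] sub
    unfolding img dist by (auto simp: Pi_iff subset_iff)
  then show ?thesis unfolding mult_matrix_def by blast
qed

lemma (in class_algebra) mult_matrix_exists:
  assumes co: "coordinates L {..<length bs} ((!) bs)" and x: "x \<in> carrier L"
  obtains M where "mult_matrix L bs x M"
proof -
  have "x \<otimes> bs ! j \<in> carrier L" if "j \<in> {..<length bs}" for j
    using coordinates_closed[OF co] x that by (auto simp: Pi_iff)
  from coordinates_span_family[OF co this]
  obtain c where c: "\<forall>j\<in>{..<length bs}. x \<otimes> bs ! j = (\<Oplus>i\<in>{..<length bs}. c j i \<odot> bs ! i)" ..
  have "mult_matrix L bs x (Matrix.mat (length bs) (length bs) (\<lambda>(i, j). c j i))"
    unfolding mult_matrix_iff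
  proof (intro conjI allI impI co)
    fix j assume j: "j < length bs"
    show "x \<otimes> bs ! j = (\<Oplus>i\<in>{..<length bs}.
        Matrix.mat (length bs) (length bs) (\<lambda>(i, j). c j i) $$ (i, j) \<odot> bs ! i)"
      unfolding c[rule_format, unfolded lessThan_iff, OF j]
      using coordinates_closed[OF co] j by (intro finsum_cong') (auto simp: Pi_iff)
  qed simp
  then show ?thesis by (rule that)
qed

text \<open>
  If \<open>P\<close> is the matrix that expresses the second basis in the first, comparison of coefficients in
  \<open>x \<otimes> bs' ! j\<close> yields \<open>P M' = M P\<close>; since \<open>P\<close> has a right inverse, its determinant is nonzero
  and cancels.
\<close>

lemma (in class_algebra) det_mult_matrix_unique:
  assumes M: "mult_matrix L bs x M" and M': "mult_matrix L bs' x M'" and x: "x \<in> carrier L"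
  shows "det M' = det M"
proof -
  define n where "n = length bs"
  have co: "coordinates L {..<n} ((!) bs)" and Mc: "M \<in> carrier_mat n n"
    and Mx: "\<And>j. j < n \<Longrightarrow> x \<otimes> bs ! j = (\<Oplus>i\<in>{..<n}. M $$ (i, j) \<odot> bs ! i)"
    using M by (auto simp: mult_matrix_iff n_def)
  have "length bs' = n"
    using M M' coordinates_basis(2) unfolding mult_matrix_iff n_def by (metis card_lessThan)
  then have co': "coordinates L {..<n} ((!) bs')" and M'c: "M' \<in> carrier_mat n n"
    and M'x: "\<And>j. j < n \<Longrightarrow> x \<otimes> bs' ! j = (\<Oplus>i\<in>{..<n}. M' $$ (i, j) \<odot> bs' ! i)"
    using M' by (auto simp: mult_matrix_iff)
  have b: "(!) bs \<in> {..<n} \<rightarrow> carrier L" and b': "(!) bs' \<in> {..<n} \<rightarrow> carrier L"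
    using coordinates_closed[OF co] coordinates_closed[OF co'] by auto
  obtain P where "\<forall>j\<in>{..<n}. bs' ! j = (\<Oplus>i\<in>{..<n}. P j i \<odot> bs ! i)"
    using coordinates_span_family[OF co, of "{..<n}" "(!) bs'", OF funcset_mem[OF b']] ..
  then have P: "\<And>j. j < n \<Longrightarrow> bs' ! j = (\<Oplus>i\<in>{..<n}. P j i \<odot> bs ! i)" by simp
  obtain Q where "\<forall>j\<in>{..<n}. bs ! j = (\<Oplus>i\<in>{..<n}. Q j i \<odot> bs' ! i)"
    using coordinates_span_family[OF co', of "{..<n}" "(!) bs", OF funcset_mem[OF b]] ..
  then have Q: "\<And>j. j < n \<Longrightarrow> bs ! j = (\<Oplus>i\<in>{..<n}. Q j i \<odot> bs' ! i)" by simp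
  have expand: "(\<Oplus>k\<in>{..<n}. a k \<odot> bs' ! k) = (\<Oplus>i\<in>{..<n}. (\<Sum>k<n. P k i * a k) \<odot> bs ! i)" for a
  proof -
    have "(\<Oplus>k\<in>{..<n}. a k \<odot> bs' ! k) = (\<Oplus>k\<in>{..<n}. a k \<odot> (\<Oplus>i\<in>{..<n}. P k i \<odot> bs ! i))"
      using b by (intro finsum_cong') (auto simp: P Pi_iff intro!: finsum_closed)
    then show ?thesis using b by (simp add: lincomb_lincomb)
  qed
  \<comment> \<open>Expanding \<open>bs\<close> in \<open>bs'\<close> and back shows that \<open>Q\<close> is a right inverse of \<open>P\<close>.\<close>
  have PQ: "(\<Sum>k<n. P k i * Q j k) = (if i = j then 1 else 0)" if "i < n" "j < n" for i j
  proof (rule coordinates_unique[OF co, where c = "\<lambda>i. \<Sum>k<n. P k i * Q j k"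
        and d = "\<lambda>i. if i = j then 1 else 0"])
    show "(\<Oplus>i\<in>{..<n}. (\<Sum>k<n. P k i * Q j k) \<odot> bs ! i) =
        (\<Oplus>i\<in>{..<n}. (if i = j then 1 else 0) \<odot> bs ! i)"
      using that finsum_delta[OF _ b, of j 1] Q[of j] expand[of "Q j"] b by (auto simp: Pi_iff)
  qed (use that in auto)
  have comm: "(\<Sum>k<n. P k i * M' $$ (k, j)) = (\<Sum>k<n. M $$ (i, k) * P j k)" if "i < n" "j < n" for i j
  proof (rule coordinates_unique[OF co, where c = "\<lambda>i. \<Sum>k<n. P k i * M' $$ (k, j)"
        and d = "\<lambda>i. \<Sum>k<n. M $$ (i, k) * P j k"])
    have "(\<Oplus>i\<in>{..<n}. (\<Sum>k<n. P k i * M' $$ (k, j)) \<odot> bs ! i) = x \<otimes> bs' ! j"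
      using that by (simp add: M'x expand)
    also have "\<dots> = (\<Oplus>k\<in>{..<n}. P j k \<odot> (x \<otimes> bs ! k))"
      using that x b by (simp add: P mult_lincomb)
    also have "\<dots> = (\<Oplus>k\<in>{..<n}. P j k \<odot> (\<Oplus>i\<in>{..<n}. M $$ (i, k) \<odot> bs ! i))"
      using b by (intro finsum_cong') (auto simp: Mx Pi_iff intro!: finsum_closed)
    also have "\<dots> = (\<Oplus>i\<in>{..<n}. (\<Sum>k<n. M $$ (i, k) * P j k) \<odot> bs ! i)"
      using b by (simp add: lincomb_lincomb)
    finally show "(\<Oplus>i\<in>{..<n}. (\<Sum>k<n. P k i * M' $$ (k, j)) \<odot> bs ! i) =
      (\<Oplus>i\<in>{..<n}. (\<Sum>k<n. M $$ (i, k) * P j k) \<odot> bs ! i)" .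
  qed (use that in auto)
  define PP where "PP = Matrix.mat n n (\<lambda>(i, j). P j i)"
  define QQ where "QQ = Matrix.mat n n (\<lambda>(i, j). Q j i)"
  have c: "PP \<in> carrier_mat n n" "QQ \<in> carrier_mat n n" by (auto simp: PP_def QQ_def)
  have "PP * QQ = 1\<^sub>m n"
    using PQ by (intro eq_matI) (auto simp: PP_def QQ_def scalar_prod_def atLeast0LessThan)
  then have "det PP * det QQ = 1" using det_mult[OF c] by simp
  then have nz: "det PP \<noteq> 0" by auto
  have "PP * M' = M * PP"
    using comm Mc M'c by (intro eq_matI) (auto simp: PP_def scalar_prod_def atLeast0LessThan)
  then have "det PP * det M' = det M * det PP"
    using det_mult[OF c(1) M'c] det_mult[OF Mc c(1)] by argo
  then show ?thesis using nz by simp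
qed

lemma (in class_algebra) alg_norm_eq:
  assumes "mult_matrix L bs x M" "x \<in> carrier L"
  shows "alg_norm L x = det M"
proof -
  have "\<exists>bs. mult_matrix L bs x (SOME M. \<exists>bs. mult_matrix L bs x M)"
    using assms(1) by (intro someI[of "\<lambda>M. \<exists>bs. mult_matrix L bs x M"]) blast
  then show ?thesis
    unfolding alg_norm_def using det_mult_matrix_unique assms by blast
qed

text \<open>
  All explicit norms in this development are norms of elements that have an eigenbasis.
\<close>

lemma (in class_algebra) alg_norm_diagonal:
  assumes co: "coordinates L T b" and x: "x \<in> carrier L"
    and eig: "\<And>t. t \<in> T \<Longrightarrow> x \<otimes> b t = d t \<odot> b t"
  shows "alg_norm L x = (\<Prod>t\<in>T. d t)"
proof -
  have T: "finite T" "b \<in> T \<rightarrow> carrier L" using coordinates_finite[OF co] coordinates_closed[OF co] by auto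
  obtain ts where ts: "set ts = T" "distinct ts" using finite_distinct_list[OF T(1)] by blast
  define n where "n = length ts"
  define M where "M = Matrix.mat n n (\<lambda>(i, j). if i = j then d (ts ! j) else 0)"
  have tsT: "ts ! i \<in> T" if "i < n" for i using that ts by (auto simp: n_def)
  have "coordinates L {..<n} ((!) (map b ts))"
  proof -
    have "(!) (map b ts) ` {..<n} = b ` T" using ts by (force simp: n_def set_conv_nth)
    moreover have "inj_on ((!) (map b ts)) {..<n}"
      using coordinates_inj[OF co] ts by (auto simp: n_def distinct_map intro!: inj_on_nth)
    ultimately show ?thesis
      using coordinates_basis(1)[OF co] T tsT
      by (subst coordinates_iff_basis) (auto simp: n_def)
  qed
  moreover have "x \<otimes> map b ts ! j = (\<Oplus>i\<in>{..<n}. M $$ (i, j) \<odot> map b ts ! i)" if "j < n" for j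
  proof -
    have "(\<Oplus>i\<in>{..<n}. M $$ (i, j) \<odot> map b ts ! i) =
        (\<Oplus>i\<in>{..<n}. (if i = j then d (ts ! j) else 0) \<odot> map b ts ! i)"
      using that tsT T by (intro finsum_cong') (auto simp: M_def n_def Pi_iff)
    also have "\<dots> = d (ts ! j) \<odot> b (ts ! j)"
      using that tsT T by (subst finsum_delta) (auto simp: n_def Pi_iff)
    finally show ?thesis using eig[OF tsT[OF that]] that by (simp add: n_def)
  qed
  ultimately have "mult_matrix L (map b ts) x M"
    by (auto simp: mult_matrix_iff M_def n_def)
  then have "alg_norm L x = det M" using x by (rule alg_norm_eq)
  also have "\<dots> = prod_list (diag_mat M)"
    by (rule det_lower_triangular[where n = n]) (auto simp: M_def)
  also have "diag_mat M = map d ts"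
    by (intro nth_equalityI) (auto simp: diag_mat_def M_def n_def)
  also have "prod_list (map d ts) = (\<Prod>t\<in>T. d t)"
    using prod.distinct_set_conv_list[OF ts(2), of d] ts(1) by simp
  finally show ?thesis .
qed

lemma (in class_algebra) alg_norm_scalar:
  assumes "vectorspace.fin_dim class_ring L"
  shows "alg_norm L (a \<odot> \<one>) = a ^ vectorspace.dim class_ring L"
proof -
  obtain bs where co: "coordinates L {..<length bs} ((!) bs)"
    using fin_dim_coordinates[OF assms] .
  have "alg_norm L (a \<odot> \<one>) = (\<Prod>t\<in>{..<length bs}. a)"
    by (rule alg_norm_diagonal[OF co]) (use coordinates_closed[OF co] in \<open>auto simp: scale_mult_left Pi_iff\<close>)
  then show ?thesis using coordinates_basis(2)[OF co] by simp
qed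

lemma (in class_algebra) alg_norm_mult:
  assumes "vectorspace.fin_dim class_ring L" and x: "x \<in> carrier L" and y: "y \<in> carrier L"
  shows "alg_norm L (x \<otimes> y) = alg_norm L x * alg_norm L y"
proof -
  obtain bs where co: "coordinates L {..<length bs} ((!) bs)"
    using fin_dim_coordinates[OF assms(1)] .
  define n where "n = length bs"
  have b: "(!) bs \<in> {..<n} \<rightarrow> carrier L" using coordinates_closed[OF co] by (auto simp: n_def)
  obtain M where M: "mult_matrix L bs x M" using mult_matrix_exists[OF co x] .
  obtain N where N: "mult_matrix L bs y N" using mult_matrix_exists[OF co y] .
  have Mc: "M \<in> carrier_mat n n" and Nc: "N \<in> carrier_mat n n"
    and Mx: "\<And>j. j < n \<Longrightarrow> x \<otimes> bs ! j = (\<Oplus>i\<in>{..<n}. M $$ (i, j) \<odot> bs ! i)"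
    and Ny: "\<And>j. j < n \<Longrightarrow> y \<otimes> bs ! j = (\<Oplus>i\<in>{..<n}. N $$ (i, j) \<odot> bs ! i)"
    using M N by (auto simp: mult_matrix_iff n_def)
  have "(x \<otimes> y) \<otimes> bs ! j = (\<Oplus>i\<in>{..<n}. (M * N) $$ (i, j) \<odot> bs ! i)" if j: "j < n" for j
  proof -
    have "(x \<otimes> y) \<otimes> bs ! j = x \<otimes> (y \<otimes> bs ! j)" using x y b j by (auto simp: m_assoc Pi_iff)
    also have "\<dots> = (\<Oplus>k\<in>{..<n}. N $$ (k, j) \<odot> (x \<otimes> bs ! k))"
      using j x b by (simp add: Ny mult_lincomb)
    also have "\<dots> = (\<Oplus>k\<in>{..<n}. N $$ (k, j) \<odot> (\<Oplus>i\<in>{..<n}. M $$ (i, k) \<odot> bs ! i))"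
      using b by (intro finsum_cong') (auto simp: Mx Pi_iff intro!: finsum_closed)
    also have "\<dots> = (\<Oplus>i\<in>{..<n}. (\<Sum>k<n. M $$ (i, k) * N $$ (k, j)) \<odot> bs ! i)"
      using b by (simp add: lincomb_lincomb)
    also have "\<dots> = (\<Oplus>i\<in>{..<n}. (M * N) $$ (i, j) \<odot> bs ! i)"
      using b j Mc Nc
      by (intro finsum_cong') (auto simp: Pi_iff scalar_prod_def atLeast0LessThan)
    finally show ?thesis .
  qed
  then have "mult_matrix L bs (x \<otimes> y) (M * N)"
    using co Mc Nc by (auto simp: mult_matrix_iff n_def)
  then have "alg_norm L (x \<otimes> y) = det (M * N)" using x y by (intro alg_norm_eq) auto
  then show ?thesis
    using alg_norm_eq[OF M x] alg_norm_eq[OF N y] det_mult[OF Mc Nc] by simp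
qed

lemma (in class_algebra) alg_norm_unit:
  assumes "vectorspace.fin_dim class_ring L" and x: "x \<in> Units L"
  shows "alg_norm L x \<noteq> 0"
proof -
  have "alg_norm L (x \<otimes> inv x) = alg_norm L x * alg_norm L (inv x)"
    using x by (intro alg_norm_mult assms(1)) auto
  moreover have "alg_norm L (x \<otimes> inv x) = 1"
    using alg_norm_scalar[OF assms(1), of 1] x by simp
  ultimately show ?thesis by auto
qed

lemma (in class_algebra) coordinates_cong:
  assumes co: "coordinates L T b" and eq: "\<And>i. i \<in> T \<Longrightarrow> b i = b' i"
  shows "coordinates L T b'"
proof -
  have "finite T" "b' \<in> T \<rightarrow> carrier L"
    using coordinates_finite[OF co] coordinates_closed[OF co] by (auto simp: eq[symmetric] Pi_iff)
  moreover have "inj_on b' T" using coordinates_inj[OF co] inj_on_cong[of T b b'] eq by simp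
  moreover have "b ` T = b' ` T" using eq by auto
  ultimately show ?thesis using coordinates_basis(1)[OF co] by (simp add: coordinates_iff_basis)
qed

text \<open>
  An isomorphism carries a basis to a basis and leaves the matrix of multiplication unchanged.
\<close>

lemma mult_matrix_iso:
  assumes m: "mult_matrix L bs x A" and \<phi>: "\<phi> \<in> alg_iso L M"
    and L: "class_algebra L" and M: "class_algebra M" and x: "x \<in> carrier L"
  shows "mult_matrix M (map \<phi> bs) (\<phi> x) A"
proof -
  interpret L: class_algebra L by fact
  interpret M: class_algebra M by fact
  define n where "n = length bs"
  have co: "coordinates L {..<n} ((!) bs)" and A: "A \<in> carrier_mat n n"
    and eq: "\<And>j. j < n \<Longrightarrow> x \<otimes>\<^bsub>L\<^esub> bs ! j = (\<Oplus>\<^bsub>L\<^esub>i\<in>{..<n}. A $$ (i, j) \<odot>\<^bsub>L\<^esub> bs ! i)"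
    using m by (auto simp: L.mult_matrix_iff n_def)
  have b: "bs ! i \<in> carrier L" if "i < n" for i using coordinates_closed[OF co] that by auto
  have "coordinates M {..<n} ((!) (map \<phi> bs))"
    by (rule M.coordinates_cong[OF coordinates_iso[OF co \<phi> L M]]) (simp add: n_def)
  moreover have "\<phi> x \<otimes>\<^bsub>M\<^esub> map \<phi> bs ! j = (\<Oplus>\<^bsub>M\<^esub>i\<in>{..<n}. A $$ (i, j) \<odot>\<^bsub>M\<^esub> map \<phi> bs ! i)"
    if j: "j < n" for j
  proof -
    have "\<phi> x \<otimes>\<^bsub>M\<^esub> map \<phi> bs ! j = \<phi> (x \<otimes>\<^bsub>L\<^esub> bs ! j)"
      using j b[OF j] x by (simp add: alg_iso_mult[OF \<phi>] n_def)
    also have "\<dots> = (\<Oplus>\<^bsub>M\<^esub>i\<in>{..<n}. \<phi> (A $$ (i, j) \<odot>\<^bsub>L\<^esub> bs ! i))"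
      unfolding eq[OF j] using b by (intro alg_iso_finsum[OF \<phi> L M]) auto
    also have "\<dots> = (\<Oplus>\<^bsub>M\<^esub>i\<in>{..<n}. A $$ (i, j) \<odot>\<^bsub>M\<^esub> map \<phi> bs ! i)"
      using b by (intro M.finsum_cong') (auto simp: alg_iso_smult[OF \<phi>] alg_iso_closed[OF \<phi>] n_def)
    finally show ?thesis .
  qed
  ultimately show ?thesis using A by (simp add: M.mult_matrix_iff n_def)
qed

lemma alg_norm_iso:
  assumes \<phi>: "\<phi> \<in> alg_iso L M" and L: "class_algebra L" and M: "class_algebra M"
    and fin: "vectorspace.fin_dim class_ring L" and x: "x \<in> carrier L"
  shows "alg_norm M (\<phi> x) = alg_norm L x"
proof -
  interpret L: class_algebra L by fact
  interpret M: class_algebra M by fact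
  obtain bs where co: "coordinates L {..<length bs} ((!) bs)" using L.fin_dim_coordinates[OF fin] .
  obtain A where A: "mult_matrix L bs x A" using L.mult_matrix_exists[OF co x] .
  show ?thesis
    using L.alg_norm_eq[OF A x] M.alg_norm_eq[OF mult_matrix_iso[OF A \<phi> L M x] alg_iso_closed[OF \<phi> x]]
    by simp
qed

lemma dim_iso:
  assumes \<phi>: "\<phi> \<in> alg_iso L M" and L: "class_algebra L" and M: "class_algebra M"
    and fin: "vectorspace.fin_dim class_ring L"
  shows "vectorspace.dim class_ring M = vectorspace.dim class_ring L"
    and "vectorspace.fin_dim class_ring M"
proof -
  interpret L: class_algebra L by fact
  interpret M: class_algebra M by fact
  obtain bs where co: "coordinates L {..<length bs} ((!) bs)" using L.fin_dim_coordinates[OF fin] .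
  note co' = coordinates_iso[OF co \<phi> L M]
  show "vectorspace.dim class_ring M = vectorspace.dim class_ring L"
    using L.coordinates_basis(2)[OF co] M.coordinates_basis(2)[OF co'] by simp
  show "vectorspace.fin_dim class_ring M" by (rule M.coordinates_basis(3)[OF co'])
qed

text \<open>
  The power \<open>a ^ n\<close> is the norm of the scalar \<open>a\<close>.
\<close>

lemma (in class_algebra) power_in_norm_image:
  assumes fin: "vectorspace.fin_dim class_ring L" and n: "vectorspace.dim class_ring L = n"
    and a: "a \<noteq> 0"
  shows "a ^ n \<in> alg_norm L ` Units L"
proof -
  have "a \<odot> \<one> \<in> Units L"
    unfolding Units_def using a by (auto intro!: bexI[of _ "inverse a \<odot> \<one>"] simp: scale_mult_left)
  then show ?thesis using alg_norm_scalar[OF fin, of a] n by (metis imageI)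
qed

section \<open>Products of algebras\<close>

lemma prod_algebra_sel [simp]:
  "carrier (prod_algebra I E) = (\<Pi>\<^sub>E j\<in>I. carrier (E j))"
  "x \<otimes>\<^bsub>prod_algebra I E\<^esub> y = (\<lambda>j\<in>I. x j \<otimes>\<^bsub>E j\<^esub> y j)"
  "\<one>\<^bsub>prod_algebra I E\<^esub> = (\<lambda>j\<in>I. \<one>\<^bsub>E j\<^esub>)"
  "\<zero>\<^bsub>prod_algebra I E\<^esub> = (\<lambda>j\<in>I. \<zero>\<^bsub>E j\<^esub>)"
  "x \<oplus>\<^bsub>prod_algebra I E\<^esub> y = (\<lambda>j\<in>I. x j \<oplus>\<^bsub>E j\<^esub> y j)"
  "a \<odot>\<^bsub>prod_algebra I E\<^esub> x = (\<lambda>j\<in>I. a \<odot>\<^bsub>E j\<^esub> x j)"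
  by (simp_all add: prod_algebra_def)

lemma prod_algebra_algebra:
  assumes "\<And>j. j \<in> I \<Longrightarrow> class_algebra (E j)"
  shows "class_algebra (prod_algebra I E)"
proof -
  have cr: "cring (E j)" if "j \<in> I" for j
    using class_algebra.algebra[OF assms[OF that]] by (rule algebra.axioms)
  note E = cring.cring_simprules[OF cr]
  have "abelian_group (prod_algebra I E)"
  proof (rule abelian_groupI)
    fix x assume x: "x \<in> carrier (prod_algebra I E)"
    show "\<exists>y\<in>carrier (prod_algebra I E). y \<oplus>\<^bsub>prod_algebra I E\<^esub> x = \<zero>\<^bsub>prod_algebra I E\<^esub>"
    proof (rule bexI[of _ "\<lambda>j\<in>I. \<ominus>\<^bsub>E j\<^esub> x j"])
      show "(\<lambda>j\<in>I. \<ominus>\<^bsub>E j\<^esub> x j) \<in> carrier (prod_algebra I E)"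
        using x by (auto simp: PiE_iff intro: E)
      show "(\<lambda>j\<in>I. \<ominus>\<^bsub>E j\<^esub> x j) \<oplus>\<^bsub>prod_algebra I E\<^esub> x = \<zero>\<^bsub>prod_algebra I E\<^esub>"
        using x by (intro extensionalityI[of _ I]) (auto simp: PiE_iff E)
    qed
    show "\<zero>\<^bsub>prod_algebra I E\<^esub> \<oplus>\<^bsub>prod_algebra I E\<^esub> x = x"
      using x by (intro extensionalityI[of _ I]) (auto simp: PiE_iff E)
  next
    fix x y assume xy: "x \<in> carrier (prod_algebra I E)" "y \<in> carrier (prod_algebra I E)"
    then show "x \<oplus>\<^bsub>prod_algebra I E\<^esub> y \<in> carrier (prod_algebra I E)"
      by (auto simp: PiE_iff intro: E)
    show "x \<oplus>\<^bsub>prod_algebra I E\<^esub> y = y \<oplus>\<^bsub>prod_algebra I E\<^esub> x"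
      using xy by (intro extensionalityI[of _ I]) (auto simp: PiE_iff intro: E)
  next
    fix x y z assume "x \<in> carrier (prod_algebra I E)" "y \<in> carrier (prod_algebra I E)"
      "z \<in> carrier (prod_algebra I E)"
    then show "x \<oplus>\<^bsub>prod_algebra I E\<^esub> y \<oplus>\<^bsub>prod_algebra I E\<^esub> z =
        x \<oplus>\<^bsub>prod_algebra I E\<^esub> (y \<oplus>\<^bsub>prod_algebra I E\<^esub> z)"
      by (intro extensionalityI[of _ I]) (auto simp: PiE_iff intro: E)
  qed (auto simp: PiE_iff intro: E)
  moreover have "comm_monoid (prod_algebra I E)"
  proof (rule comm_monoidI)
    fix x assume x: "x \<in> carrier (prod_algebra I E)"
    show "\<one>\<^bsub>prod_algebra I E\<^esub> \<otimes>\<^bsub>prod_algebra I E\<^esub> x = x"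
      using x by (intro extensionalityI[of _ I]) (auto simp: PiE_iff intro: E)
  next
    fix x y assume xy: "x \<in> carrier (prod_algebra I E)" "y \<in> carrier (prod_algebra I E)"
    then show "x \<otimes>\<^bsub>prod_algebra I E\<^esub> y \<in> carrier (prod_algebra I E)"
      by (auto simp: PiE_iff intro: E)
    show "x \<otimes>\<^bsub>prod_algebra I E\<^esub> y = y \<otimes>\<^bsub>prod_algebra I E\<^esub> x"
      using xy by (intro extensionalityI[of _ I]) (auto simp: PiE_iff intro: E)
  next
    fix x y z assume "x \<in> carrier (prod_algebra I E)" "y \<in> carrier (prod_algebra I E)"
      "z \<in> carrier (prod_algebra I E)"
    then show "x \<otimes>\<^bsub>prod_algebra I E\<^esub> y \<otimes>\<^bsub>prod_algebra I E\<^esub> z =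
        x \<otimes>\<^bsub>prod_algebra I E\<^esub> (y \<otimes>\<^bsub>prod_algebra I E\<^esub> z)"
      by (intro extensionalityI[of _ I]) (auto simp: PiE_iff intro: E)
  qed (auto simp: PiE_iff intro: E)
  ultimately have P: "cring (prod_algebra I E)"
  proof (rule cringI)
    fix x y z assume "x \<in> carrier (prod_algebra I E)" "y \<in> carrier (prod_algebra I E)"
      "z \<in> carrier (prod_algebra I E)"
    then show "(x \<oplus>\<^bsub>prod_algebra I E\<^esub> y) \<otimes>\<^bsub>prod_algebra I E\<^esub> z =
        x \<otimes>\<^bsub>prod_algebra I E\<^esub> z \<oplus>\<^bsub>prod_algebra I E\<^esub> y \<otimes>\<^bsub>prod_algebra I E\<^esub> z"
      by (intro extensionalityI[of _ I]) (auto simp: PiE_iff intro: E)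
  qed
  note A = class_algebra.scale_closed[OF assms] class_algebra.scale_add_left[OF assms]
    class_algebra.scale_add_right[OF assms] class_algebra.scale_scale[OF assms]
    class_algebra.scale_one[OF assms] class_algebra.scale_mult_left[OF assms]
  have "algebra class_ring (prod_algebra I E)"
  proof (rule algebraI[OF class_cring.is_cring P])
    fix a x assume "x \<in> carrier (prod_algebra I E)"
    then show "a \<odot>\<^bsub>prod_algebra I E\<^esub> x \<in> carrier (prod_algebra I E)"
      by (auto simp: PiE_iff intro: A)
  next
    fix x assume "x \<in> carrier (prod_algebra I E)"
    then show "\<one>\<^bsub>class_ring\<^esub> \<odot>\<^bsub>prod_algebra I E\<^esub> x = x"
      by (intro extensionalityI[of _ I]) (auto simp: PiE_iff A)
  qed (auto simp: PiE_iff A intro!: restrict_ext)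
  then show ?thesis by (simp add: class_algebra_iff)
qed

lemma prod_algebra_iso:
  assumes "\<And>j. j \<in> I \<Longrightarrow> \<phi> j \<in> alg_iso (E j) (E' j)"
  shows "(\<lambda>x. \<lambda>j\<in>I. \<phi> j (x j)) \<in> alg_iso (prod_algebra I E) (prod_algebra I E')"
proof -
  note bij = alg_iso_bij[OF assms]
  have "bij_betw (\<lambda>x. \<lambda>j\<in>I. \<phi> j (x j)) (\<Pi>\<^sub>E j\<in>I. carrier (E j)) (\<Pi>\<^sub>E j\<in>I. carrier (E' j))"
    by (rule bij_betwI[where g = "\<lambda>y. \<lambda>j\<in>I. inv_into (carrier (E j)) (\<phi> j) (y j)"])
      (use bij alg_iso_closed[OF assms] in \<open>auto simp: PiE_iff bij_betw_def f_inv_into_f inv_into_into fun_eq_iff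
        extensional_def restrict_def\<close>)
  then show ?thesis
    by (intro alg_isoI)
      (auto simp: PiE_iff alg_iso_closed[OF assms] alg_iso_mult[OF assms] alg_iso_add[OF assms]
        alg_iso_one[OF assms] alg_iso_smult[OF assms] intro!: restrict_ext)
qed

lemma prod_algebra_reindex:
  assumes "bij_betw \<sigma> I' I"
  shows "(\<lambda>x. \<lambda>j\<in>I'. x (\<sigma> j)) \<in> alg_iso (prod_algebra I E) (prod_algebra I' (\<lambda>j. E (\<sigma> j)))"
proof -
  have \<sigma>: "\<sigma> j \<in> I" if "j \<in> I'" for j using assms that by (auto simp: bij_betw_def)
  let ?\<tau> = "inv_into I' \<sigma>"
  have \<tau>: "?\<tau> j \<in> I'" "\<sigma> (?\<tau> j) = j" if "j \<in> I" for j
    using assms that by (auto simp: bij_betw_def f_inv_into_f inv_into_into)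
  have \<tau>\<sigma>: "?\<tau> (\<sigma> j) = j" if "j \<in> I'" for j using assms that by (auto simp: bij_betw_def)
  have "bij_betw (\<lambda>x. \<lambda>j\<in>I'. x (\<sigma> j)) (\<Pi>\<^sub>E j\<in>I. carrier (E j)) (\<Pi>\<^sub>E j\<in>I'. carrier (E (\<sigma> j)))"
  proof (rule bij_betwI[where g = "\<lambda>y. \<lambda>j\<in>I. y (?\<tau> j)"])
    show "(\<lambda>y. \<lambda>j\<in>I. y (?\<tau> j)) \<in> (\<Pi>\<^sub>E j\<in>I'. carrier (E (\<sigma> j))) \<rightarrow> (\<Pi>\<^sub>E j\<in>I. carrier (E j))"
    proof
      fix y assume y: "y \<in> (\<Pi>\<^sub>E j\<in>I'. carrier (E (\<sigma> j)))"
      have "y (?\<tau> j) \<in> carrier (E j)" if "j \<in> I" for j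
        using PiE_mem[OF y \<tau>(1)[OF that]] \<tau>(2)[OF that] by simp
      then show "(\<lambda>j\<in>I. y (?\<tau> j)) \<in> (\<Pi>\<^sub>E j\<in>I. carrier (E j))" by auto
    qed
  qed (auto simp: \<sigma> \<tau> \<tau>\<sigma> PiE_iff fun_eq_iff extensional_def restrict_def)
  then show ?thesis
    by (intro alg_isoI) (auto simp: PiE_iff \<sigma> intro!: restrict_ext)
qed

lemma prod_algebra_finsum:
  assumes E: "\<And>j. j \<in> I \<Longrightarrow> class_algebra (E j)"
    and S: "finite S" "\<And>s. s \<in> S \<Longrightarrow> f s \<in> carrier (prod_algebra I E)" and j: "j \<in> I"
  shows "finsum (prod_algebra I E) f S j = (\<Oplus>\<^bsub>E j\<^esub>s\<in>S. f s j)"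
proof -
  interpret P: class_algebra "prod_algebra I E" by (rule prod_algebra_algebra[OF E])
  interpret Ej: class_algebra "E j" by (rule E[OF j])
  show ?thesis using S
  proof (induction S rule: finite_induct)
    case (insert s S)
    have f: "f \<in> S \<rightarrow> carrier (prod_algebra I E)" "f s \<in> carrier (prod_algebra I E)"
      using insert.prems by auto
    have fj: "(\<lambda>s. f s j) \<in> S \<rightarrow> carrier (E j)" "f s j \<in> carrier (E j)"
      using f j by (auto simp: PiE_iff Pi_iff)
    have "finsum (prod_algebra I E) f (insert s S) = f s \<oplus>\<^bsub>prod_algebra I E\<^esub> finsum (prod_algebra I E) f S"
      using insert.hyps f by (rule P.finsum_insert)
    moreover have "(\<Oplus>\<^bsub>E j\<^esub>s\<in>insert s S. f s j) = f s j \<oplus>\<^bsub>E j\<^esub> (\<Oplus>\<^bsub>E j\<^esub>s\<in>S. f s j)"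
      using insert.hyps fj by (rule Ej.finsum_insert)
    ultimately show ?case using insert.IH insert.prems j by simp
  qed (use j in simp)
qed

definition component :: "'i set \<Rightarrow> ('i \<Rightarrow> ('c::field, 'l) module) \<Rightarrow> 'i \<Rightarrow> 'l \<Rightarrow> 'i \<Rightarrow> 'l" where
  "component I E j v = (\<lambda>i\<in>I. if i = j then v else \<zero>\<^bsub>E i\<^esub>)"

lemma component_closed:
  assumes "\<And>j. j \<in> I \<Longrightarrow> class_algebra (E j)" "j \<in> I" "v \<in> carrier (E j)"
  shows "component I E j v \<in> carrier (prod_algebra I E)"
proof -
  have "\<zero>\<^bsub>E i\<^esub> \<in> carrier (E i)" if "i \<in> I" for i
    using cring.cring_simprules(2)[OF algebra.axioms(2)[OF class_algebra.algebra[OF assms(1)[OF that]]]] .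
  then show ?thesis using assms(3) by (auto simp: component_def)
qed

text \<open>
  A basis of a product is the disjoint union of bases of the factors. The projection to the factor
  \<open>j\<close> kills all other basis vectors, so both spanning and independence can be checked factor by factor.
\<close>

lemma prod_algebra_coordinates:
  fixes E :: "'i \<Rightarrow> ('c::field, 'l) module" and T :: "'i \<Rightarrow> 't set"
  assumes E: "\<And>j. j \<in> I \<Longrightarrow> class_algebra (E j)" and I: "finite I"
    and co: "\<And>j. j \<in> I \<Longrightarrow> coordinates (E j) (T j) (b j)"
  shows "coordinates (prod_algebra I E) (Sigma I T) (\<lambda>(j, t). component I E j (b j t))"
proof -
  let ?P = "prod_algebra I E"
  let ?b = "\<lambda>(j, t). component I E j (b j t)"
  interpret P: class_algebra ?P by (rule prod_algebra_algebra[OF E])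
  have T: "finite (T j)" if "j \<in> I" for j using coordinates_finite[OF co[OF that]] .
  have fin: "finite (Sigma I T)" using I T by auto
  have bc: "b j t \<in> carrier (E j)" if "j \<in> I" "t \<in> T j" for j t
    using coordinates_closed[OF co[OF that(1)]] that(2) by auto
  have b: "?b p \<in> carrier ?P" if "p \<in> Sigma I T" for p
    using that by (cases p) (auto simp del: prod_algebra_sel intro!: component_closed E bc)
  have sum_closed: "(\<Oplus>\<^bsub>?P\<^esub>p\<in>Sigma I T. c p \<odot>\<^bsub>?P\<^esub> ?b p) \<in> carrier ?P" for c
    using b by (intro P.finsum_closed Pi_I P.scale_closed)
  have sum: "(\<Oplus>\<^bsub>?P\<^esub>p\<in>Sigma I T. c p \<odot>\<^bsub>?P\<^esub> ?b p) j = (\<Oplus>\<^bsub>E j\<^esub>t\<in>T j. c (j, t) \<odot>\<^bsub>E j\<^esub> b j t)"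
    if j: "j \<in> I" for c j
  proof -
    interpret Ej: class_algebra "E j" by (rule E[OF j])
    have "(\<Oplus>\<^bsub>?P\<^esub>p\<in>Sigma I T. c p \<odot>\<^bsub>?P\<^esub> ?b p) j = (\<Oplus>\<^bsub>E j\<^esub>p\<in>Sigma I T. (c p \<odot>\<^bsub>?P\<^esub> ?b p) j)"
      using b by (intro prod_algebra_finsum E fin j P.scale_closed)
    also have "\<dots> = (\<Oplus>\<^bsub>E j\<^esub>p\<in>Pair j ` T j. c p \<odot>\<^bsub>E j\<^esub> b j (snd p))"
      using fin j bc[OF j] T[OF j]
      by (intro Ej.add.finprod_mono_neutral_cong) (auto simp: component_def split: if_splits)
    also have "\<dots> = (\<Oplus>\<^bsub>E j\<^esub>t\<in>T j. c (j, t) \<odot>\<^bsub>E j\<^esub> b j (snd (j, t)))"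
      using bc[OF j] by (intro Ej.finsum_reindex) (auto simp: inj_on_def)
    finally show ?thesis by simp
  qed
  show ?thesis
  proof (rule coordinatesI[OF fin])
    fix v assume v: "v \<in> carrier ?P"
    have "\<exists>c. v j = (\<Oplus>\<^bsub>E j\<^esub>t\<in>T j. c t \<odot>\<^bsub>E j\<^esub> b j t)" if "j \<in> I" for j
      using v that by (intro coordinates_span[OF co[OF that]]) auto
    then have "\<forall>j\<in>I. \<exists>c. v j = (\<Oplus>\<^bsub>E j\<^esub>t\<in>T j. c t \<odot>\<^bsub>E j\<^esub> b j t)" by simp
    from bchoice[OF this] obtain c
      where c: "\<forall>j\<in>I. v j = (\<Oplus>\<^bsub>E j\<^esub>t\<in>T j. c j t \<odot>\<^bsub>E j\<^esub> b j t)" ..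
    show "\<exists>c. v = (\<Oplus>\<^bsub>?P\<^esub>p\<in>Sigma I T. c p \<odot>\<^bsub>?P\<^esub> ?b p)"
    proof (rule exI[of _ "\<lambda>(j, t). c j t"], rule extensionalityI[of _ I])
      show "v \<in> extensional I" using v by (simp add: PiE_iff)
      show "(\<Oplus>\<^bsub>?P\<^esub>p\<in>Sigma I T. (case p of (j, t) \<Rightarrow> c j t) \<odot>\<^bsub>?P\<^esub> ?b p) \<in> extensional I"
        using sum_closed[of "\<lambda>(j, t). c j t"] unfolding prod_algebra_sel(1) PiE_iff by blast
    next
      fix j assume j: "j \<in> I"
      show "v j = (\<Oplus>\<^bsub>?P\<^esub>p\<in>Sigma I T. (case p of (j, t) \<Rightarrow> c j t) \<odot>\<^bsub>?P\<^esub> ?b p) j"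
        unfolding sum[OF j] using c j by simp
    qed
  next
    fix c p assume c: "(\<Oplus>\<^bsub>?P\<^esub>p\<in>Sigma I T. c p \<odot>\<^bsub>?P\<^esub> ?b p) = \<zero>\<^bsub>?P\<^esub>" and p: "p \<in> Sigma I T"
    obtain j t where jt: "p = (j, t)" "j \<in> I" "t \<in> T j" using p by auto
    have "(\<Oplus>\<^bsub>E j\<^esub>t\<in>T j. c (j, t) \<odot>\<^bsub>E j\<^esub> b j t) = \<zero>\<^bsub>E j\<^esub>"
      using sum[OF jt(2), of c] jt(2) unfolding c by simp
    from coordinates_indep[OF co[OF jt(2)] this jt(3)] show "c p = 0" by (simp add: jt)
  qed (rule b)
qed

text \<open>
  If the factor \<open>j\<close> is one-dimensional, the element that is \<open>a\<close> there and one elsewhere is diagonal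
  with a single entry \<open>a\<close>. This is how a real factor makes the norm surjective.
\<close>

lemma component_scalar_norm:
  fixes E :: "'i \<Rightarrow> ('c::field, 'l) module" and a :: 'c
  assumes E: "\<And>j. j \<in> I \<Longrightarrow> class_algebra (E j)" and I: "finite I" and j: "j \<in> I"
    and co: "\<And>j. j \<in> I \<Longrightarrow> coordinates (E j) (T j) (b j)" and Tj: "T j = {t}"
  defines "x \<equiv> \<lambda>i\<in>I. (if i = j then a else 1) \<odot>\<^bsub>E i\<^esub> \<one>\<^bsub>E i\<^esub>"
  shows "x \<in> carrier (prod_algebra I E)" "alg_norm (prod_algebra I E) x = a"
proof -
  let ?P = "prod_algebra I E"
  interpret P: class_algebra ?P by (rule prod_algebra_algebra[OF E])
  have one: "\<one>\<^bsub>E i\<^esub> \<in> carrier (E i)" if "i \<in> I" for i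
    using cring.cring_simprules(6)[OF algebra.axioms(2)[OF class_algebra.algebra[OF E[OF that]]]] .
  show x: "x \<in> carrier ?P"
    using one class_algebra.scale_closed[OF E] by (auto simp: x_def)
  have b: "b i s \<in> carrier (E i)" if "i \<in> I" "s \<in> T i" for i s
    using coordinates_closed[OF co[OF that(1)]] that(2) by auto
  let ?d = "\<lambda>(i, s). if i = j then a else 1"
  have "alg_norm ?P x = (\<Prod>p\<in>Sigma I T. ?d p)"
  proof (rule P.alg_norm_diagonal[OF prod_algebra_coordinates[OF E I co] x])
    fix p assume "p \<in> Sigma I T"
    then obtain i s where p: "p = (i, s)" "i \<in> I" "s \<in> T i" by auto
    have "x \<otimes>\<^bsub>?P\<^esub> component I E i (b i s) = (if i = j then a else 1) \<odot>\<^bsub>?P\<^esub> component I E i (b i s)"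
    proof (rule extensionalityI[of _ I])
      fix k assume k: "k \<in> I"
      interpret Ek: class_algebra "E k" by (rule E[OF k])
      show "(x \<otimes>\<^bsub>?P\<^esub> component I E i (b i s)) k = ((if i = j then a else 1) \<odot>\<^bsub>?P\<^esub> component I E i (b i s)) k"
        using k b[OF p(2,3)] by (auto simp: x_def component_def Ek.scale_mult_left)
    qed auto
    then show "x \<otimes>\<^bsub>?P\<^esub> (case p of (j, t) \<Rightarrow> component I E j (b j t)) =
        ?d p \<odot>\<^bsub>?P\<^esub> (case p of (j, t) \<Rightarrow> component I E j (b j t))"
      by (simp add: p del: prod_algebra_sel)
  qed
  also have "\<dots> = (\<Prod>p\<in>{(j, t)}. ?d p)"
    using I Tj j coordinates_finite[OF co] by (intro prod.mono_neutral_right) (auto split: if_splits)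
  finally show "alg_norm ?P x = a" by simp
qed

section \<open>Finite extensions of the real and complex numbers\<close>

definition complex_algebra :: "('c::field \<Rightarrow> complex) \<Rightarrow> complex set \<Rightarrow> ('c, complex) module" where
  "complex_algebra h F =
     \<lparr> carrier = F, mult = (*), one = 1, zero = 0, add = (+), smult = (\<lambda>a z. h a * z) \<rparr>"

lemma complex_algebra_sel [simp]:
  "carrier (complex_algebra h F) = F"
  "mult (complex_algebra h F) = (*)"
  "one (complex_algebra h F) = 1"
  "zero (complex_algebra h F) = 0"
  "add (complex_algebra h F) = (+)"
  "smult (complex_algebra h F) = (\<lambda>a z. h a * z)"
  by (simp_all add: complex_algebra_def)

text \<open>
  The base field is handled through an embedding onto \<open>\<real>\<close> or \<open>\<complex>\<close>, so both cases of the theorem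
  can be treated inside the complex numbers. With \<open>h\<close> as structure map, a finite extension is,
  up to isomorphism, \<open>range h\<close> or the whole plane; in the complex case these coincide.
\<close>

locale real_or_complex_field = field_hom h
  for h :: "'c::field \<Rightarrow> complex" +
  assumes range_h: "range h = \<real> \<or> range h = UNIV"
begin

lemma h_inj: "h a = h b \<longleftrightarrow> a = b"
  by (rule eq_iff)

lemma of_real_in_range: "complex_of_real r \<in> range h"
  using range_h Reals_of_real[of r] by (metis UNIV_I)

definition real_elem :: "real \<Rightarrow> 'c" where
  "real_elem r = inv_into UNIV h (complex_of_real r)"

lemma h_real_elem [simp]: "h (real_elem r) = complex_of_real r"
  unfolding real_elem_def by (rule f_inv_into_f[OF of_real_in_range])

lemma real_elem_arith:
  "real_elem (r + s) = real_elem r + real_elem s"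
  "real_elem (r - s) = real_elem r - real_elem s"
  "real_elem (r * s) = real_elem r * real_elem s"
  "real_elem 0 = 0" "real_elem 1 = 1" "real_elem (- r) = - real_elem r"
  by (auto simp: hom_add hom_mult hom_minus hom_uminus simp flip: h_inj)

lemma subfield_closed:
  assumes "F \<in> {range h, UNIV}" "x \<in> F" "y \<in> F"
  shows "x + y \<in> F" "x * y \<in> F" "- x \<in> F" "inverse x \<in> F"
  using assms by (auto simp flip: hom_add hom_mult hom_uminus hom_inverse)

lemma range_h_subfield: "F \<in> {range h, UNIV} \<Longrightarrow> h a \<in> F" "F \<in> {range h, UNIV} \<Longrightarrow> 0 \<in> F"
  "F \<in> {range h, UNIV} \<Longrightarrow> 1 \<in> F"
  by (auto intro: range_eqI[of _ _ 0] range_eqI[of _ _ 1])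

lemma complex_algebra_algebra:
  assumes F: "F \<in> {range h, UNIV}"
  shows "class_algebra (complex_algebra h F)"
proof -
  note cl = subfield_closed[OF F] range_h_subfield[OF F]
  have "cring (complex_algebra h F)"
  proof (rule cringI)
    show "abelian_group (complex_algebra h F)"
    proof (rule abelian_groupI)
      fix x assume x: "x \<in> carrier (complex_algebra h F)"
      show "\<exists>y\<in>carrier (complex_algebra h F). y \<oplus>\<^bsub>complex_algebra h F\<^esub> x = \<zero>\<^bsub>complex_algebra h F\<^esub>"
        by (rule bexI[of _ "- x"]) (use x cl in auto)
    qed (auto simp: cl)
    show "comm_monoid (complex_algebra h F)"
      by (rule comm_monoidI) (auto simp: cl)
  qed (auto simp: algebra_simps)
  then have "algebra class_ring (complex_algebra h F)"
    by (intro algebraI[OF class_cring.is_cring]) (auto simp: cl hom_add hom_mult algebra_simps)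
  then show ?thesis by (simp add: class_algebra_iff)
qed

lemma complex_algebra_field:
  assumes F: "F \<in> {range h, UNIV}"
  shows "field (complex_algebra h F)"
proof -
  interpret class_algebra "complex_algebra h F" by (rule complex_algebra_algebra[OF F])
  show ?thesis
  proof (rule cring_fieldI2)
    fix a assume "a \<in> carrier (complex_algebra h F)" "a \<noteq> \<zero>\<^bsub>complex_algebra h F\<^esub>"
    then show "\<exists>b\<in>carrier (complex_algebra h F). a \<otimes>\<^bsub>complex_algebra h F\<^esub> b = \<one>\<^bsub>complex_algebra h F\<^esub>"
      using subfield_closed[OF F] by (intro bexI[of _ "inverse a"]) auto
  qed simp
qed

lemma complex_algebra_alg_poly:
  assumes F: "F \<in> {range h, UNIV}" and z: "z \<in> F"
  shows "alg_poly (complex_algebra h F) q z = (\<Sum>i\<le>degree q. h (coeff q i) * z ^ i)"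
proof -
  interpret class_algebra "complex_algebra h F" by (rule complex_algebra_algebra[OF F])
  have pow: "z [^]\<^bsub>complex_algebra h F\<^esub> i = z ^ i" for i :: nat
    by (induction i) (simp_all add: mult.commute)
  have "z ^ i \<in> F" for i using nat_pow_closed[of z i] z by (simp add: pow)
  then have term_closed: "h a * z ^ i \<in> F" for a i
    using subfield_closed(2)[OF F range_h_subfield(1)[OF F]] by simp
  have "(\<Oplus>\<^bsub>complex_algebra h F\<^esub>i\<in>S. h (coeff q i) * z ^ i) = (\<Sum>i\<in>S. h (coeff q i) * z ^ i)"
    if "finite S" for S
    using that by (induction S rule: finite_induct) (simp_all add: term_closed)
  then show ?thesis by (simp add: alg_poly_def pow)
qed

lemma coordinates_range_h: "coordinates (complex_algebra h (range h)) {0::nat} (\<lambda>_. 1)"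
proof -
  interpret class_algebra "complex_algebra h (range h)" by (rule complex_algebra_algebra) simp
  have sum: "(\<Oplus>\<^bsub>complex_algebra h (range h)\<^esub>i\<in>{0::nat}. c i \<odot>\<^bsub>complex_algebra h (range h)\<^esub> 1) = h (c 0)" for c
    by (subst finsum_insert) auto
  show ?thesis
  proof (rule coordinatesI, unfold sum)
    fix v assume "v \<in> carrier (complex_algebra h (range h))"
    then obtain a where "v = h a" by auto
    then show "\<exists>c. v = h (c (0::nat))" by (intro exI[of _ "\<lambda>_. a"]) simp
  qed (auto intro: range_eqI[of _ _ 1])
qed

lemma coordinates_complex:
  assumes "range h = \<real>"
  shows "coordinates (complex_algebra h UNIV) {0, 1::nat} (\<lambda>i. if i = 0 then 1 else \<i>)"
proof -
  interpret class_algebra "complex_algebra h UNIV" by (rule complex_algebra_algebra) simp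
  have sum: "(\<Oplus>\<^bsub>complex_algebra h UNIV\<^esub>i\<in>{0, 1::nat}. c i \<odot>\<^bsub>complex_algebra h UNIV\<^esub> (if i = 0 then 1 else \<i>)) =
      h (c 0) + h (c 1) * \<i>" for c :: "nat \<Rightarrow> 'c"
    by simp
  have real: "h a \<in> \<real>" for a using assms by auto
  show ?thesis
  proof (rule coordinatesI, unfold sum)
    fix v :: complex
    show "\<exists>c. v = h (c (0::nat)) + h (c 1) * \<i>"
      by (rule exI[of _ "\<lambda>i. real_elem (if i = 0 then Re v else Im v)"]) (simp add: complex_eq_iff)
  next
    fix c :: "nat \<Rightarrow> 'c" and i :: nat
    assume "h (c 0) + h (c 1) * \<i> = \<zero>\<^bsub>complex_algebra h UNIV\<^esub>" and i: "i \<in> {0, 1}"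
    then have "Re (h (c 0)) = 0" "Re (h (c 1)) = 0"
      using real[of "c 0"] real[of "c 1"] by (auto simp: complex_eq_iff complex_is_Real_iff)
    then have "h (c 0) = 0" "h (c 1) = 0"
      using real[of "c 0"] real[of "c 1"] by (auto simp: complex_eq_iff complex_is_Real_iff)
    then show "c i = 0" using i by auto
  qed auto
qed

text \<open>
  An irreducible polynomial has a complex root \<open>z\<close>. If \<open>z\<close> comes from \<open>'c\<close>, the polynomial is
  associated to the linear polynomial with this root. Otherwise the base field is real, and the
  polynomial is associated to the quadratic polynomial with roots \<open>z\<close> and \<open>cnj z\<close>.
\<close>

lemma irreducible_poly_cases [consumes 1, case_names linear quadratic]:
  fixes q :: "'c poly"
  assumes q: "Factorial_Ring.irreducible q"
  obtains (linear) e a where "e \<noteq> 0" "q = [:- e * a, e:]"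
  | (quadratic) e a b where "range h = \<real>" "e \<noteq> 0" "b \<noteq> 0" "q = [:e * (a * a + b * b), - (2 * e * a), e:]"
proof -
  have map_add: "map_poly h (r + s) = map_poly h r + map_poly h s" for r s
    by (rule poly_eqI) (simp add: coeff_map_poly hom_add)
  have map_mult: "map_poly h (r * s) = map_poly h r * map_poly h s" for r s
    by (rule poly_eqI) (simp add: coeff_map_poly coeff_mult hom_sum hom_mult)
  have map_eval: "poly (map_poly h r) (h a) = h (poly r a)" for r a
    by (induction r) (simp_all add: map_poly_pCons hom_add hom_mult)
  have "q \<noteq> 0" "\<not> q dvd 1" using q by (auto simp: Factorial_Ring.irreducible_def)
  then have "degree q \<noteq> 0" using is_unit_iff_degree[of q] by blast
  moreover have "degree (map_poly h q) = degree q" by (rule degree_map_poly) simp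
  ultimately have "\<not> constant (poly (map_poly h q))" by (simp add: constant_degree)
  then obtain z where z: "poly (map_poly h q) z = 0"
    using fundamental_theorem_of_algebra by blast
  have factor: "\<exists>e. e \<noteq> 0 \<and> q = Polynomial.smult e p" if "p dvd q" "degree p > 0" for p
  proof -
    obtain u where u: "q = p * u" using \<open>p dvd q\<close> by (auto elim: dvdE)
    have "\<not> p dvd 1" using \<open>degree p > 0\<close> by (metis is_unit_iff_degree less_numeral_extra(3) dvd_0_left_iff zero_neq_one)
    then have "u dvd 1" using irreducibleD[OF q u] by blast
    then obtain e where "u = [:e:]" "e \<noteq> 0" by (metis is_unit_polyE' is_unit_poly_iff dvd_0_left_iff zero_neq_one)
    then show ?thesis using u by (intro exI[of _ e]) simp
  qed
  show ?thesis
  proof (cases "z \<in> range h")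
    case True
    then obtain a where a: "z = h a" by blast
    then have "poly q a = 0" using z by (simp add: map_eval)
    then have "[:- a, 1:] dvd q" by (simp add: poly_eq_0_iff_dvd)
    from factor[OF this] obtain e where "e \<noteq> 0" "q = Polynomial.smult e [:- a, 1:]" by auto
    then show ?thesis by (intro linear[of e a]) auto
  next
    case False
    then have R: "range h = \<real>" and "z \<notin> \<real>" using range_h by auto
    then have Im: "Im z \<noteq> 0" by (simp add: complex_is_Real_iff)
    define a where "a = real_elem (Re z)"
    define b where "b = real_elem (Im z)"
    \<comment> \<open>The polynomial with roots \<open>z\<close> and \<open>cnj z\<close>. The remainder of \<open>q\<close> modulo \<open>p\<close> is linear with a non-real root, hence zero.\<close>
    define p where "p = [:a * a + b * b, - (2 * a), 1:]"
    have b: "b \<noteq> 0" using Im unfolding b_def by (metis h_real_elem hom_zero of_real_eq_0_iff)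
    have p0: "degree p = 2" and p_nz: "p \<noteq> 0" by (simp_all add: p_def)
    have "poly (map_poly h p) z = 0"
      by (simp add: p_def a_def b_def map_poly_pCons hom_distribs complex_eq_iff algebra_simps)
    moreover have "q = q div p * p + q mod p" by simp
    then have "map_poly h q = map_poly h (q div p) * map_poly h p + map_poly h (q mod p)"
      by (metis map_add map_mult)
    ultimately have r: "poly (map_poly h (q mod p)) z = 0" using z by simp
    have "q mod p = 0"
    proof -
      have "degree (q mod p) < 2" using degree_mod_less'[of p q] p0 p_nz by (cases "q mod p = 0") auto
      then obtain r0 r1 where r01: "q mod p = [:r0, r1:]"
        by (metis One_nat_def Suc_1 degree_eq_zeroE less_2_cases pCons_0_0 degree1_coeffs)
      have "h r0 + z * h r1 = 0" using r by (simp add: r01 map_poly_pCons)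
      moreover have "Im (h r0) = 0" "Im (h r1) = 0" using R by (auto simp flip: complex_is_Real_iff)
      ultimately have "h r1 = 0" "h r0 = 0" using Im by (auto simp: complex_eq_iff)
      then show ?thesis by (simp add: r01)
    qed
    then have "p dvd q" by (simp add: mod_eq_0_iff_dvd)
    from factor[OF this] obtain e where "e \<noteq> 0" "q = Polynomial.smult e p" using p0 by auto
    then show ?thesis using R b by (intro quadratic[of e b a]) (auto simp: p_def algebra_simps)
  qed
qed

text \<open>
  Completing the square in the quadratic equation of \<open>x\<close> shows that \<open>x\<close> is a combination of one and
  a square root \<open>u\<close> of \<open>-1\<close>.
\<close>

lemma finite_separable_extension_square [consumes 2, case_names scalar imaginary]:
  fixes E :: "('c, 'l) module"
  assumes E: "finite_separable_extension E" and x: "x \<in> carrier E"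
  obtains (scalar) a where "x = a \<odot>\<^bsub>E\<^esub> \<one>\<^bsub>E\<^esub>"
  | (imaginary) a b u where "range h = \<real>" "u \<in> carrier E" "u \<otimes>\<^bsub>E\<^esub> u = (- 1) \<odot>\<^bsub>E\<^esub> \<one>\<^bsub>E\<^esub>"
      "x = a \<odot>\<^bsub>E\<^esub> \<one>\<^bsub>E\<^esub> \<oplus>\<^bsub>E\<^esub> b \<odot>\<^bsub>E\<^esub> u"
proof -
  interpret E: class_algebra E using E by (simp add: finite_separable_extension_def class_algebra_iff)
  obtain q where q: "Factorial_Ring.irreducible q" "alg_poly E q x = \<zero>\<^bsub>E\<^esub>"
    using E x by (auto simp: finite_separable_extension_def)
  have cancel: "y = \<zero>\<^bsub>E\<^esub>" if "e \<odot>\<^bsub>E\<^esub> y = \<zero>\<^bsub>E\<^esub>" "e \<noteq> 0" "y \<in> carrier E" for e y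
  proof -
    have "y = inverse e \<odot>\<^bsub>E\<^esub> (e \<odot>\<^bsub>E\<^esub> y)" using that(2,3) by simp
    then show ?thesis using that(1) by simp
  qed
  from q(1) show ?thesis
  proof (cases rule: irreducible_poly_cases)
    case (linear e a)
    have "{..Suc 0} = {0, Suc 0}" by auto
    then have "alg_poly E q x = (- e * a) \<odot>\<^bsub>E\<^esub> \<one>\<^bsub>E\<^esub> \<oplus>\<^bsub>E\<^esub> e \<odot>\<^bsub>E\<^esub> x"
      using linear x by (simp add: alg_poly_def)
    also have "\<dots> = e \<odot>\<^bsub>E\<^esub> ((- a) \<odot>\<^bsub>E\<^esub> \<one>\<^bsub>E\<^esub> \<oplus>\<^bsub>E\<^esub> x)"
      using x by (simp add: E.scale_add_right)
    finally have "e \<odot>\<^bsub>E\<^esub> ((- a) \<odot>\<^bsub>E\<^esub> \<one>\<^bsub>E\<^esub> \<oplus>\<^bsub>E\<^esub> x) = \<zero>\<^bsub>E\<^esub>"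
      unfolding q(2) by (rule sym)
    from cancel[OF this linear(1)] have "(- a) \<odot>\<^bsub>E\<^esub> \<one>\<^bsub>E\<^esub> \<oplus>\<^bsub>E\<^esub> x = \<zero>\<^bsub>E\<^esub>"
      using x by simp
    then have "\<ominus>\<^bsub>E\<^esub> (a \<odot>\<^bsub>E\<^esub> \<one>\<^bsub>E\<^esub>) \<oplus>\<^bsub>E\<^esub> x = \<zero>\<^bsub>E\<^esub>"
      by (simp add: E.scale_minus_left)
    then have "\<ominus>\<^bsub>E\<^esub> x = \<ominus>\<^bsub>E\<^esub> (a \<odot>\<^bsub>E\<^esub> \<one>\<^bsub>E\<^esub>)"
      using x by (intro E.minus_equality) auto
    then have "x = a \<odot>\<^bsub>E\<^esub> \<one>\<^bsub>E\<^esub>"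
      using x by (metis E.minus_minus E.one_closed E.scale_closed)
    then show ?thesis by (rule scalar)
  next
    case (quadratic e a b)
    have sq: "x [^]\<^bsub>E\<^esub> (2::nat) = x \<otimes>\<^bsub>E\<^esub> x" using x by (simp add: numeral_2_eq_2)
    have "{..Suc (Suc 0)} = {0, 1, 2::nat}" by auto
    then have "alg_poly E q x =
        (e * (a * a + b * b)) \<odot>\<^bsub>E\<^esub> \<one>\<^bsub>E\<^esub> \<oplus>\<^bsub>E\<^esub> ((- (2 * e * a)) \<odot>\<^bsub>E\<^esub> x \<oplus>\<^bsub>E\<^esub> e \<odot>\<^bsub>E\<^esub> (x \<otimes>\<^bsub>E\<^esub> x))"
      using quadratic x by (simp add: alg_poly_def sq numeral_2_eq_2)
    also have "\<dots> = e \<odot>\<^bsub>E\<^esub> ((a * a + b * b) \<odot>\<^bsub>E\<^esub> \<one>\<^bsub>E\<^esub> \<oplus>\<^bsub>E\<^esub> ((- (2 * a)) \<odot>\<^bsub>E\<^esub> x \<oplus>\<^bsub>E\<^esub> x \<otimes>\<^bsub>E\<^esub> x))"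
      using x by (simp add: E.scale_add_right algebra_simps)
    finally have "e \<odot>\<^bsub>E\<^esub> ((a * a + b * b) \<odot>\<^bsub>E\<^esub> \<one>\<^bsub>E\<^esub> \<oplus>\<^bsub>E\<^esub> ((- (2 * a)) \<odot>\<^bsub>E\<^esub> x \<oplus>\<^bsub>E\<^esub> x \<otimes>\<^bsub>E\<^esub> x)) = \<zero>\<^bsub>E\<^esub>"
      unfolding q(2) by (rule sym)
    from cancel[OF this quadratic(2)]
    have eq: "(a * a + b * b) \<odot>\<^bsub>E\<^esub> \<one>\<^bsub>E\<^esub> \<oplus>\<^bsub>E\<^esub> ((- (2 * a)) \<odot>\<^bsub>E\<^esub> x \<oplus>\<^bsub>E\<^esub> x \<otimes>\<^bsub>E\<^esub> x) = \<zero>\<^bsub>E\<^esub>"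
      using x by simp
    \<comment> \<open>The equation of \<open>x\<close> reads \<open>(x - a)\<^sup>2 = - b\<^sup>2\<close>.\<close>
    define u where "u = inverse b \<odot>\<^bsub>E\<^esub> ((- a) \<odot>\<^bsub>E\<^esub> \<one>\<^bsub>E\<^esub> \<oplus>\<^bsub>E\<^esub> x)"
    have u: "u \<in> carrier E" using x by (simp add: u_def)
    have "x = a \<odot>\<^bsub>E\<^esub> \<one>\<^bsub>E\<^esub> \<oplus>\<^bsub>E\<^esub> b \<odot>\<^bsub>E\<^esub> u"
    proof -
      have "a \<odot>\<^bsub>E\<^esub> \<one>\<^bsub>E\<^esub> \<oplus>\<^bsub>E\<^esub> b \<odot>\<^bsub>E\<^esub> u = a \<odot>\<^bsub>E\<^esub> \<one>\<^bsub>E\<^esub> \<oplus>\<^bsub>E\<^esub> ((- a) \<odot>\<^bsub>E\<^esub> \<one>\<^bsub>E\<^esub> \<oplus>\<^bsub>E\<^esub> x)"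
        using x quadratic by (simp add: u_def)
      then show ?thesis using x by (simp add: E.scale_minus_left E.r_neg2)
    qed
    moreover have "u \<otimes>\<^bsub>E\<^esub> u = (- 1) \<odot>\<^bsub>E\<^esub> \<one>\<^bsub>E\<^esub>"
    proof -
      let ?v = "(- a) \<odot>\<^bsub>E\<^esub> \<one>\<^bsub>E\<^esub> \<oplus>\<^bsub>E\<^esub> x"
      have "(- (2 * a)) \<odot>\<^bsub>E\<^esub> x = (- a) \<odot>\<^bsub>E\<^esub> x \<oplus>\<^bsub>E\<^esub> (- a) \<odot>\<^bsub>E\<^esub> x"
        using E.scale_add_left[OF x, of "- a" "- a"] unfolding mult_2 minus_add_distrib .
      moreover have "(a * a + b * b) \<odot>\<^bsub>E\<^esub> \<one>\<^bsub>E\<^esub> = (a * a) \<odot>\<^bsub>E\<^esub> \<one>\<^bsub>E\<^esub> \<oplus>\<^bsub>E\<^esub> (b * b) \<odot>\<^bsub>E\<^esub> \<one>\<^bsub>E\<^esub>"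
        by (rule E.scale_add_left) simp
      moreover have "?v \<otimes>\<^bsub>E\<^esub> ?v = (a * a) \<odot>\<^bsub>E\<^esub> \<one>\<^bsub>E\<^esub> \<oplus>\<^bsub>E\<^esub> ((- a) \<odot>\<^bsub>E\<^esub> x \<oplus>\<^bsub>E\<^esub> ((- a) \<odot>\<^bsub>E\<^esub> x \<oplus>\<^bsub>E\<^esub> x \<otimes>\<^bsub>E\<^esub> x))"
        using x by (simp add: E.l_distr E.r_distr E.scale_add_right E.scale_mult_left E.scale_mult_right E.a_assoc)
      ultimately have "?v \<otimes>\<^bsub>E\<^esub> ?v \<oplus>\<^bsub>E\<^esub> (b * b) \<odot>\<^bsub>E\<^esub> \<one>\<^bsub>E\<^esub> = \<zero>\<^bsub>E\<^esub>"
        using eq x by (simp add: E.a_ac)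
      then have "?v \<otimes>\<^bsub>E\<^esub> ?v = \<ominus>\<^bsub>E\<^esub> ((b * b) \<odot>\<^bsub>E\<^esub> \<one>\<^bsub>E\<^esub>)"
        using x by (intro E.minus_equality[symmetric]) auto
      then have "?v \<otimes>\<^bsub>E\<^esub> ?v = (- (b * b)) \<odot>\<^bsub>E\<^esub> \<one>\<^bsub>E\<^esub>" by (simp add: E.scale_minus_left)
      moreover have "u \<otimes>\<^bsub>E\<^esub> u = (inverse b * inverse b) \<odot>\<^bsub>E\<^esub> (?v \<otimes>\<^bsub>E\<^esub> ?v)"
        unfolding u_def using x by (subst E.scale_mult_left, simp, simp, subst E.scale_mult_right) simp_all
      moreover have "inverse b * inverse b * (b * b) = 1"
        using quadratic(3) by (simp add: field_simps)
      ultimately show ?thesis by simp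
    qed
    ultimately show ?thesis using quadratic u by (intro imaginary[of u a b])
  qed
qed

text \<open>
  If some element is not a scalar, the extension contains a square root \<open>j\<close> of \<open>-1\<close>. Any other element
  has the form \<open>a + b u\<close> with \<open>u\<^sup>2 = -1\<close>. As \<open>u\<close> is \<open>j\<close> or \<open>-j\<close>, one and \<open>j\<close> already span.
\<close>

lemma finite_separable_extension_cases:
  assumes E: "finite_separable_extension E"
  obtains "alg_iso E (complex_algebra h (range h)) \<noteq> {}"
  | "range h = \<real>" "alg_iso E (complex_algebra h UNIV) \<noteq> {}"
proof -
  interpret E: class_algebra E using E by (simp add: finite_separable_extension_def class_algebra_iff)
  interpret Ef: Ring.field E using E by (simp add: finite_separable_extension_def)
  have scal_inj: "a = 0" if "a \<odot>\<^bsub>E\<^esub> \<one>\<^bsub>E\<^esub> = \<zero>\<^bsub>E\<^esub>" for a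
  proof (rule ccontr)
    assume "a \<noteq> 0"
    then have "\<one>\<^bsub>E\<^esub> = inverse a \<odot>\<^bsub>E\<^esub> (a \<odot>\<^bsub>E\<^esub> \<one>\<^bsub>E\<^esub>)" by simp
    then show False using that Ef.one_not_zero by simp
  qed
  show ?thesis
  proof (cases "\<forall>x\<in>carrier E. \<exists>a. x = a \<odot>\<^bsub>E\<^esub> \<one>\<^bsub>E\<^esub>")
    case True
    let ?C = "complex_algebra h (range h)"
    have C: "class_algebra ?C" by (rule complex_algebra_algebra) simp
    have "(\<lambda>z. inv_into UNIV h z \<odot>\<^bsub>E\<^esub> \<one>\<^bsub>E\<^esub>) \<in> alg_iso ?C E"
    proof (rule alg_isoI)
      have inv [simp]: "inv_into UNIV h (h a) = a" for a by (rule inv_f_f)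
      show "bij_betw (\<lambda>z. inv_into UNIV h z \<odot>\<^bsub>E\<^esub> \<one>\<^bsub>E\<^esub>) (carrier ?C) (carrier E)"
        unfolding bij_betw_def
      proof
        show "inj_on (\<lambda>z. inv_into UNIV h z \<odot>\<^bsub>E\<^esub> \<one>\<^bsub>E\<^esub>) (carrier ?C)"
        proof (rule inj_onI)
          fix y z assume yz: "y \<in> carrier ?C" "z \<in> carrier ?C"
            "inv_into UNIV h y \<odot>\<^bsub>E\<^esub> \<one>\<^bsub>E\<^esub> = inv_into UNIV h z \<odot>\<^bsub>E\<^esub> \<one>\<^bsub>E\<^esub>"
          then obtain a b where yz': "y = h a" "z = h b" by auto
          then have ab: "a \<odot>\<^bsub>E\<^esub> \<one>\<^bsub>E\<^esub> = b \<odot>\<^bsub>E\<^esub> \<one>\<^bsub>E\<^esub>"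
            using yz by simp
          have "(a - b) \<odot>\<^bsub>E\<^esub> \<one>\<^bsub>E\<^esub> = \<zero>\<^bsub>E\<^esub>"
            using E.scale_add_left[of "\<one>\<^bsub>E\<^esub>" a "- b"] by (simp add: E.scale_minus_left ab E.r_neg)
          then show "y = z" using scal_inj[of "a - b"] yz' by simp
        qed
        show "(\<lambda>z. inv_into UNIV h z \<odot>\<^bsub>E\<^esub> \<one>\<^bsub>E\<^esub>) ` carrier ?C = carrier E"
          using True by (force simp: image_iff)
      qed
      have "inv_into UNIV h 1 = 1" using inv[of 1] by simp
      then show "inv_into UNIV h \<one>\<^bsub>?C\<^esub> \<odot>\<^bsub>E\<^esub> \<one>\<^bsub>E\<^esub> = \<one>\<^bsub>E\<^esub>" by simp
    qed (auto simp: E.scale_mult_left E.scale_add_left[symmetric] simp flip: hom_add hom_mult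
        )
    from alg_iso_sym[OF this C] show ?thesis using that(1) by blast
  next
    case False
    then obtain x where x: "x \<in> carrier E" "\<And>a. x \<noteq> a \<odot>\<^bsub>E\<^esub> \<one>\<^bsub>E\<^esub>" by blast
    from E x(1) obtain j where R: "range h = \<real>" and j: "j \<in> carrier E" "j \<otimes>\<^bsub>E\<^esub> j = (- 1) \<odot>\<^bsub>E\<^esub> \<one>\<^bsub>E\<^esub>"
      by (cases rule: finite_separable_extension_square) (use x(2) in auto)
    let ?C = "complex_algebra h UNIV"
    have C: "class_algebra ?C" by (rule complex_algebra_algebra) simp
    define \<psi> where "\<psi> z = real_elem (Re z) \<odot>\<^bsub>E\<^esub> \<one>\<^bsub>E\<^esub> \<oplus>\<^bsub>E\<^esub> real_elem (Im z) \<odot>\<^bsub>E\<^esub> j" for z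
    have h_real: "h a = complex_of_real (Re (h a))" for a
      using R by (metis Reals_cases Re_complex_of_real rangeI)
    have re_h: "real_elem (Re (h a)) = a" for a
      using h_real h_inj by (metis h_real_elem)
    have im_h: "Im (h a) = 0" for a using h_real by (metis Im_complex_of_real)
    have cl: "\<psi> z \<in> carrier E" for z using j by (simp add: \<psi>_def)
    have add: "\<psi> (y + z) = \<psi> y \<oplus>\<^bsub>E\<^esub> \<psi> z" for y z
      using j by (simp add: \<psi>_def real_elem_arith E.scale_add_left E.a_ac)
    have mult: "\<psi> (y * z) = \<psi> y \<otimes>\<^bsub>E\<^esub> \<psi> z" for y z
    proof -
      let ?a = "real_elem (Re y)" let ?b = "real_elem (Im y)"
      let ?c = "real_elem (Re z)" let ?d = "real_elem (Im z)"
      have "\<psi> y \<otimes>\<^bsub>E\<^esub> \<psi> z = (?a * ?c) \<odot>\<^bsub>E\<^esub> \<one>\<^bsub>E\<^esub> \<oplus>\<^bsub>E\<^esub> ((?a * ?d) \<odot>\<^bsub>E\<^esub> j \<oplus>\<^bsub>E\<^esub>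
          ((?b * ?c) \<odot>\<^bsub>E\<^esub> j \<oplus>\<^bsub>E\<^esub> (- (?b * ?d)) \<odot>\<^bsub>E\<^esub> \<one>\<^bsub>E\<^esub>))"
        using j by (simp add: \<psi>_def E.l_distr E.r_distr E.scale_add_right E.scale_mult_left E.scale_mult_right E.a_assoc E.a_lcomm mult.commute)
      also have "\<dots> = (?a * ?c - ?b * ?d) \<odot>\<^bsub>E\<^esub> \<one>\<^bsub>E\<^esub> \<oplus>\<^bsub>E\<^esub> (?a * ?d + ?b * ?c) \<odot>\<^bsub>E\<^esub> j"
        using j E.scale_add_left[of "\<one>\<^bsub>E\<^esub>" "?a * ?c" "- (?b * ?d)"]
          E.scale_add_left[of j "?a * ?d" "?b * ?c"] by (simp add: E.a_ac)
      also have "\<dots> = \<psi> (y * z)" by (simp add: \<psi>_def real_elem_arith)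
      finally show ?thesis by simp
    qed
    have one: "\<psi> 1 = \<one>\<^bsub>E\<^esub>" using j by (simp add: \<psi>_def real_elem_arith)
    have "\<psi> \<in> alg_iso ?C E"
    proof (rule alg_isoI)
      show "\<psi> (a \<odot>\<^bsub>?C\<^esub> z) = a \<odot>\<^bsub>E\<^esub> \<psi> z" for a z
      proof -
        have "\<psi> (h a) = a \<odot>\<^bsub>E\<^esub> \<one>\<^bsub>E\<^esub>" using j by (simp add: \<psi>_def re_h im_h real_elem_arith)
        then show ?thesis using cl[of z] by (simp add: mult E.scale_mult_left)
      qed
      have "inj \<psi>"
      proof (rule injI, rule ccontr)
        fix y z assume yz: "\<psi> y = \<psi> z" "y \<noteq> z"
        have "\<psi> (y + (- z)) \<oplus>\<^bsub>E\<^esub> \<psi> z = \<psi> y" by (simp flip: add)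
        then have "\<psi> (y - z) = \<zero>\<^bsub>E\<^esub>" using yz cl[of z] cl[of "y - z"] by (simp add: E.add.r_cancel_one')
        moreover have "\<psi> ((y - z) * inverse (y - z)) = \<one>\<^bsub>E\<^esub>" using yz one by simp
        ultimately show False using cl Ef.one_not_zero by (simp add: mult)
      qed
      moreover have "\<exists>z. y = \<psi> z" if y: "y \<in> carrier E" for y
        using E y
      proof (cases rule: finite_separable_extension_square)
        case (scalar a)
        then have "y = \<psi> (h a)" using j by (simp add: \<psi>_def re_h im_h real_elem_arith)
        then show ?thesis by blast
      next
        case (imaginary a b u)
        \<comment> \<open>In a field, \<open>u\<^sup>2 = j\<^sup>2\<close> forces \<open>u = \<plusminus>j\<close>.\<close>
        have "(u \<oplus>\<^bsub>E\<^esub> j) \<otimes>\<^bsub>E\<^esub> (u \<ominus>\<^bsub>E\<^esub> j) = \<zero>\<^bsub>E\<^esub>"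
        proof -
          have "(u \<oplus>\<^bsub>E\<^esub> j) \<otimes>\<^bsub>E\<^esub> (u \<ominus>\<^bsub>E\<^esub> j) = u \<otimes>\<^bsub>E\<^esub> u \<ominus>\<^bsub>E\<^esub> j \<otimes>\<^bsub>E\<^esub> j"
            using j(1) imaginary(2) by (simp add: a_minus_def E.l_distr E.r_distr E.r_minus E.l_minus E.a_assoc E.m_comm E.r_neg1 E.r_neg2)
          then show ?thesis using j imaginary by (simp add: a_minus_def E.r_neg)
        qed
        then have "u \<oplus>\<^bsub>E\<^esub> j = \<zero>\<^bsub>E\<^esub> \<or> u \<ominus>\<^bsub>E\<^esub> j = \<zero>\<^bsub>E\<^esub>"
          using j(1) imaginary(2) by (intro Ef.integral) auto
        then have "u = \<ominus>\<^bsub>E\<^esub> j \<or> u = j"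
          using j(1) imaginary(2) E.minus_equality[of u j] E.minus_equality[of u "\<ominus>\<^bsub>E\<^esub> j"]
          by (auto simp: a_minus_def)
        then have "u = \<psi> (- \<i>) \<or> u = \<psi> \<i>"
          using j by (auto simp: \<psi>_def real_elem_arith E.scale_minus_left)
        moreover have "y = \<psi> (h a) \<oplus>\<^bsub>E\<^esub> \<psi> (h b) \<otimes>\<^bsub>E\<^esub> u"
          using j imaginary by (simp add: \<psi>_def re_h im_h real_elem_arith E.scale_mult_left)
        ultimately show ?thesis by (metis add mult)
      qed
      ultimately show "bij_betw \<psi> (carrier ?C) (carrier E)"
        using cl by (auto simp: bij_betw_def)
    qed (simp_all add: cl add mult one)
    from alg_iso_sym[OF this C] R show ?thesis using that(2) by blast
  qed
qed

text \<open>
  The converse of the classification. It is stated for a copy because the factors of an etale algebra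
  have to live on the same type as the algebra.
\<close>

lemma complex_algebra_separable:
  assumes F: "F \<in> {range h, UNIV}" and g: "inj_on g F"
  shows "finite_separable_extension (copy_algebra g (complex_algebra h F))"
proof -
  let ?C = "complex_algebra h F" and ?E = "copy_algebra g (complex_algebra h F)"
  have C: "class_algebra ?C" by (rule complex_algebra_algebra[OF F])
  have g': "inj_on g (carrier ?C)" using g by simp
  have iso: "g \<in> alg_iso ?C ?E" by (rule copy_algebra_iso[OF g'])
  have E: "class_algebra ?E" by (rule copy_algebra_algebra[OF g' C])
  interpret C: class_algebra ?C by fact
  interpret E: class_algebra ?E by fact
  have "\<exists>b. \<exists>T::nat set. coordinates ?C T b"
  proof (cases "F = range h")
    case True
    then show ?thesis using coordinates_range_h by blast
  next
    case False
    then show ?thesis using F range_h coordinates_complex by auto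
  qed
  then have fin: "vectorspace.fin_dim class_ring ?E"
    using coordinates_iso[OF _ iso C E] E.coordinates_basis(3) by metis
  have "\<exists>q. Factorial_Ring.irreducible q \<and> alg_poly ?E q x = \<zero>\<^bsub>?E\<^esub> \<and> coprime q (pderiv q)"
    if x: "x \<in> carrier ?E" for x
  proof -
    obtain z where z: "z \<in> F" "x = g z" using x by (auto simp: copy_algebra_def Let_def)
    have reduce: ?thesis if "Factorial_Ring.irreducible q" "coprime q (pderiv q)" "alg_poly ?C q z = 0" for q
      using that alg_poly_iso[OF iso C E, of z q] alg_iso_zero[OF iso C E] z
      by (intro exI[of _ q]) simp
    show ?thesis
    proof (cases "z \<in> range h")
      case True
      then obtain a where a: "z = h a" by blast
      have "alg_poly ?C [:- a, 1:] z = 0"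
        unfolding complex_algebra_alg_poly[OF F z(1)] by (simp add: a hom_uminus)
      moreover have "Factorial_Ring.irreducible [:- a, 1:]"
        by (rule irreducible_linear_field_poly) simp
      moreover have "coprime [:- a, 1:] (pderiv [:- a, 1:])"
        by (simp add: pderiv_pCons flip: one_pCons)
      ultimately show ?thesis by (intro reduce)
    next
      case False
      then have R: "range h = \<real>" and Im: "Im z \<noteq> 0" using range_h by (auto simp: complex_is_Real_iff)
      define a where "a = real_elem (Re z)"
      define b where "b = real_elem (Im z)"
      define p where "p = [:a * a + b * b, - (2 * a), 1:]"
      have b: "b \<noteq> 0" using Im unfolding b_def by (metis h_real_elem hom_zero of_real_eq_0_iff)
      have "alg_poly ?C p z = 0"
        unfolding complex_algebra_alg_poly[OF F z(1)]
        by (simp add: p_def hom_distribs a_def b_def complex_eq_iff algebra_simps)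
      moreover have "Factorial_Ring.irreducible p"
      proof (rule Factorial_Ring.irreducibleI)
        show "p \<noteq> 0" "\<not> p dvd 1" by (simp_all add: p_def is_unit_pCons_iff)
        fix r s assume rs: "p = r * s"
        have "degree p = 2" by (simp add: p_def)
        moreover have nz: "r \<noteq> 0" "s \<noteq> 0" using rs by (auto simp: p_def)
        ultimately have deg: "degree r + degree s = 2" using rs degree_mult_eq[OF nz] by simp
        have noroot: "poly p c \<noteq> 0" for c
        proof
          assume "poly p c = 0"
          then have "h ((c - a) * (c - a) + b * b) = 0" by (simp add: p_def algebra_simps)
          then have "(h c - of_real (Re z))\<^sup>2 + (of_real (Im z))\<^sup>2 = 0"
            by (simp add: hom_distribs a_def b_def power2_eq_square)
          moreover obtain r where "h c = of_real r" using R by (metis Reals_cases rangeI)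
          ultimately have "complex_of_real ((r - Re z)\<^sup>2 + (Im z)\<^sup>2) = 0" by simp
          then have "(r - Re z)\<^sup>2 + (Im z)\<^sup>2 = 0" by (simp only: of_real_eq_0_iff)
          then show False using Im by (simp add: sum_power2_eq_zero_iff)
        qed
        have "degree r \<noteq> 1"
        proof
          assume "degree r = 1"
          then obtain c d where cd: "r = [:c, d:]" "d \<noteq> 0" by (metis degree1_coeffs One_nat_def degree_pCons_0 zero_neq_one pCons_0_0)
          then have "poly p (- c / d) = 0" by (simp add: rs)
          then show False using noroot by blast
        qed
        then show "r dvd 1 \<or> s dvd 1" using deg is_unit_iff_degree[OF nz(1)] is_unit_iff_degree[OF nz(2)] by linarith
      qed
      moreover have "coprime p (pderiv p)"
      proof (rule coprimeI)
        fix d assume "d dvd p" "d dvd pderiv p"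
        \<comment> \<open>This combination of \<open>p\<close> and its derivative is minus the discriminant of \<open>p\<close>.\<close>
        then have "d dvd [:4:] * p - [:- (2 * a), 2:] * pderiv p" by (intro dvd_diff dvd_mult)
        also have "[:4:] * p - [:- (2 * a), 2:] * pderiv p = [:4 * (b * b):]"
          by (simp add: p_def pderiv_pCons algebra_simps)
        finally have "d dvd [:4 * (b * b):]" .
        moreover have "(4::'c) \<noteq> 0" using h_inj[of 4 0] by (simp add: hom_numeral)
        then have "[:4 * (b * b):] dvd 1" using b by (simp add: is_unit_const_poly_iff dvd_field_iff)
        ultimately show "d dvd 1" by (rule dvd_trans)
      qed
      ultimately show ?thesis by (intro reduce)
    qed
  qed
  then show ?thesis
    unfolding finite_separable_extension_def
    using E.algebra field_alg_iso[OF complex_algebra_field[OF F] iso C E] fin by blast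
qed

end

section \<open>Function algebras and their automorphisms\<close>

context real_or_complex_field
begin

definition component_field :: "'i set \<Rightarrow> 'i \<Rightarrow> complex set" where
  "component_field J j = (if j \<in> J then range h else UNIV)"

text \<open>
  Complex functions on \<open>I\<close> that take values in the base field on \<open>J\<close>: the product of \<open>card J\<close> copies of
  the base field and \<open>card (I - J)\<close> copies of the complex numbers.
\<close>

definition model :: "'i set \<Rightarrow> 'i set \<Rightarrow> ('c, 'i \<Rightarrow> complex) module" where
  "model I J = prod_algebra I (\<lambda>j. complex_algebra h (component_field J j))"

lemma component_field_cases: "component_field J j \<in> {range h, UNIV}"
  by (simp add: component_field_def)

lemma model_algebra: "class_algebra (model I J)"
  unfolding model_def by (intro prod_algebra_algebra complex_algebra_algebra component_field_cases)

lemma model_sel: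
  "carrier (model I J) = (\<Pi>\<^sub>E j\<in>I. component_field J j)"
  "x \<otimes>\<^bsub>model I J\<^esub> y = (\<lambda>j\<in>I. x j * y j)"
  "\<one>\<^bsub>model I J\<^esub> = (\<lambda>j\<in>I. 1)"
  "x \<oplus>\<^bsub>model I J\<^esub> y = (\<lambda>j\<in>I. x j + y j)"
  "a \<odot>\<^bsub>model I J\<^esub> x = (\<lambda>j\<in>I. h a * x j)"
  by (simp_all add: model_def)

text \<open>
  Over the complex numbers every factor is a copy of the base field. Requiring \<open>J = I\<close> in this case
  makes \<open>J\<close> determine the number of proper extensions.
\<close>

definition admissible :: "'i set \<Rightarrow> 'i set \<Rightarrow> bool" where
  "admissible I J \<longleftrightarrow> finite I \<and> J \<subseteq> I \<and> (range h = \<real> \<or> J = I)"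

lemma etale_iso_model:
  assumes L: "etale_algebra (L :: ('c, 'l) module)"
  obtains m and J :: "nat set" where "admissible {..<m} J" "alg_iso L (model {..<m} J) \<noteq> {}"
proof -
  obtain m :: nat and E :: "nat \<Rightarrow> ('c, 'l) module"
    where E: "\<And>j. j < m \<Longrightarrow> finite_separable_extension (E j)" "alg_iso L (prod_algebra {..<m} E) \<noteq> {}"
    using L by (auto simp: etale_algebra_def)
  define J where "J = {j. j < m \<and> alg_iso (E j) (complex_algebra h (range h)) \<noteq> {}}"
  have notJ: "range h = \<real> \<and> alg_iso (E j) (complex_algebra h UNIV) \<noteq> {}" if "j < m" "j \<notin> J" for j
    using E(1)[OF that(1)] that by (cases rule: finite_separable_extension_cases) (auto simp: J_def)
  have "\<forall>j\<in>{..<m}. \<exists>\<phi>. \<phi> \<in> alg_iso (E j) (complex_algebra h (component_field J j))"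
  proof
    fix j assume "j \<in> {..<m}"
    then show "\<exists>\<phi>. \<phi> \<in> alg_iso (E j) (complex_algebra h (component_field J j))"
      using notJ[of j] by (cases "j \<in> J") (auto simp: J_def component_field_def)
  qed
  from bchoice[OF this]
  obtain \<phi> where \<phi>: "\<forall>j\<in>{..<m}. \<phi> j \<in> alg_iso (E j) (complex_algebra h (component_field J j))" ..
  obtain \<psi> where \<psi>: "\<psi> \<in> alg_iso L (prod_algebra {..<m} E)" using E(2) by blast
  have "(\<lambda>x. \<lambda>j\<in>{..<m}. \<phi> j (x j)) \<in> alg_iso (prod_algebra {..<m} E) (model {..<m} J)"
    unfolding model_def using \<phi> by (intro prod_algebra_iso) simp
  from alg_iso_trans[OF \<psi> this] have "alg_iso L (model {..<m} J) \<noteq> {}" by blast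
  moreover have "admissible {..<m} J"
    unfolding admissible_def using notJ by (auto simp: J_def)
  ultimately show ?thesis using that by blast
qed

text \<open>
  Permuting the factors and applying an automorphism to each of them; \<open>model_iso_bij\<close> shows that
  every isomorphism arises in this way.
\<close>

lemma model_reindex:
  assumes \<sigma>: "bij_betw \<sigma> I' I" and J: "\<And>j. j \<in> I' \<Longrightarrow> \<sigma> j \<in> J \<longleftrightarrow> j \<in> J'"
    and \<phi>: "\<And>j. j \<in> I' \<Longrightarrow> \<phi> j \<in> alg_iso (complex_algebra h (component_field J' j)) (complex_algebra h (component_field J' j))"
  shows "(\<lambda>x. \<lambda>j\<in>I'. \<phi> j (x (\<sigma> j))) \<in> alg_iso (model I J) (model I' J')"
proof -
  let ?E = "\<lambda>j. complex_algebra h (component_field J j)"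
  have 1: "(\<lambda>x. \<lambda>j\<in>I'. x (\<sigma> j)) \<in> alg_iso (model I J) (prod_algebra I' (\<lambda>j. ?E (\<sigma> j)))"
    unfolding model_def by (rule prod_algebra_reindex[OF \<sigma>])
  have 2: "(\<lambda>x. \<lambda>j\<in>I'. \<phi> j (x j)) \<in> alg_iso (prod_algebra I' (\<lambda>j. ?E (\<sigma> j))) (model I' J')"
    unfolding model_def
  proof (rule prod_algebra_iso)
    fix j assume j: "j \<in> I'"
    have "component_field J (\<sigma> j) = component_field J' j" using J[OF j] by (simp add: component_field_def)
    then show "\<phi> j \<in> alg_iso (?E (\<sigma> j)) (complex_algebra h (component_field J' j))" using \<phi>[OF j] by simp
  qed
  show ?thesis
    by (rule alg_iso_cong[OF alg_iso_trans[OF 1 2] model_algebra]) auto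
qed

lemma models_isomorphic:
  assumes "finite I" "finite I'" "J \<subseteq> I" "J' \<subseteq> I'" "card I = card I'" "card J = card J'"
  shows "alg_iso (model I J) (model I' J') \<noteq> {}"
proof -
  have fin: "finite J" "finite J'" "finite (I - J)" "finite (I' - J')"
    using assms finite_subset by blast+
  obtain \<sigma>1 where 1: "bij_betw \<sigma>1 J' J" using finite_same_card_bij[OF fin(2,1)] assms by auto
  have "card (I' - J') = card (I - J)" using assms fin by (simp add: card_Diff_subset)
  then obtain \<sigma>2 where 2: "bij_betw \<sigma>2 (I' - J') (I - J)"
    using finite_same_card_bij[OF fin(4,3)] by auto
  let ?\<sigma> = "\<lambda>j. if j \<in> J' then \<sigma>1 j else \<sigma>2 j"
  have "bij_betw ?\<sigma> (J' \<union> (I' - J')) (J \<union> (I - J))"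
  proof (rule bij_betw_combine)
    show "bij_betw ?\<sigma> J' J" by (rule bij_betw_cong[THEN iffD1, OF _ 1]) simp
    show "bij_betw ?\<sigma> (I' - J') (I - J)" by (rule bij_betw_cong[THEN iffD1, OF _ 2]) simp
  qed auto
  moreover have "J' \<union> (I' - J') = I'" "J \<union> (I - J) = I" using assms by auto
  ultimately have "bij_betw ?\<sigma> I' I" by simp
  moreover have "?\<sigma> j \<in> J \<longleftrightarrow> j \<in> J'" if "j \<in> I'" for j
    using that 1 2 by (auto simp: bij_betw_def)
  ultimately have "(\<lambda>x. \<lambda>j\<in>I'. id (x (?\<sigma> j))) \<in> alg_iso (model I J) (model I' J')"
    by (rule model_reindex[where \<phi> = "\<lambda>_. id"]) (simp_all add: alg_iso_id)
  then show ?thesis by blast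
qed

lemma model_coordinates:
  assumes "admissible I J"
  obtains T :: "'i \<Rightarrow> nat set" and b where
    "\<And>j. j \<in> I \<Longrightarrow> coordinates (complex_algebra h (component_field J j)) (T j) (b j)"
    "\<And>j. j \<in> J \<Longrightarrow> T j = {0}" "\<And>j. j \<in> I - J \<Longrightarrow> T j = {0, 1}"
proof
  define T where "T j = (if j \<in> J then {0::nat} else {0, 1})" for j
  define b where "b j = (if j \<in> J then (\<lambda>_. 1) else (\<lambda>i::nat. if i = 0 then 1 else \<i>))" for j
  show "coordinates (complex_algebra h (component_field J j)) (T j) (b j)" if "j \<in> I" for j
    using that assms coordinates_range_h coordinates_complex
    by (auto simp: T_def b_def component_field_def admissible_def)
  show "T j = {0}" if "j \<in> J" for j using that by (simp add: T_def)
  show "T j = {0, 1}" if "j \<in> I - J" for j using that by (simp add: T_def)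
qed

lemma model_dim:
  assumes "admissible I J"
  shows "vectorspace.dim class_ring (model I J) = card I + card (I - J)"
    and "vectorspace.fin_dim class_ring (model I J)"
proof -
  obtain T :: "'a \<Rightarrow> nat set" and b where Tb:
    "\<And>j. j \<in> I \<Longrightarrow> coordinates (complex_algebra h (component_field J j)) (T j) (b j)"
    "\<And>j. j \<in> J \<Longrightarrow> T j = {0}" "\<And>j. j \<in> I - J \<Longrightarrow> T j = {0, 1}"
    using model_coordinates[OF assms] by blast
  have I: "finite I" "J \<subseteq> I" using assms by (auto simp: admissible_def)
  interpret class_algebra "model I J" by (rule model_algebra)
  have co: "coordinates (model I J) (Sigma I T)
      (\<lambda>(j, t). component I (\<lambda>j. complex_algebra h (component_field J j)) j (b j t))"
    unfolding model_def
    by (intro prod_algebra_coordinates complex_algebra_algebra component_field_cases I(1) Tb(1))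
  have "card (Sigma I T) = (\<Sum>j\<in>I. card (T j))" using I(1) coordinates_finite[OF Tb(1)] by simp
  also have "\<dots> = (\<Sum>j\<in>I. 1 + (if j \<in> I - J then 1 else 0))"
    by (intro sum.cong) (use Tb(2,3) in auto)
  also have "\<dots> = card I + (\<Sum>j\<in>I. if j \<in> I - J then 1 else 0)"
    by (simp only: sum.distrib card_eq_sum)
  also have "(\<Sum>j\<in>I. if j \<in> I - J then 1 else 0) = (\<Sum>j\<in>I - J. 1::nat)"
    using I by (intro sum.mono_neutral_cong_right) auto
  also have "\<dots> = card (I - J)" by simp
  finally show "vectorspace.dim class_ring (model I J) = card I + card (I - J)"
    using coordinates_basis(2)[OF co] by simp
  show "vectorspace.fin_dim class_ring (model I J)" by (rule coordinates_basis(3)[OF co])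
qed

text \<open>
  The element \<open>point_mass I i 1\<close> is the idempotent of the factor \<open>i\<close>. The values \<open>1\<close> and \<open>\<i>\<close> are used to
  read off the effect of a homomorphism on indices and on conjugation.
\<close>

definition point_mass :: "'i set \<Rightarrow> 'i \<Rightarrow> complex \<Rightarrow> 'i \<Rightarrow> complex" where
  "point_mass I i z = (\<lambda>j\<in>I. if j = i then z else 0)"

lemma point_mass_carrier:
  assumes "z \<in> component_field J i"
  shows "point_mass I i z \<in> carrier (model I J)"
  using assms range_h_subfield(2)[OF component_field_cases] by (auto simp: model_sel point_mass_def)

text \<open>
  The idempotents of the factors sum to one, so \<open>ch\<close> cannot vanish on all of them. It takes the value
  one on some idempotent \<open>i\<close>, and then \<open>ch x\<close> depends on \<open>x i\<close> only. On a copy of the base field,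
  linearity leaves no choice; on the complex numbers over \<open>\<real>\<close>, the image of \<open>\<i>\<close> is a square root of
  \<open>-1\<close> and decides between the identity and conjugation.
\<close>

lemma model_character:
  assumes IJ: "admissible I J"
    and add: "\<And>x y. x \<in> carrier (model I J) \<Longrightarrow> y \<in> carrier (model I J) \<Longrightarrow>
      ch (x \<oplus>\<^bsub>model I J\<^esub> y) = ch x + ch y"
    and mult: "\<And>x y. x \<in> carrier (model I J) \<Longrightarrow> y \<in> carrier (model I J) \<Longrightarrow>
      ch (x \<otimes>\<^bsub>model I J\<^esub> y) = ch x * ch y"
    and one: "ch \<one>\<^bsub>model I J\<^esub> = 1"
    and smult: "\<And>a x. x \<in> carrier (model I J) \<Longrightarrow> ch (a \<odot>\<^bsub>model I J\<^esub> x) = h a * ch x"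
  shows "\<exists>i \<epsilon>. i \<in> I \<and> (i \<in> J \<longrightarrow> \<not> \<epsilon>) \<and>
    (\<forall>x\<in>carrier (model I J). ch x = (if \<epsilon> then cnj (x i) else x i))"
proof -
  let ?M = "model I J"
  have I: "finite I" "J \<subseteq> I" using IJ by (auto simp: admissible_def)
  interpret M: class_algebra ?M by (rule model_algebra)
  have one_mem: "1 \<in> component_field J j" for j
    using range_h_subfield(3)[OF component_field_cases] .
  have e: "point_mass I i 1 \<in> carrier ?M" for i by (rule point_mass_carrier[OF one_mem])
  \<comment> \<open>If all idempotents were killed, so would be every partial sum \<open>ind S\<close>, and finally one.\<close>
  define ind where "ind S = (\<lambda>j\<in>I. if j \<in> S then 1 else 0 :: complex)" for S
  have ind_mem: "ind S \<in> carrier ?M" for S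
    using one_mem range_h_subfield(2)[OF component_field_cases] by (auto simp: model_sel ind_def)
  have "\<exists>i\<in>I. ch (point_mass I i 1) \<noteq> 0"
  proof (rule ccontr)
    assume "\<not> (\<exists>i\<in>I. ch (point_mass I i 1) \<noteq> 0)"
    then have 0: "ch (point_mass I i 1) = 0" if "i \<in> I" for i using that by blast
    have "ch (ind S) = 0" if "S \<subseteq> I" for S
      using finite_subset[OF that I(1)] that
    proof (induction S rule: finite_induct)
      case empty
      have "ind {} = 0 \<odot>\<^bsub>?M\<^esub> \<one>\<^bsub>?M\<^esub>" by (simp add: ind_def model_sel)
      then show ?case using smult[OF M.one_closed, of 0] by simp
    next
      case (insert s S)
      have "ind (insert s S) = point_mass I s 1 \<oplus>\<^bsub>?M\<^esub> ind S"
        using insert by (auto simp: ind_def point_mass_def model_sel intro!: restrict_ext)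
      then show ?case using add[OF e ind_mem] 0 insert by simp
    qed
    moreover have "ind I = \<one>\<^bsub>?M\<^esub>" by (auto simp: ind_def model_sel intro!: restrict_ext)
    ultimately show False using one by (metis order_refl zero_neq_one)
  qed
  then obtain i where i: "i \<in> I" "ch (point_mass I i 1) \<noteq> 0" by blast
  have "point_mass I i 1 \<otimes>\<^bsub>?M\<^esub> point_mass I i 1 = point_mass I i 1"
    by (auto simp: point_mass_def model_sel intro!: restrict_ext)
  then have ch_e: "ch (point_mass I i 1) = 1" using mult[OF e[of i] e[of i]] i(2) by simp
  define g where "g z = ch (point_mass I i z)" for z
  have ch_g: "ch x = g (x i)" if x: "x \<in> carrier ?M" for x
  proof -
    have "x \<otimes>\<^bsub>?M\<^esub> point_mass I i 1 = point_mass I i (x i)"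
      by (auto simp: point_mass_def model_sel intro!: restrict_ext)
    then show ?thesis using mult[OF x e[of i]] ch_e by (simp add: g_def)
  qed
  have g_h: "g (h a * z) = h a * g z" if "z \<in> component_field J i" for a z
  proof -
    have "a \<odot>\<^bsub>?M\<^esub> point_mass I i z = point_mass I i (h a * z)"
      by (auto simp: point_mass_def model_sel intro!: restrict_ext)
    then show ?thesis using smult[OF point_mass_carrier[OF that], of a] by (simp add: g_def)
  qed
  have g1: "g 1 = 1" using ch_e by (simp add: g_def)
  show ?thesis
  proof (cases "i \<in> J")
    case True
    have "ch x = x i" if x: "x \<in> carrier ?M" for x
    proof -
      have "x i \<in> component_field J i" using x i(1) by (auto simp: model_sel)
      then have "x i \<in> range h" using True by (simp add: component_field_def)
      then obtain a where "x i = h a" by (rule rangeE)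
      then show ?thesis using ch_g[OF x] g_h[OF one_mem, of a] g1 by simp
    qed
    then show ?thesis using i(1) by (intro exI[of _ i] exI[of _ False]) simp
  next
    case False
    then have full: "component_field J i = UNIV" by (simp add: component_field_def)
    have g_add: "g (y + z) = g y + g z" for y z
    proof -
      have "point_mass I i y \<oplus>\<^bsub>?M\<^esub> point_mass I i z = point_mass I i (y + z)"
        by (auto simp: point_mass_def model_sel intro!: restrict_ext)
      then show ?thesis
        using add[OF point_mass_carrier[of y J i I] point_mass_carrier[of z J i I]] by (simp add: g_def full)
    qed
    have g_mult: "g (y * z) = g y * g z" for y z
    proof -
      have "point_mass I i y \<otimes>\<^bsub>?M\<^esub> point_mass I i z = point_mass I i (y * z)"
        by (auto simp: point_mass_def model_sel intro!: restrict_ext)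
      then show ?thesis
        using mult[OF point_mass_carrier[of y J i I] point_mass_carrier[of z J i I]] by (simp add: g_def full)
    qed
    have g_real: "g (of_real r) = of_real r" for r
      using g_h[of 1 "real_elem r"] g1 by (simp add: full)
    have "g \<i> * g \<i> = - 1" using g_mult[of \<i> \<i>] g_real[of "- 1"] by simp
    then have "(g \<i> - \<i>) * (g \<i> + \<i>) = 0" by (simp add: algebra_simps)
    then have gi: "g \<i> = \<i> \<or> g \<i> = - \<i>" by (auto simp: eq_neg_iff_add_eq_0)
    have g: "g z = of_real (Re z) + of_real (Im z) * g \<i>" for z
    proof -
      have "z = of_real (Re z) + of_real (Im z) * \<i>" by (simp add: complex_eq_iff)
      then have "g z = g (of_real (Re z) + of_real (Im z) * \<i>)" by simp
      then show ?thesis by (simp only: g_add g_mult g_real)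
    qed
    from gi show ?thesis
    proof
      assume "g \<i> = \<i>"
      then have "g z = z" for z using g[of z] by (simp add: complex_eq_iff)
      then show ?thesis using i(1) ch_g by (intro exI[of _ i] exI[of _ False]) simp
    next
      assume "g \<i> = - \<i>"
      then have "g z = cnj z" for z using g[of z] by (simp add: complex_eq_iff)
      then show ?thesis using i(1) ch_g False by (intro exI[of _ i] exI[of _ True]) simp
    qed
  qed
qed

text \<open>
  Each coordinate of an isomorphism is a character. At an index in \<open>J'\<close> it takes values in the base
  field, which is impossible if it reads a full complex coordinate.
\<close>

lemma model_iso_form:
  assumes IJ: "admissible I J" and \<phi>: "\<phi> \<in> alg_iso (model I J) (model I' J')"
  obtains \<sigma> \<epsilon> where "\<And>i. i \<in> I' \<Longrightarrow> \<sigma> i \<in> I" "\<And>i. i \<in> I' \<Longrightarrow> \<sigma> i \<in> J \<Longrightarrow> \<not> \<epsilon> i"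
    "\<And>i. i \<in> I' \<Longrightarrow> i \<in> J' \<Longrightarrow> \<sigma> i \<in> J"
    "\<And>x i. x \<in> carrier (model I J) \<Longrightarrow> i \<in> I' \<Longrightarrow> \<phi> x i = (if \<epsilon> i then cnj (x (\<sigma> i)) else x (\<sigma> i))"
proof -
  interpret M: class_algebra "model I J" by (rule model_algebra)
  have "\<forall>i\<in>I'. \<exists>p. fst p \<in> I \<and> (fst p \<in> J \<longrightarrow> \<not> snd p) \<and>
      (\<forall>x\<in>carrier (model I J). \<phi> x i = (if snd p then cnj (x (fst p)) else x (fst p)))"
  proof
    fix i assume i: "i \<in> I'"
    have "\<exists>k \<epsilon>. k \<in> I \<and> (k \<in> J \<longrightarrow> \<not> \<epsilon>) \<and>
        (\<forall>x\<in>carrier (model I J). \<phi> x i = (if \<epsilon> then cnj (x k) else x k))"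
      by (rule model_character[OF IJ])
        (use i in \<open>simp_all add: alg_iso_add[OF \<phi>] alg_iso_mult[OF \<phi>] alg_iso_one[OF \<phi>] alg_iso_smult[OF \<phi>]
          model_sel(2-)[of I' J']\<close>)
    then obtain k \<epsilon> where "k \<in> I \<and> (k \<in> J \<longrightarrow> \<not> \<epsilon>) \<and>
        (\<forall>x\<in>carrier (model I J). \<phi> x i = (if \<epsilon> then cnj (x k) else x k))" by (elim exE)
    then show "\<exists>p. fst p \<in> I \<and> (fst p \<in> J \<longrightarrow> \<not> snd p) \<and>
      (\<forall>x\<in>carrier (model I J). \<phi> x i = (if snd p then cnj (x (fst p)) else x (fst p)))"
      by (intro exI[of _ "(k, \<epsilon>)"]) simp
  qed
  from bchoice[OF this] obtain p where p: "\<forall>i\<in>I'. fst (p i) \<in> I \<and> (fst (p i) \<in> J \<longrightarrow> \<not> snd (p i)) \<and>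
      (\<forall>x\<in>carrier (model I J). \<phi> x i = (if snd (p i) then cnj (x (fst (p i))) else x (fst (p i))))" ..
  have J: "fst (p i) \<in> J" if i: "i \<in> I'" "i \<in> J'" for i
  proof (rule ccontr)
    assume nJ: "fst (p i) \<notin> J"
    then have R: "range h = \<real>" using IJ p i by (auto simp: admissible_def)
    have x: "point_mass I (fst (p i)) \<i> \<in> carrier (model I J)"
      using nJ by (intro point_mass_carrier) (simp add: component_field_def)
    have "\<phi> (point_mass I (fst (p i)) \<i>) i \<in> range h"
      using alg_iso_closed[OF \<phi> x] i by (auto simp: model_sel component_field_def PiE_iff)
    moreover have "\<phi> (point_mass I (fst (p i)) \<i>) i \<in> {\<i>, - \<i>}"
      using p i x by (auto simp: point_mass_def)
    ultimately show False using R by (auto simp: complex_is_Real_iff)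
  qed
  show ?thesis
    by (rule that[of "\<lambda>i. fst (p i)" "\<lambda>i. snd (p i)"]) (use p J in auto)
qed

text \<open>
  The index maps of \<open>\<phi>\<close> and of its inverse are inverse to each other, as one sees on idempotents.
\<close>

lemma model_iso_bij:
  assumes IJ: "admissible I J" and IJ': "admissible I' J'" and \<phi>: "\<phi> \<in> alg_iso (model I J) (model I' J')"
  obtains \<sigma> \<epsilon> where "bij_betw \<sigma> I' I" "\<And>i. i \<in> I' \<Longrightarrow> \<sigma> i \<in> J \<longleftrightarrow> i \<in> J'"
    "\<And>i. i \<in> J' \<Longrightarrow> \<not> \<epsilon> i"
    "\<And>x i. x \<in> carrier (model I J) \<Longrightarrow> i \<in> I' \<Longrightarrow> \<phi> x i = (if \<epsilon> i then cnj (x (\<sigma> i)) else x (\<sigma> i))"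
proof -
  define \<psi> where "\<psi> = inv_into (carrier (model I J)) \<phi>"
  have \<psi>: "\<psi> \<in> alg_iso (model I' J') (model I J)" unfolding \<psi>_def by (rule alg_iso_sym[OF \<phi> model_algebra])
  have \<psi>\<phi>: "\<psi> (\<phi> x) = x" if "x \<in> carrier (model I J)" for x
    using alg_iso_bij[OF \<phi>] that by (auto simp: \<psi>_def bij_betw_def)
  have \<phi>\<psi>: "\<phi> (\<psi> x) = x" if "x \<in> carrier (model I' J')" for x
    using alg_iso_bij[OF \<phi>] that by (auto simp: \<psi>_def bij_betw_def f_inv_into_f)
  obtain \<sigma> \<epsilon> where s: "\<And>i. i \<in> I' \<Longrightarrow> \<sigma> i \<in> I" "\<And>i. i \<in> I' \<Longrightarrow> \<sigma> i \<in> J \<Longrightarrow> \<not> \<epsilon> i"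
    "\<And>i. i \<in> I' \<Longrightarrow> i \<in> J' \<Longrightarrow> \<sigma> i \<in> J"
    "\<And>x i. x \<in> carrier (model I J) \<Longrightarrow> i \<in> I' \<Longrightarrow> \<phi> x i = (if \<epsilon> i then cnj (x (\<sigma> i)) else x (\<sigma> i))"
    using model_iso_form[OF IJ \<phi>] by blast
  obtain \<tau> \<delta> where t: "\<And>i. i \<in> I \<Longrightarrow> \<tau> i \<in> I'" "\<And>i. i \<in> I \<Longrightarrow> \<tau> i \<in> J' \<Longrightarrow> \<not> \<delta> i"
    "\<And>i. i \<in> I \<Longrightarrow> i \<in> J \<Longrightarrow> \<tau> i \<in> J'"
    "\<And>x i. x \<in> carrier (model I' J') \<Longrightarrow> i \<in> I \<Longrightarrow> \<psi> x i = (if \<delta> i then cnj (x (\<tau> i)) else x (\<tau> i))"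
    using model_iso_form[OF IJ' \<psi>] by blast
  have one_mem: "1 \<in> component_field J j" for j J
    using range_h_subfield(3)[OF component_field_cases] .
  have st: "\<sigma> (\<tau> i) = i" if i: "i \<in> I" for i
  proof -
    let ?x = "point_mass I i 1"
    have x: "?x \<in> carrier (model I J)" by (rule point_mass_carrier[OF one_mem])
    have "\<psi> (\<phi> ?x) i \<noteq> 0" using \<psi>\<phi>[OF x] i by (simp add: point_mass_def)
    then have "\<phi> ?x (\<tau> i) \<noteq> 0" using t(4)[OF alg_iso_closed[OF \<phi> x] i] by (auto split: if_splits)
    then have "?x (\<sigma> (\<tau> i)) \<noteq> 0" using s(4)[OF x t(1)[OF i]] by (auto split: if_splits)
    then show ?thesis using s(1)[OF t(1)[OF i]] by (auto simp: point_mass_def split: if_splits)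
  qed
  have ts: "\<tau> (\<sigma> i) = i" if i: "i \<in> I'" for i
  proof -
    let ?x = "point_mass I' i 1"
    have x: "?x \<in> carrier (model I' J')" by (rule point_mass_carrier[OF one_mem])
    have "\<phi> (\<psi> ?x) i \<noteq> 0" using \<phi>\<psi>[OF x] i by (simp add: point_mass_def)
    then have "\<psi> ?x (\<sigma> i) \<noteq> 0" using s(4)[OF alg_iso_closed[OF \<psi> x] i] by (auto split: if_splits)
    then have "?x (\<tau> (\<sigma> i)) \<noteq> 0" using t(4)[OF x s(1)[OF i]] by (auto split: if_splits)
    then show ?thesis using t(1)[OF s(1)[OF i]] by (auto simp: point_mass_def split: if_splits)
  qed
  have "bij_betw \<sigma> I' I"
    by (rule bij_betwI[where g = \<tau>]) (use s(1) t(1) st ts in auto)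
  moreover have J: "\<sigma> i \<in> J \<longleftrightarrow> i \<in> J'" if "i \<in> I'" for i
    using s(3)[OF that] t(3)[OF s(1)[OF that]] ts[OF that] by auto
  moreover have "\<not> \<epsilon> i" if "i \<in> J'" for i
    using that J s(2) IJ' by (auto simp: admissible_def)
  ultimately show ?thesis using s(4) that[of \<sigma> \<epsilon>] by blast
qed

text \<open>
  Together with the dimension \<open>card I + card (I - J)\<close>, this makes \<open>card (I - J)\<close> an isomorphism invariant.
\<close>

lemma isomorphic_models_card:
  assumes "admissible I J" "admissible I' J'" "alg_iso (model I J) (model I' J') \<noteq> {}"
  shows "card I = card I'"
proof -
  obtain \<phi> where "\<phi> \<in> alg_iso (model I J) (model I' J')" using assms(3) by blast
  from model_iso_bij[OF assms(1,2) this] obtain \<sigma> where "bij_betw \<sigma> I' I" by metis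
  then show ?thesis using bij_betw_same_card by metis
qed

lemma cnj_alg_iso:
  assumes "range h = \<real>"
  shows "cnj \<in> alg_iso (complex_algebra h UNIV) (complex_algebra h UNIV)"
proof (rule alg_isoI)
  show "cnj (a \<odot>\<^bsub>complex_algebra h UNIV\<^esub> x) = a \<odot>\<^bsub>complex_algebra h UNIV\<^esub> cnj x" for a x
  proof -
    have "h a \<in> \<real>" using assms by auto
    then have "cnj (h a) = h a" by (simp add: Reals_cnj_iff)
    then show ?thesis by simp
  qed
  show "bij_betw cnj (carrier (complex_algebra h UNIV)) (carrier (complex_algebra h UNIV))"
    by (rule bij_betwI[where g = cnj]) auto
qed auto

text \<open>
  An automorphism is given by a permutation of \<open>J\<close>, a permutation of \<open>I - J\<close>, and the set of indices
  in \<open>I - J\<close> at which it conjugates. Evaluation on idempotents recovers the permutations, evaluation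
  on \<open>\<i>\<close> times an idempotent recovers the set.
\<close>

lemma card_aut_model:
  assumes IJ: "admissible I J"
  shows "card (alg_aut (model I J)) = fact (card J) * fact (card (I - J)) * 2 ^ card (I - J)"
proof -
  have I: "finite I" "J \<subseteq> I" using IJ by (auto simp: admissible_def)
  then have fin: "finite J" "finite (I - J)" using finite_subset by auto
  let ?P = "{\<sigma>. \<sigma> permutes J} \<times> {\<sigma>. \<sigma> permutes (I - J)} \<times> Pow (I - J)"
  define perm where "perm \<sigma>1 \<sigma>2 i = (if i \<in> J then \<sigma>1 i else \<sigma>2 i)" for \<sigma>1 \<sigma>2 :: "'a \<Rightarrow> 'a" and i
  \<comment> \<open>Where the index lies in \<open>S\<close> the coordinate is conjugated; the second permutation acts off \<open>J\<close>.\<close>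
  define act where "act = (\<lambda>(\<sigma>1, \<sigma>2, S). restrict (\<lambda>x. \<lambda>i\<in>I. (if i \<in> S then cnj else id) (x (perm \<sigma>1 \<sigma>2 i)))
    (carrier (model I J)))"
  have perm_J: "perm \<sigma>1 \<sigma>2 i \<in> J \<longleftrightarrow> i \<in> J"
    if \<sigma>: "\<sigma>1 permutes J" "\<sigma>2 permutes (I - J)" and i: "i \<in> I" for \<sigma>1 \<sigma>2 i
    using permutes_in_image[OF \<sigma>(1), of i] permutes_in_image[OF \<sigma>(2), of i] i by (auto simp: perm_def)
  have perm_bij: "bij_betw (perm \<sigma>1 \<sigma>2) I I"
    if \<sigma>: "\<sigma>1 permutes J" "\<sigma>2 permutes (I - J)" for \<sigma>1 \<sigma>2
  proof -
    have "bij_betw (perm \<sigma>1 \<sigma>2) (J \<union> (I - J)) (J \<union> (I - J))"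
    proof (rule bij_betw_combine)
      show "bij_betw (perm \<sigma>1 \<sigma>2) J J"
        by (rule bij_betw_cong[THEN iffD1, OF _ permutes_imp_bij[OF \<sigma>(1)]]) (simp add: perm_def)
      show "bij_betw (perm \<sigma>1 \<sigma>2) (I - J) (I - J)"
        by (rule bij_betw_cong[THEN iffD1, OF _ permutes_imp_bij[OF \<sigma>(2)]]) (simp add: perm_def)
    qed auto
    moreover have "J \<union> (I - J) = I" using I by auto
    ultimately show "bij_betw (perm \<sigma>1 \<sigma>2) I I" by simp
  qed
  have "bij_betw act ?P (alg_aut (model I J))"
    unfolding bij_betw_def
  proof
    show "act ` ?P = alg_aut (model I J)"
    proof
      show "act ` ?P \<subseteq> alg_aut (model I J)"
      proof clarify
        fix \<sigma>1 \<sigma>2 S assume \<sigma>: "\<sigma>1 permutes J" "\<sigma>2 permutes (I - J)" and S: "S \<subseteq> I - J"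
        have "(\<lambda>x. \<lambda>i\<in>I. (if i \<in> S then cnj else id) (x (perm \<sigma>1 \<sigma>2 i))) \<in> alg_iso (model I J) (model I J)"
          using perm_bij[OF \<sigma>]
          proof (rule model_reindex)
            show "perm \<sigma>1 \<sigma>2 j \<in> J \<longleftrightarrow> j \<in> J" if "j \<in> I" for j by (rule perm_J[OF \<sigma> that])
            fix j assume j: "j \<in> I"
            show "(if j \<in> S then cnj else id)
              \<in> alg_iso (complex_algebra h (component_field J j)) (complex_algebra h (component_field J j))"
            proof (cases "j \<in> S")
              case True
              then have "component_field J j = UNIV" "range h = \<real>"
                using S IJ by (auto simp: component_field_def admissible_def)
              then show ?thesis using True cnj_alg_iso by simp
            qed (simp add: alg_iso_id)
          qed
        then show "act (\<sigma>1, \<sigma>2, S) \<in> alg_aut (model I J)"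
          unfolding alg_aut_def act_def by (auto elim: alg_iso_cong[OF _ model_algebra])
      qed
      show "alg_aut (model I J) \<subseteq> act ` ?P"
      proof
        fix \<phi> assume "\<phi> \<in> alg_aut (model I J)"
        then have \<phi>: "\<phi> \<in> alg_iso (model I J) (model I J)" "\<phi> \<in> extensional (carrier (model I J))"
          by (auto simp: alg_aut_def)
        obtain \<sigma> \<epsilon> where s: "bij_betw \<sigma> I I" "\<And>i. i \<in> I \<Longrightarrow> \<sigma> i \<in> J \<longleftrightarrow> i \<in> J"
          "\<And>i. i \<in> J \<Longrightarrow> \<not> \<epsilon> i"
          "\<And>x i. x \<in> carrier (model I J) \<Longrightarrow> i \<in> I \<Longrightarrow> \<phi> x i = (if \<epsilon> i then cnj (x (\<sigma> i)) else x (\<sigma> i))"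
          using model_iso_bij[OF IJ IJ \<phi>(1)] by blast
        have inj: "inj_on \<sigma> I" and im: "\<sigma> ` I = I" using s(1) by (auto simp: bij_betw_def)
        have "\<sigma> ` J = J"
        proof
          show "\<sigma> ` J \<subseteq> J" using s(2) I(2) by auto
          show "J \<subseteq> \<sigma> ` J"
          proof
            fix k assume "k \<in> J"
            moreover from this obtain i where "i \<in> I" "k = \<sigma> i" using im I(2) by (metis imageE subsetD)
            ultimately show "k \<in> \<sigma> ` J" using s(2)[of i] by simp
          qed
        qed
        then have 1: "bij_betw \<sigma> J J" using inj_on_subset[OF inj I(2)] by (simp add: bij_betw_def)
        have "\<sigma> ` (I - J) = \<sigma> ` I - \<sigma> ` J" by (rule inj_on_image_set_diff[OF inj]) (use I(2) in auto)
        then have "\<sigma> ` (I - J) = I - J" by (simp only: \<open>\<sigma> ` J = J\<close> im)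
        then have 2: "bij_betw \<sigma> (I - J) (I - J)"
          using inj_on_subset[OF inj Diff_subset] by (simp add: bij_betw_def)
        let ?\<sigma>1 = "\<lambda>i. if i \<in> J then \<sigma> i else i" and ?\<sigma>2 = "\<lambda>i. if i \<in> I - J then \<sigma> i else i"
        have "?\<sigma>1 permutes J"
          by (intro bij_imp_permutes bij_betw_cong[THEN iffD1, OF _ 1]) auto
        moreover have "?\<sigma>2 permutes (I - J)"
          by (intro bij_imp_permutes bij_betw_cong[THEN iffD1, OF _ 2]) auto
        moreover have "\<phi> = act (?\<sigma>1, ?\<sigma>2, {i\<in>I - J. \<epsilon> i})"
        proof (rule extensionalityI[of _ "carrier (model I J)"])
          fix x assume x: "x \<in> carrier (model I J)"
          show "\<phi> x = act (?\<sigma>1, ?\<sigma>2, {i\<in>I - J. \<epsilon> i}) x"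
          proof (rule extensionalityI[of _ I])
            show "\<phi> x \<in> extensional I" using alg_iso_closed[OF \<phi>(1) x] by (auto simp: model_sel PiE_iff)
            fix i assume i: "i \<in> I"
            show "\<phi> x i = act (?\<sigma>1, ?\<sigma>2, {i\<in>I - J. \<epsilon> i}) x i"
              using x i s(4)[OF x i] s(3)[of i] by (auto simp: act_def perm_def)
          qed (use x in \<open>simp add: act_def\<close>)
        qed (use \<phi>(2) in \<open>auto simp: act_def\<close>)
        ultimately show "\<phi> \<in> act ` ?P" by (intro image_eqI[of _ _ "(?\<sigma>1, ?\<sigma>2, {i\<in>I - J. \<epsilon> i})"]) auto
      qed
    qed
    show "inj_on act ?P"
    proof (rule inj_onI)
      fix p p' assume pp: "p \<in> ?P" "p' \<in> ?P" "act p = act p'"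
      obtain \<sigma>1 \<sigma>2 S where p: "p = (\<sigma>1, \<sigma>2, S)" by (rule prod_cases3)
      obtain \<sigma>1' \<sigma>2' S' where p': "p' = (\<sigma>1', \<sigma>2', S')" by (rule prod_cases3)
      have \<sigma>: "\<sigma>1 permutes J" "\<sigma>2 permutes (I - J)" and S: "S \<subseteq> I - J"
        and \<sigma>': "\<sigma>1' permutes J" "\<sigma>2' permutes (I - J)" and S': "S' \<subseteq> I - J"
        and eq: "act (\<sigma>1, \<sigma>2, S) = act (\<sigma>1', \<sigma>2', S')"
        using pp by (simp_all add: p p')
      have eq_at: "(if i \<in> S then cnj else id) (x (perm \<sigma>1 \<sigma>2 i)) =
          (if i \<in> S' then cnj else id) (x (perm \<sigma>1' \<sigma>2' i))"
        if "x \<in> carrier (model I J)" "i \<in> I" for x i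
        using fun_cong[OF fun_cong[OF eq, of x], of i] that by (simp add: act_def)
      have in_I: "perm \<sigma>1 \<sigma>2 i \<in> I" "perm \<sigma>1' \<sigma>2' i \<in> I" if "i \<in> I" for i
        using perm_bij[OF \<sigma>] perm_bij[OF \<sigma>'] that by (auto simp: bij_betw_def)
      have one_mem: "1 \<in> component_field J j" for j
        using range_h_subfield(3)[OF component_field_cases] .
      have perm_eq: "perm \<sigma>1 \<sigma>2 i = perm \<sigma>1' \<sigma>2' i" if i: "i \<in> I" for i
        using eq_at[OF point_mass_carrier[OF one_mem, of I "perm \<sigma>1 \<sigma>2 i"] i] in_I[OF i]
        by (auto simp: point_mass_def split: if_splits)
      have "\<sigma>1 i = \<sigma>1' i" for i
      proof (cases "i \<in> J")
        case True
        then show ?thesis using perm_eq[of i] I by (auto simp: perm_def)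
      next
        case False
        then show ?thesis using \<sigma>(1) \<sigma>'(1) by (simp add: permutes_not_in)
      qed
      moreover have "\<sigma>2 i = \<sigma>2' i" for i
      proof (cases "i \<in> I - J")
        case True
        then show ?thesis using perm_eq[of i] by (auto simp: perm_def)
      next
        case False
        then show ?thesis using \<sigma>(2) \<sigma>'(2) by (simp add: permutes_not_in)
      qed
      moreover have "i \<in> S \<longleftrightarrow> i \<in> S'" if i: "i \<in> I - J" for i
      proof -
        have "perm \<sigma>1 \<sigma>2 i \<notin> J" using perm_J[OF \<sigma>, of i] i by simp
        then have "point_mass I (perm \<sigma>1 \<sigma>2 i) \<i> \<in> carrier (model I J)"
          by (intro point_mass_carrier) (simp add: component_field_def)
        from eq_at[OF this, of i] show ?thesis
          using i in_I[of i] perm_eq[of i] by (auto simp: point_mass_def complex_eq_iff split: if_splits)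
      qed
      ultimately have "\<sigma>1 = \<sigma>1'" "\<sigma>2 = \<sigma>2'" "S = S'" using S S' by blast+
      then show "p = p'" by (simp add: p p')
    qed
  qed
  then have "card (alg_aut (model I J)) = card ?P" by (rule bij_betw_same_card[symmetric])
  also have "\<dots> = fact (card J) * fact (card (I - J)) * 2 ^ card (I - J)"
    using fin by (simp add: card_cartesian_product card_permutations card_Pow)
  finally show ?thesis .
qed

end

section \<open>Norms of units\<close>

context real_or_complex_field
begin

lemma norm_surjective:
  assumes \<phi>: "\<phi> \<in> alg_iso L (model I J)" and L: "class_algebra L"
    and IJ: "admissible I J" and j: "j \<in> J" and c: "c \<noteq> 0"
  shows "c \<in> alg_norm L ` Units L"
proof -
  let ?M = "model I J"
  let ?E = "\<lambda>i. complex_algebra h (component_field J i)"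
  define x where "x a = (\<lambda>i\<in>I. (if i = j then a else 1) \<odot>\<^bsub>?E i\<^esub> \<one>\<^bsub>?E i\<^esub>)" for a
  interpret M: class_algebra ?M by (rule model_algebra)
  have jI: "j \<in> I" and I: "finite I" using IJ j by (auto simp: admissible_def)
  obtain T :: "_ \<Rightarrow> nat set" and b where Tb:
    "\<And>j. j \<in> I \<Longrightarrow> coordinates (?E j) (T j) (b j)" "\<And>j. j \<in> J \<Longrightarrow> T j = {0}"
    "\<And>j. j \<in> I - J \<Longrightarrow> T j = {0, 1}"
    by (rule model_coordinates[OF IJ]) blast
  note cs = component_scalar_norm[where E = ?E and I = I and T = T and b = b and j = j,
      OF complex_algebra_algebra[OF component_field_cases] I jI Tb(1) Tb(2)[OF j], folded model_def x_def]
  have x: "x a \<in> carrier ?M" for a using cs(1)[of a] .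
  have norm: "alg_norm ?M (x a) = a" for a using cs(2)[of a] .
  define \<psi> where "\<psi> = inv_into (carrier L) \<phi>"
  have \<psi>: "\<psi> \<in> alg_iso ?M L" unfolding \<psi>_def by (rule alg_iso_sym[OF \<phi> L])
  have inv: "x a \<otimes>\<^bsub>?M\<^esub> x b = \<one>\<^bsub>?M\<^esub>" if "a * b = 1" for a b
    using that by (auto simp: x_def model_sel simp flip: hom_mult intro!: restrict_ext)
  have "\<psi> (x a) \<otimes>\<^bsub>L\<^esub> \<psi> (x b) = \<one>\<^bsub>L\<^esub>" if "a * b = 1" for a b
    using inv[OF that] alg_iso_mult[OF \<psi> x x, of a b] alg_iso_one[OF \<psi>] by simp
  then have "\<psi> (x c) \<in> Units L"
    unfolding Units_def using alg_iso_closed[OF \<psi> x] c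
    by (auto intro!: bexI[of _ "\<psi> (x (inverse c))"])
  moreover have "alg_norm L (\<psi> (x c)) = c"
    using alg_norm_iso[OF \<psi> model_algebra L model_dim(2)[OF IJ] x, of c] norm by simp
  ultimately show ?thesis by (metis imageI)
qed

text \<open>
  Complex numbers have square roots, so each element of a product of copies of the complex numbers
  is a square, and the norm is multiplicative.
\<close>

lemma norm_square:
  assumes \<phi>: "\<phi> \<in> alg_iso L (model I {})" and L: "class_algebra L"
    and fin: "vectorspace.fin_dim class_ring L" and x: "x \<in> Units L"
  obtains b where "b \<noteq> 0" "alg_norm L x = b * b"
proof -
  let ?M = "model I {}"
  interpret L: class_algebra L by fact
  define \<psi> where "\<psi> = inv_into (carrier L) \<phi>"
  have \<psi>: "\<psi> \<in> alg_iso ?M L" unfolding \<psi>_def by (rule alg_iso_sym[OF \<phi> L])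
  have xL: "x \<in> carrier L" using x by auto
  let ?w = "\<lambda>i\<in>I. csqrt (\<phi> x i)"
  have w: "?w \<in> carrier ?M" by (auto simp: model_sel component_field_def)
  have "\<phi> x \<in> extensional I" using alg_iso_closed[OF \<phi> xL] by (auto simp: model_sel PiE_iff)
  then have "?w \<otimes>\<^bsub>?M\<^esub> ?w = \<phi> x"
    by (intro extensionalityI[of _ I]) (auto simp: model_sel simp flip: power2_eq_square)
  then have "\<psi> ?w \<otimes>\<^bsub>L\<^esub> \<psi> ?w = x"
    using alg_iso_mult[OF \<psi> w w] alg_iso_bij[OF \<phi>] xL by (simp add: \<psi>_def bij_betw_def)
  then have "alg_norm L x = alg_norm L (\<psi> ?w) * alg_norm L (\<psi> ?w)"
    using L.alg_norm_mult[OF fin alg_iso_closed[OF \<psi> w] alg_iso_closed[OF \<psi> w]] by simp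
  then show ?thesis using that L.alg_norm_unit[OF fin x] by (metis mult_zero_left)
qed

text \<open>
  Only algebras without a factor \<open>'c\<close> impose a condition. For \<open>J = {}\<close> the base field is real, since the
  algebra is nonzero.
\<close>

lemma norm_image_contains_iff:
  assumes \<phi>: "\<phi> \<in> alg_iso L (model I J)" and L: "class_algebra L" and IJ: "admissible I J"
    and fin: "vectorspace.fin_dim class_ring L" and dim: "vectorspace.dim class_ring L > 0"
    and A: "0 \<notin> A"
  shows "A \<subseteq> alg_norm L ` Units L \<longleftrightarrow> (J = {} \<longrightarrow> (\<forall>a\<in>A. Re (h a) > 0))"
proof (cases "J = {}")
  case False
  then obtain j where "j \<in> J" by blast
  have "A \<subseteq> alg_norm L ` Units L"
  proof
    fix a assume "a \<in> A"
    with A have "a \<noteq> 0" by auto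
    with \<open>j \<in> J\<close> show "a \<in> alg_norm L ` Units L" by (rule norm_surjective[OF \<phi> L IJ])
  qed
  then show ?thesis using False by simp
next
  case True
  interpret L: class_algebra L by fact
  have "I \<noteq> {}"
    using dim_iso(1)[OF \<phi> L model_algebra fin] model_dim(1)[OF IJ] dim by auto
  then have R: "range h = \<real>" using IJ True by (auto simp: admissible_def)
  have real: "h a = complex_of_real (Re (h a))" for a
    using R by (metis Reals_cases Re_complex_of_real rangeI)
  let ?n = "vectorspace.dim class_ring L"
  have "A \<subseteq> alg_norm L ` Units L \<longleftrightarrow> (\<forall>a\<in>A. Re (h a) > 0)"
  proof
    assume sub: "A \<subseteq> alg_norm L ` Units L"
    show "\<forall>a\<in>A. Re (h a) > 0"
    proof
      fix a assume "a \<in> A"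
      then obtain x where x: "x \<in> Units L" "a = alg_norm L x" using sub by blast
      obtain b where b: "b \<noteq> 0" "a = b * b" using norm_square[OF \<phi>[unfolded True] L fin x(1)] x(2) by metis
      have "h a = complex_of_real (Re (h b) * Re (h b))" using real[of b] by (simp add: b(2) hom_mult)
      moreover have "Re (h b) \<noteq> 0" using real[of b] b(1) by auto
      ultimately show "Re (h a) > 0" by (auto simp: zero_less_mult_iff linorder_neq_iff)
    qed
  next
    assume pos: "\<forall>a\<in>A. Re (h a) > 0"
    show "A \<subseteq> alg_norm L ` Units L"
    proof
      fix a assume "a \<in> A"
      then have a: "Re (h a) > 0" using pos by blast
      define r where "r = root ?n (Re (h a))"
      have r: "r ^ ?n = Re (h a)" "r > 0" using a dim by (simp_all add: r_def)
      have "h (real_elem r ^ ?n) = h a" using real[of a] r(1) by (simp add: hom_power flip: of_real_power)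
      then have "real_elem r ^ ?n = a" by (simp add: h_inj)
      moreover have "real_elem r \<noteq> 0" using r(2) h_real_elem[of r] by (metis hom_zero less_irrefl of_real_eq_0_iff)
      ultimately show "a \<in> alg_norm L ` Units L" using L.power_in_norm_image[OF fin refl] by metis
    qed
  qed
  then show ?thesis using True by simp
qed

section \<open>Isomorphism classes and their mass\<close>

text \<open>
  An injection of the functions in a model into the type \<open>nat \<Rightarrow> 'c\<close> of the carriers that \<^const>\<open>Et\<close>
  is built on: real parts at even positions, imaginary parts at odd ones.
\<close>

definition interleave :: "(nat \<Rightarrow> complex) \<Rightarrow> nat \<Rightarrow> 'c" where
  "interleave x k = real_elem (if even k then Re (x (k div 2)) else Im (x (k div 2)))"

lemma inj_interleave: "inj interleave"
proof
  fix x y assume eq: "interleave x = interleave y"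
  have re: "r = s" if "real_elem r = real_elem s" for r s
    using that by (metis h_real_elem of_real_eq_iff)
  show "x = y"
  proof
    fix i
    have "Re (x i) = Re (y i)" using fun_cong[OF eq, of "2 * i"] by (auto simp: interleave_def dest: re)
    moreover have "Im (x i) = Im (y i)" using fun_cong[OF eq, of "2 * i + 1"] by (auto simp: interleave_def dest: re)
    ultimately show "x i = y i" by (simp add: complex_eq_iff)
  qed
qed

lemma model_realization:
  fixes m :: nat
  obtains L :: "('c, nat \<Rightarrow> 'c) module" where "etale_algebra L" "alg_iso L (model {..<m} J) \<noteq> {}"
proof -
  let ?M = "model {..<m} J"
  have inj: "inj_on interleave (carrier ?M)" using inj_interleave by (rule inj_on_subset) simp
  define L where "L = copy_algebra interleave ?M"
  have L: "class_algebra L" unfolding L_def by (rule copy_algebra_algebra[OF inj model_algebra])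
  have iso: "interleave \<in> alg_iso ?M L" unfolding L_def by (rule copy_algebra_iso[OF inj])
  note iso' = alg_iso_sym[OF iso model_algebra]
  define g where "g z = interleave (\<lambda>_. z)" for z
  have inj_g: "inj_on g F" for F
  proof (rule inj_onI)
    fix y z assume "g y = g z"
    then have "(\<lambda>_::nat. y) = (\<lambda>_. z)" unfolding g_def by (rule injD[OF inj_interleave])
    then show "y = z" by (rule fun_cong)
  qed
  let ?E = "\<lambda>j. copy_algebra g (complex_algebra h (component_field J j))"
  have "(\<lambda>x. \<lambda>j\<in>{..<m}. g (x j)) \<in> alg_iso ?M (prod_algebra {..<m} ?E)"
    unfolding model_def by (intro prod_algebra_iso copy_algebra_iso inj_g)
  from alg_iso_trans[OF iso' this] have "alg_iso L (prod_algebra {..<m} ?E) \<noteq> {}" by blast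
  moreover have "finite_separable_extension (?E j)" for j
    by (rule complex_algebra_separable[OF component_field_cases inj_g])
  ultimately have "etale_algebra L"
    unfolding etale_algebra_def using L class_algebra_iff by (intro conjI exI[of _ m] exI[of _ ?E]) auto
  moreover have "alg_iso L ?M \<noteq> {}" using iso' by blast
  ultimately show ?thesis using that by blast
qed

text \<open>
  The possible numbers \<open>s\<close> of proper complex factors of an etale algebra of degree \<open>n\<close>.
\<close>

definition signatures :: "nat \<Rightarrow> nat set" where
  "signatures n = (if range h = \<real> then {..n div 2} else {0})"

abbreviation signature_model :: "nat \<Rightarrow> nat \<Rightarrow> ('c, nat \<Rightarrow> complex) module" where
  "signature_model n s \<equiv> model {..<n - s} {..<n - 2 * s}"

text \<open>
  The element of \<^term>\<open>Et n\<close> that belongs to \<open>s\<close> (see \<open>Et_eq\<close>).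
\<close>

definition signature_class :: "nat \<Rightarrow> nat \<Rightarrow> ('c, nat \<Rightarrow> 'c) module set" where
  "signature_class n s = {L \<in> etale_algebras n. alg_iso L (signature_model n s) \<noteq> {}}"

lemma signature_model_props:
  assumes "s \<in> signatures n"
  shows "admissible {..<n - s} {..<n - 2 * s}" "2 * s \<le> n"
    "card ({..<n - s} - {..<n - 2 * s}) = s"
    "vectorspace.dim class_ring (signature_model n s) = n"
    "vectorspace.fin_dim class_ring (signature_model n s)"
    "card (alg_aut (signature_model n s)) = fact (n - 2 * s) * fact s * 2 ^ s"
proof -
  show s: "2 * s \<le> n" using assms by (auto simp: signatures_def split: if_splits)
  show adm: "admissible {..<n - s} {..<n - 2 * s}"
    using assms s by (auto simp: signatures_def admissible_def split: if_splits)
  have "{..<n - s} - {..<n - 2 * s} = {n - 2 * s..<n - s}" by auto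
  then show card: "card ({..<n - s} - {..<n - 2 * s}) = s" using s by simp
  show "vectorspace.dim class_ring (signature_model n s) = n" using model_dim(1)[OF adm] card s by simp
  show "vectorspace.fin_dim class_ring (signature_model n s)" by (rule model_dim(2)[OF adm])
  show "card (alg_aut (signature_model n s)) = fact (n - 2 * s) * fact s * 2 ^ s"
    using card_aut_model[OF adm] card by simp
qed

lemma etale_algebras_algebra: "L \<in> etale_algebras n \<Longrightarrow> class_algebra L"
  by (simp add: etale_algebras_def etale_algebra_def class_algebra_iff)

lemma etale_fin_dim:
  assumes "L \<in> etale_algebras n"
  shows "vectorspace.fin_dim class_ring (L :: ('c, nat \<Rightarrow> 'c) module)"
proof -
  have "etale_algebra L" using assms by (simp add: etale_algebras_def)
  then obtain m and J :: "nat set" where mJ: "admissible {..<m} J" "alg_iso L (model {..<m} J) \<noteq> {}" by (rule etale_iso_model) blast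
  obtain \<phi> where \<phi>: "\<phi> \<in> alg_iso L (model {..<m} J)" using mJ(2) by blast
  show ?thesis
    by (rule dim_iso(2)[OF alg_iso_sym[OF \<phi>] model_algebra _ model_dim(2)[OF mJ(1)]])
      (rule etale_algebras_algebra[OF assms])+
qed

lemma etale_signature:
  assumes L: "L \<in> etale_algebras n"
  shows "\<exists>s\<in>signatures n. L \<in> signature_class n s"
proof -
  have "etale_algebra L" and dim: "vectorspace.dim class_ring L = n"
    using L by (simp_all add: etale_algebras_def)
  from this(1) obtain m and J :: "nat set" where mJ: "admissible {..<m} J" "alg_iso L (model {..<m} J) \<noteq> {}"
    by (rule etale_iso_model) blast
  obtain \<phi> where \<phi>: "\<phi> \<in> alg_iso L (model {..<m} J)" using mJ(2) by blast
  have J: "finite J" "J \<subseteq> {..<m}" using mJ(1) finite_subset by (auto simp: admissible_def)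
  define s where "s = card ({..<m} - J)"
  have n: "n = m + s"
    using dim_iso(1)[OF \<phi> etale_algebras_algebra[OF L] model_algebra etale_fin_dim[OF L]]
      model_dim(1)[OF mJ(1)] dim by (simp add: s_def)
  have s: "s = m - card J" "card J \<le> m"
    using J card_mono[of "{..<m}" J] by (simp_all add: s_def card_Diff_subset)
  have "s \<in> signatures n"
    using mJ(1) n s by (auto simp: signatures_def admissible_def)
  moreover have "alg_iso (model {..<m} J) (signature_model n s) \<noteq> {}"
    using J n s by (intro models_isomorphic) auto
  then obtain \<psi> where "\<psi> \<in> alg_iso (model {..<m} J) (signature_model n s)" by blast
  from alg_iso_trans[OF \<phi> this] have "L \<in> signature_class n s"
    using L by (auto simp: signature_class_def)
  ultimately show ?thesis by blast
qed

lemma signature_class_nonempty: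
  assumes s: "s \<in> signatures n"
  shows "signature_class n s \<noteq> {}"
proof -
  obtain L :: "('c, nat \<Rightarrow> 'c) module" where L: "etale_algebra L" "alg_iso L (signature_model n s) \<noteq> {}"
    using model_realization .
  obtain \<phi> where \<phi>: "\<phi> \<in> alg_iso L (signature_model n s)" using L(2) by blast
  have La: "class_algebra L" using L(1) by (simp add: etale_algebra_def class_algebra_iff)
  have "vectorspace.dim class_ring L = n"
    using dim_iso(1)[OF alg_iso_sym[OF \<phi> La] model_algebra La] signature_model_props(4,5)[OF s] by simp
  then show ?thesis using L by (auto simp: signature_class_def etale_algebras_def)
qed

lemma signature_class_unique:
  assumes "s \<in> signatures n" "t \<in> signatures n" "L \<in> signature_class n s" "L \<in> signature_class n t"
  shows "s = t"
proof -
  obtain \<phi> \<psi> where \<phi>: "\<phi> \<in> alg_iso L (signature_model n s)" and \<psi>: "\<psi> \<in> alg_iso L (signature_model n t)"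
    using assms by (auto simp: signature_class_def)
  have "class_algebra L" using assms(3) by (auto simp: signature_class_def intro: etale_algebras_algebra)
  from alg_iso_trans[OF alg_iso_sym[OF \<phi> this] \<psi>]
  have "alg_iso (signature_model n s) (signature_model n t) \<noteq> {}" by blast
  from isomorphic_models_card[OF signature_model_props(1)[OF assms(1)] signature_model_props(1)[OF assms(2)] this]
  show ?thesis using signature_model_props(2)[OF assms(1)] signature_model_props(2)[OF assms(2)] by simp
qed

lemma Et_eq: "(Et n :: ('c, nat \<Rightarrow> 'c) module set set) = signature_class n ` signatures n"
proof -
  let ?r = "{(L :: ('c, nat \<Rightarrow> 'c) module, M). L \<in> etale_algebras n \<and> M \<in> etale_algebras n \<and> alg_iso L M \<noteq> {}}"
  have cls: "?r `` {L} = signature_class n s" if L: "L \<in> signature_class n s" for L s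
  proof -
    obtain \<phi> where \<phi>: "\<phi> \<in> alg_iso L (signature_model n s)" and Le: "L \<in> etale_algebras n"
      using L by (auto simp: signature_class_def)
    note La = etale_algebras_algebra[OF Le]
    have "alg_iso L M \<noteq> {} \<longleftrightarrow> alg_iso M (signature_model n s) \<noteq> {}" if M: "M \<in> etale_algebras n"
      for M :: "('c, nat \<Rightarrow> 'c) module"
    proof
      assume "alg_iso L M \<noteq> {}"
      then obtain \<psi> where "\<psi> \<in> alg_iso L M" by blast
      from alg_iso_trans[OF alg_iso_sym[OF this La] \<phi>] show "alg_iso M (signature_model n s) \<noteq> {}" by blast
    next
      assume "alg_iso M (signature_model n s) \<noteq> {}"
      then obtain \<psi> where "\<psi> \<in> alg_iso M (signature_model n s)" by blast
      from alg_iso_trans[OF \<phi> alg_iso_sym[OF this etale_algebras_algebra[OF M]]] show "alg_iso L M \<noteq> {}" by blast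
    qed
    then show ?thesis using Le by (auto simp: signature_class_def)
  qed
  show ?thesis
  proof (intro equalityI subsetI)
    fix C :: "('c, nat \<Rightarrow> 'c) module set" assume "C \<in> Et n"
    then obtain L where L: "L \<in> etale_algebras n" "C = ?r `` {L}" unfolding Et_def by (rule quotientE)
    obtain s where s: "s \<in> signatures n" "L \<in> signature_class n s" using etale_signature[OF L(1)] by blast
    have "C = signature_class n s" unfolding L(2) by (rule cls[OF s(2)])
    then show "C \<in> signature_class n ` signatures n" using s(1) by blast
  next
    fix C :: "('c, nat \<Rightarrow> 'c) module set" assume "C \<in> signature_class n ` signatures n"
    then obtain s where s: "s \<in> signatures n" "C = signature_class n s" by blast
    obtain L where L: "L \<in> signature_class n s" using signature_class_nonempty[OF s(1)] by blast
    then have "?r `` {L} \<in> Et n" unfolding Et_def by (intro quotientI) (simp add: signature_class_def)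
    then show "C \<in> Et n" using cls[OF L] s(2) by simp
  qed
qed

text \<open>
  The classes in \<^const>\<open>Et\<close> correspond to signatures. The norm condition and the number of automorphisms
  of a representative are computed in the model, and \<open>n = 2 s\<close> says that there is no factor \<open>'c\<close>.
\<close>

lemma mass_Et_norm:
  assumes n: "n > 0" and A: "0 \<notin> A"
  shows "mass (Et_norm n A) =
    (\<Sum>s | s \<in> signatures n \<and> (n = 2 * s \<longrightarrow> (\<forall>a\<in>A. Re (h a) > 0)). 1 / (fact s * fact (n - 2 * s) * 2 ^ s))"
proof -
  have rep: "class_rep (signature_class n s) \<in> signature_class n s" if "s \<in> signatures n" for s
    unfolding class_rep_def using signature_class_nonempty[OF that] by (intro some_in_eq[THEN iffD2])
  let ?L = "\<lambda>s. class_rep (signature_class n s)"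
  have L: "?L s \<in> etale_algebras n" "alg_iso (?L s) (signature_model n s) \<noteq> {}" if "s \<in> signatures n" for s
    using rep[OF that] by (auto simp: signature_class_def)
  have norm: "A \<subseteq> alg_norm (?L s) ` Units (?L s) \<longleftrightarrow> (n = 2 * s \<longrightarrow> (\<forall>a\<in>A. Re (h a) > 0))"
    if s: "s \<in> signatures n" for s
  proof -
    obtain \<phi> where \<phi>: "\<phi> \<in> alg_iso (?L s) (signature_model n s)" using L(2)[OF s] by blast
    have "vectorspace.dim class_ring (?L s) = n" using L(1)[OF s] by (simp add: etale_algebras_def)
    moreover have "{..<n - 2 * s} = {} \<longleftrightarrow> n = 2 * s"
      using signature_model_props(2)[OF s] by (simp add: lessThan_empty_iff)
    ultimately show ?thesis
      using norm_image_contains_iff[OF \<phi> etale_algebras_algebra[OF L(1)[OF s]] signature_model_props(1)[OF s]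
          etale_fin_dim[OF L(1)[OF s]] _ A] n by simp
  qed
  have aut: "card (alg_aut (?L s)) = fact (n - 2 * s) * fact s * 2 ^ s" if s: "s \<in> signatures n" for s
  proof -
    obtain \<phi> where \<phi>: "\<phi> \<in> alg_iso (?L s) (signature_model n s)" using L(2)[OF s] by blast
    show ?thesis
      using card_alg_aut_iso[OF \<phi> etale_algebras_algebra[OF L(1)[OF s]] model_algebra]
        signature_model_props(6)[OF s] by simp
  qed
  let ?S = "{s. s \<in> signatures n \<and> (n = 2 * s \<longrightarrow> (\<forall>a\<in>A. Re (h a) > 0))}"
  have "Et_norm n A = signature_class n ` ?S"
    unfolding Et_norm_def Et_eq using norm by auto
  moreover have "inj_on (signature_class n) ?S"
  proof (rule inj_onI)
    fix s t assume "s \<in> ?S" "t \<in> ?S" "signature_class n s = signature_class n t"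
    then show "s = t" using signature_class_unique[of s n t "?L s"] rep[of s] by simp
  qed
  ultimately have "mass (Et_norm n A) = (\<Sum>s\<in>?S. 1 / real (card (alg_aut (?L s))))"
    unfolding mass_def by (simp add: sum.reindex)
  also have "\<dots> = (\<Sum>s\<in>?S. 1 / (fact s * fact (n - 2 * s) * 2 ^ s))"
    by (intro sum.cong) (auto simp: aut mult.commute)
  finally show ?thesis .
qed

end

section \<open>Completions at infinite primes\<close>

lemma field_hom_of_rat:
  assumes "field_hom (f :: 'k::field_char_0 \<Rightarrow> complex)"
  shows "f (of_rat q) = complex_of_real (of_rat q)"
proof -
  interpret f: field_hom f by fact
  obtain a b where q: "q = Rat.Fract a b" "b > 0" by (cases q) auto
  have i: "f (of_int a) = of_int a" for a by (simp add: f.hom_of_int)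
  show ?thesis using q by (simp add: of_rat_rat f.hom_div i)
qed

lemma absolute_value_one: "absolute_value v \<Longrightarrow> v 1 = 1"
  unfolding absolute_value_def by (metis mult_cancel_left1 mult.right_neutral one_neq_zero)

lemma absolute_value_minus:
  assumes "absolute_value v"
  shows "v (- x) = v x"
proof -
  have v: "\<And>x. 0 \<le> v x" "\<And>x y. v (x * y) = v x * v y" using assms by (auto simp: absolute_value_def)
  have "v (- 1) * v (- 1) = 1" using v(2)[of "- 1" "- 1"] absolute_value_one[OF assms] by simp
  then have "v (- 1) = 1" using v(1)[of "- 1"] by (metis abs_of_nonneg abs_square_eq_1 power2_eq_square)
  then show ?thesis using v(2)[of "- 1" x] by simp
qed

lemma absolute_value_metric:
  assumes "absolute_value v"
  shows "Metric_space UNIV (\<lambda>x y. v (x - y))"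
proof -
  have v: "\<And>x. 0 \<le> v x" "\<And>x. v x = 0 \<longleftrightarrow> x = 0" "\<And>x y. v (x + y) \<le> v x + v y"
    using assms by (auto simp: absolute_value_def)
  show ?thesis
  proof
    show "v (x - y) = v (y - x)" for x y using absolute_value_minus[OF assms, of "x - y"] by simp
    show "v (x - z) \<le> v (x - y) + v (y - z)" for x y z using v(3)[of "x - y" "y - z"] by simp
  qed (use v in auto)
qed

text \<open>
  The absolute values of \<open>x\<close> in the completion and under \<open>f\<close> are powers of each other, so a sequence
  in \<open>k\<close> converges in the completion if and only if its image under \<open>f\<close> converges in the plane.
  Sending one limit to the other defines \<open>h\<close> as a map onto the closure of the range of \<open>f\<close>. The closure
  contains the real numbers because \<open>f\<close> fixes the rational ones; together with a single value of \<open>f\<close>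
  that is not real they generate the plane.
\<close>

lemma completion_embedding:
  fixes f :: "'k::field_char_0 \<Rightarrow> complex" and \<iota> :: "'k \<Rightarrow> 'c::field"
  assumes p: "infinite_prime p" and f: "field_hom f" and fp: "(\<lambda>x. cmod (f x)) \<in> p"
    and comp: "is_completion p \<iota> w"
  obtains h :: "'c \<Rightarrow> complex"
  where "field_hom h" "\<And>x. h (\<iota> x) = f x"
    "range f \<subseteq> \<real> \<Longrightarrow> range h = \<real>" "\<not> range f \<subseteq> \<real> \<Longrightarrow> range h = UNIV"
proof -
  interpret f: field_hom f by fact
  interpret \<iota>: field_hom \<iota> using comp by (simp add: is_completion_def)
  have w: "absolute_value w" using comp by (simp add: is_completion_def)
  interpret W: Metric_space UNIV "\<lambda>x y. w (x - y)" by (rule absolute_value_metric[OF w])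
  have w_pos: "\<And>x. 0 \<le> w x" and w_0: "\<And>x. w x = 0 \<longleftrightarrow> x = 0"
    and w_mult: "\<And>x y. w (x * y) = w x * w y" and w_add: "\<And>x y. w (x + y) \<le> w x + w y"
    using w by (auto simp: absolute_value_def)
  note w_minus = absolute_value_minus[OF w]
  have w_diff: "w (x - y) \<le> w x + w y" for x y using w_add[of x "- y"] by (simp add: w_minus)
  obtain s where s: "s > 0" "\<And>x. w (\<iota> x) = cmod (f x) powr s"
  proof -
    obtain v where v: "p = {u. absolute_value u \<and> equivalent_abs u v}"
      using p by (auto simp: infinite_prime_def)
    obtain a where a: "a > 0" "\<And>x. cmod (f x) = v x powr a"
      using fp by (auto simp: v equivalent_abs_def)
    obtain b where b: "b > 0" "\<And>x. w (\<iota> x) = v x powr b"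
      using comp by (auto simp: is_completion_def v equivalent_abs_def)
    show ?thesis
      by (rule that[of "b / a"]) (use a b in \<open>auto simp: powr_powr\<close>)
  qed
  have small_f: "cmod (f x) < e" if "w (\<iota> x) < e powr s" "e > 0" for x e
    using that s powr_mono2[of s e "cmod (f x)"] by (smt (verit))
  have small_w: "w (\<iota> x) < e" if "cmod (f x) < e powr (1 / s)" "e > 0" for x e
    using that s powr_less_mono2[of s "cmod (f x)" "e powr (1 / s)"] by (simp add: powr_powr)
  \<comment> \<open>The graph of \<open>h\<close>.\<close>
  define R where "R y z \<longleftrightarrow> (\<exists>X. (\<lambda>n. w (\<iota> (X n) - y)) \<longlonglongrightarrow> 0 \<and> (\<lambda>n. f (X n)) \<longlonglongrightarrow> z)" for y z
  have limit_f: "\<exists>z. (\<lambda>n. f (X n)) \<longlonglongrightarrow> z" if X: "(\<lambda>n. w (\<iota> (X n) - y)) \<longlonglongrightarrow> 0" for X y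
  proof -
    have "Cauchy (\<lambda>n. f (X n))"
    proof (rule CauchyI)
      fix e :: real assume e: "e > 0"
      then have "e powr s / 2 > 0" by simp
      then obtain N where N: "\<And>n. n \<ge> N \<Longrightarrow> w (\<iota> (X n) - y) < e powr s / 2"
        using LIMSEQ_D[OF X] w_pos by fastforce
      have "cmod (f (X m) - f (X n)) < e" if "m \<ge> N" "n \<ge> N" for m n
      proof -
        have "w (\<iota> (X m - X n)) = w ((\<iota> (X m) - y) - (\<iota> (X n) - y))" by (simp add: \<iota>.hom_minus)
        also have "\<dots> \<le> w (\<iota> (X m) - y) + w (\<iota> (X n) - y)" by (rule w_diff)
        also have "\<dots> < e powr s" using N[OF that(1)] N[OF that(2)] by simp
        finally show ?thesis using small_f[of "X m - X n"] e by (simp add: f.hom_minus)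
      qed
      then show "\<exists>N. \<forall>m\<ge>N. \<forall>n\<ge>N. cmod (f (X m) - f (X n)) < e" by blast
    qed
    then show ?thesis by (simp add: Cauchy_convergent_iff convergent_def)
  qed
  have limit_completion: "\<exists>y. (\<lambda>n. w (\<iota> (X n) - y)) \<longlonglongrightarrow> 0" if X: "(\<lambda>n. f (X n)) \<longlonglongrightarrow> z" for X z
  proof -
    have cauchy: "Cauchy (\<lambda>n. f (X n))" using X by (rule LIMSEQ_imp_Cauchy)
    have "W.MCauchy (\<lambda>n. \<iota> (X n))"
      unfolding W.MCauchy_def
    proof (intro conjI allI impI)
      fix e :: real assume e: "e > 0"
      then have "e powr (1 / s) > 0" by simp
      then obtain N where N: "\<And>m n. m \<ge> N \<Longrightarrow> n \<ge> N \<Longrightarrow> cmod (f (X m) - f (X n)) < e powr (1 / s)"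
        using CauchyD[OF cauchy] by blast
      have "w (\<iota> (X m) - \<iota> (X n)) < e" if "m \<ge> N" "n \<ge> N" for m n
        using small_w[of "X m - X n" e] N[OF that] e by (simp add: f.hom_minus \<iota>.hom_minus)
      then show "\<exists>N. \<forall>n n'. N \<le> n \<longrightarrow> N \<le> n' \<longrightarrow> w (\<iota> (X n) - \<iota> (X n')) < e" by blast
    qed simp
    then obtain y where "limitin W.mtopology (\<lambda>n. \<iota> (X n)) y sequentially"
      using comp by (auto simp: is_completion_def W.mcomplete_def)
    then show ?thesis by (auto simp: W.limitin_metric_dist_null)
  qed
  have R_total: "\<exists>z. R y z" for y
  proof -
    have "y \<in> W.mtopology closure_of range \<iota>" using comp by (simp add: is_completion_def)
    then have dense: "\<exists>x. w (\<iota> x - y) < e" if "e > 0" for e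
      using that w_minus[of "y - _"] unfolding W.metric_closure_of by (fastforce simp: W.in_mball)
    have "\<exists>x. w (\<iota> x - y) < inverse (real (Suc n))" for n by (rule dense) simp
    then obtain X where X: "\<And>n. w (\<iota> (X n) - y) < inverse (real (Suc n))" by metis
    have "(\<lambda>n. w (\<iota> (X n) - y)) \<longlonglongrightarrow> 0"
      by (rule real_tendsto_sandwich[OF _ _ tendsto_const LIMSEQ_inverse_real_of_nat])
        (use less_imp_le[OF X] w_pos in auto)
    then show ?thesis using limit_f unfolding R_def by blast
  qed
  have R_unique: "z = z'" if "R y z" "R y z'" for y z z'
  proof -
    obtain X X' where X: "(\<lambda>n. w (\<iota> (X n) - y)) \<longlonglongrightarrow> 0" "(\<lambda>n. f (X n)) \<longlonglongrightarrow> z"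
      and X': "(\<lambda>n. w (\<iota> (X' n) - y)) \<longlonglongrightarrow> 0" "(\<lambda>n. f (X' n)) \<longlonglongrightarrow> z'"
      using \<open>R y z\<close> \<open>R y z'\<close> unfolding R_def by blast
    have "w (\<iota> (X n - X' n)) \<le> w (\<iota> (X n) - y) + w (\<iota> (X' n) - y)" for n
      using w_diff[of "\<iota> (X n) - y" "\<iota> (X' n) - y"] by (simp add: \<iota>.hom_minus)
    then have wlim: "(\<lambda>n. w (\<iota> (X n - X' n))) \<longlonglongrightarrow> 0"
      by (intro real_tendsto_sandwich[OF _ _ tendsto_const tendsto_add_zero[OF X(1) X'(1)]])
        (use w_pos in auto)
    have "(\<lambda>n. f (X n - X' n)) \<longlonglongrightarrow> 0"
    proof (rule LIMSEQ_I)
      fix e :: real assume e: "e > 0"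
      then have "e powr s > 0" by simp
      then obtain N where "\<And>n. n \<ge> N \<Longrightarrow> w (\<iota> (X n - X' n)) < e powr s"
        using LIMSEQ_D[OF wlim] w_pos by fastforce
      then show "\<exists>N. \<forall>n\<ge>N. norm (f (X n - X' n) - 0) < e" using small_f e by fastforce
    qed
    moreover have "(\<lambda>n. f (X n - X' n)) \<longlonglongrightarrow> z - z'"
      using tendsto_diff[OF X(2) X'(2)] by (simp add: f.hom_minus)
    ultimately show ?thesis using LIMSEQ_unique by fastforce
  qed
  define h where "h y = (THE z. R y z)" for y
  have R_iff: "R y z \<longleftrightarrow> h y = z" for y z
    unfolding h_def using R_total R_unique by (metis the_equality)
  have R_\<iota>: "R (\<iota> x) (f x)" for x
    unfolding R_def by (rule exI[of _ "\<lambda>_. x"]) (use w_0[of 0] in simp)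
  have h_\<iota>: "h (\<iota> x) = f x" for x using R_\<iota> R_iff by blast
  have h_add: "h (y + y') = h y + h y'" for y y'
  proof -
    obtain X X' where X: "(\<lambda>n. w (\<iota> (X n) - y)) \<longlonglongrightarrow> 0" "(\<lambda>n. f (X n)) \<longlonglongrightarrow> h y"
      and X': "(\<lambda>n. w (\<iota> (X' n) - y')) \<longlonglongrightarrow> 0" "(\<lambda>n. f (X' n)) \<longlonglongrightarrow> h y'"
      using R_iff unfolding R_def by metis
    have "w (\<iota> (X n + X' n) - (y + y')) \<le> w (\<iota> (X n) - y) + w (\<iota> (X' n) - y')" for n
      using w_add[of "\<iota> (X n) - y" "\<iota> (X' n) - y'"] by (simp add: \<iota>.hom_add algebra_simps)
    then have "(\<lambda>n. w (\<iota> (X n + X' n) - (y + y'))) \<longlonglongrightarrow> 0"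
      by (intro real_tendsto_sandwich[OF _ _ tendsto_const tendsto_add_zero[OF X(1) X'(1)]])
        (use w_pos in auto)
    moreover have "(\<lambda>n. f (X n + X' n)) \<longlonglongrightarrow> h y + h y'"
      using tendsto_add[OF X(2) X'(2)] by (simp add: f.hom_add)
    ultimately have "R (y + y') (h y + h y')"
      unfolding R_def by (intro exI[of _ "\<lambda>n. X n + X' n"]) simp
    then show ?thesis by (simp add: R_iff)
  qed
  have h_mult: "h (y * y') = h y * h y'" for y y'
  proof -
    obtain X X' where X: "(\<lambda>n. w (\<iota> (X n) - y)) \<longlonglongrightarrow> 0" "(\<lambda>n. f (X n)) \<longlonglongrightarrow> h y"
      and X': "(\<lambda>n. w (\<iota> (X' n) - y')) \<longlonglongrightarrow> 0" "(\<lambda>n. f (X' n)) \<longlonglongrightarrow> h y'"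
      using R_iff unfolding R_def by metis
    have bound: "w (\<iota> (X n * X' n) - y * y') \<le>
        w (\<iota> (X n) - y) * w (\<iota> (X' n) - y') + (w (\<iota> (X n) - y) * w y' + w y * w (\<iota> (X' n) - y'))" for n
    proof -
      define d where "d = \<iota> (X n) - y"
      define d' where "d' = \<iota> (X' n) - y'"
      have "\<iota> (X n * X' n) - y * y' = d * d' + (d * y' + y * d')"
        by (simp add: d_def d'_def \<iota>.hom_mult algebra_simps)
      then have "w (\<iota> (X n * X' n) - y * y') \<le> w (d * d') + (w (d * y') + w (y * d'))"
        using w_add[of "d * d'" "d * y' + y * d'"] w_add[of "d * y'" "y * d'"] by simp
      then show ?thesis by (simp add: w_mult d_def d'_def)
    qed
    have "(\<lambda>n. w (\<iota> (X n) - y) * w (\<iota> (X' n) - y') + (w (\<iota> (X n) - y) * w y' + w y * w (\<iota> (X' n) - y')))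
        \<longlonglongrightarrow> 0 * 0 + (0 * w y' + w y * 0)"
      by (intro tendsto_intros X X')
    then have "(\<lambda>n. w (\<iota> (X n) - y) * w (\<iota> (X' n) - y') + (w (\<iota> (X n) - y) * w y' + w y * w (\<iota> (X' n) - y')))
        \<longlonglongrightarrow> 0" by simp
    from real_tendsto_sandwich[OF _ _ tendsto_const this] have "(\<lambda>n. w (\<iota> (X n * X' n) - y * y')) \<longlonglongrightarrow> 0"
      using w_pos bound by simp
    moreover have "(\<lambda>n. f (X n * X' n)) \<longlonglongrightarrow> h y * h y'"
      using tendsto_mult[OF X(2) X'(2)] by (simp add: f.hom_mult)
    ultimately have "R (y * y') (h y * h y')"
      unfolding R_def by (intro exI[of _ "\<lambda>n. X n * X' n"]) simp
    then show ?thesis by (simp add: R_iff)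
  qed
  have h_0: "h 0 = 0" using h_\<iota>[of 0] by simp
  have h_1: "h 1 = 1" using h_\<iota>[of 1] by simp
  have hom: "field_hom h"
    by unfold_locales (auto simp: h_add h_mult h_0 h_1)
  have range_h: "range h = closure (range f)"
  proof -
    have "z \<in> range h \<longleftrightarrow> (\<exists>X. (\<lambda>n. f (X n)) \<longlonglongrightarrow> z)" for z
    proof
      assume "z \<in> range h"
      then obtain y where "R y z" using R_iff by blast
      then show "\<exists>X. (\<lambda>n. f (X n)) \<longlonglongrightarrow> z" unfolding R_def by blast
    next
      assume "\<exists>X. (\<lambda>n. f (X n)) \<longlonglongrightarrow> z"
      then obtain X where X: "(\<lambda>n. f (X n)) \<longlonglongrightarrow> z" by blast
      obtain y where "(\<lambda>n. w (\<iota> (X n) - y)) \<longlonglongrightarrow> 0" using limit_completion[OF X] by blast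
      then have "R y z" using X unfolding R_def by blast
      then show "z \<in> range h" using R_iff[of y z] by auto
    qed
    moreover have "z \<in> closure (range f) \<longleftrightarrow> (\<exists>X. (\<lambda>n. f (X n)) \<longlonglongrightarrow> z)" for z
    proof -
      have "(\<exists>x. (\<forall>n. x n \<in> range f) \<and> x \<longlonglongrightarrow> z) \<longleftrightarrow> (\<exists>X. (\<lambda>n. f (X n)) \<longlonglongrightarrow> z)"
      proof
        assume "\<exists>x. (\<forall>n. x n \<in> range f) \<and> x \<longlonglongrightarrow> z"
        then obtain x where x: "\<And>n. x n \<in> range f" "x \<longlonglongrightarrow> z" by blast
        then have "\<forall>n. \<exists>k. x n = f k" by blast
        then obtain X where "\<And>n. x n = f (X n)" by metis
        then have "x = (\<lambda>n. f (X n))" by auto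
        then show "\<exists>X. (\<lambda>n. f (X n)) \<longlonglongrightarrow> z" using x by blast
      next
        assume "\<exists>X. (\<lambda>n. f (X n)) \<longlonglongrightarrow> z"
        then obtain X where "(\<lambda>n. f (X n)) \<longlonglongrightarrow> z" by blast
        then show "\<exists>x. (\<forall>n. x n \<in> range f) \<and> x \<longlonglongrightarrow> z"
          by (intro exI[of _ "\<lambda>n. f (X n)"]) simp
      qed
      then show ?thesis by (simp add: closure_sequential)
    qed
    ultimately show ?thesis by blast
  qed
  have reals: "\<real> \<subseteq> range h"
  proof
    fix z :: complex assume "z \<in> \<real>"
    then obtain r where z: "z = of_real r" by (auto elim: Reals_cases)
    show "z \<in> range h"
      unfolding range_h closure_approachable
    proof (intro allI impI)
      fix e :: real assume "e > 0"
      then obtain q where q: "r < of_rat q" "of_rat q < r + e" using of_rat_dense[of r "r + e"] by auto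
      have "dist (f (of_rat q)) z < e"
        using q unfolding field_hom_of_rat[OF f] z dist_of_real by (simp add: dist_real_def)
      then show "\<exists>y\<in>range f. dist y z < e" by blast
    qed
  qed
  show ?thesis
  proof (rule that[OF hom h_\<iota>])
    assume "range f \<subseteq> \<real>"
    then have "closure (range f) \<subseteq> \<real>" by (intro closure_minimal closed_complex_Reals)
    then show "range h = \<real>" using reals range_h by blast
  next
    assume "\<not> range f \<subseteq> \<real>"
    then obtain x where x: "f x \<notin> \<real>" by blast
    then have b: "Im (f x) \<noteq> 0" by (simp add: complex_is_Real_iff)
    have "z \<in> range h" for z
    proof -
      define v where "v = Im z / Im (f x)"
      define u where "u = Re z - v * Re (f x)"
      obtain u' v' where "of_real u = h u'" "of_real v = h v'"
        using reals by (metis Reals_of_real imageE subsetD)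
      moreover have "z = of_real u + of_real v * f x"
        using b by (simp add: complex_eq_iff u_def v_def)
      ultimately have "z = h (u' + v' * \<iota> x)" by (simp add: h_add h_mult h_\<iota>)
      then show ?thesis by blast
    qed
    then show "range h = UNIV" by blast
  qed
qed

theorem theorem1p5:
  fixes A :: "'k::field_char_0 set"
    and n :: nat
    and p :: "('k \<Rightarrow> real) set"
    and f :: "'k \<Rightarrow> complex"
    and \<iota> :: "'k \<Rightarrow> 'c::field"
    and w :: "'c \<Rightarrow> real"
  assumes "number_field TYPE('k)"
    and "finitely_generated_subgroup A (units_of (class_ring :: 'k ring))"
    and "n > 0"
    and "infinite_prime p"
    and "field_hom f"
    and "(\<lambda>x. cmod (f x)) \<in> p"
    and "is_completion p \<iota> w"
  shows "(range f \<subseteq> \<real> \<longrightarrow>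
            mass (Et_norm n (\<iota> ` A)) =
              (if \<forall>\<alpha>\<in>A. Re (f \<alpha>) > 0
               then \<Sum>s = 0..nat \<lfloor>real n / 2\<rfloor>. 1 / (fact s * fact (n - 2 * s) * 2 ^ s)
               else \<Sum>s = 0..nat (\<lceil>real n / 2\<rceil> - 1). 1 / (fact s * fact (n - 2 * s) * 2 ^ s)))
       \<and> (\<not> range f \<subseteq> \<real> \<longrightarrow> mass (Et_norm n (\<iota> ` A)) = 1 / fact n)"
proof -
  obtain h :: "'c \<Rightarrow> complex" where h: "field_hom h" "\<And>x. h (\<iota> x) = f x"
    "range f \<subseteq> \<real> \<Longrightarrow> range h = \<real>" "\<not> range f \<subseteq> \<real> \<Longrightarrow> range h = UNIV"
    using completion_embedding[OF assms(4-7)] by blast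
  interpret field_hom h by fact
  interpret real_or_complex_field h
    by unfold_locales (use h(3,4) in blast)
  interpret \<iota>: field_hom \<iota> using assms(7) by (simp add: is_completion_def)
  have "A \<subseteq> carrier (units_of (class_ring :: 'k ring))"
    using assms(2) by (simp add: finitely_generated_subgroup_def subgroup.subset)
  then have "0 \<notin> A" by (auto simp: units_of_def Units_def)
  then have A: "0 \<notin> \<iota> ` A" by auto
  note mass = mass_Et_norm[OF assms(3) A]
  have pos: "(\<forall>a\<in>\<iota> ` A. Re (h a) > 0) \<longleftrightarrow> (\<forall>\<alpha>\<in>A. Re (f \<alpha>) > 0)" by (simp add: h(2))
  have floor: "nat \<lfloor>real n / 2\<rfloor> = n div 2" by linarith
  have ceil: "nat (\<lceil>real n / 2\<rceil> - 1) = (n - 1) div 2" using assms(3) by linarith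
  show ?thesis
  proof (intro conjI impI)
    assume "range f \<subseteq> \<real>"
    then have R: "range h = \<real>" by (rule h(3))
    have "{s. s \<in> signatures n \<and> (n = 2 * s \<longrightarrow> (\<forall>\<alpha>\<in>A. Re (f \<alpha>) > 0))} =
        (if \<forall>\<alpha>\<in>A. Re (f \<alpha>) > 0 then {0..n div 2} else {0..(n - 1) div 2})"
      using assms(3) by (auto simp: signatures_def R)
    then show "mass (Et_norm n (\<iota> ` A)) =
        (if \<forall>\<alpha>\<in>A. Re (f \<alpha>) > 0
         then \<Sum>s = 0..nat \<lfloor>real n / 2\<rfloor>. 1 / (fact s * fact (n - 2 * s) * 2 ^ s)
         else \<Sum>s = 0..nat (\<lceil>real n / 2\<rceil> - 1). 1 / (fact s * fact (n - 2 * s) * 2 ^ s))"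
      unfolding mass pos floor ceil by simp
  next
    assume "\<not> range f \<subseteq> \<real>"
    then have "range h = UNIV" by (rule h(4))
    moreover have "\<i> \<notin> \<real>" by (simp add: complex_is_Real_iff)
    then have "(UNIV :: complex set) \<noteq> \<real>" by (metis UNIV_I)
    ultimately have "{s. s \<in> signatures n \<and> (n = 2 * s \<longrightarrow> (\<forall>\<alpha>\<in>A. Re (f \<alpha>) > 0))} = {0}"
      using assms(3) by (auto simp: signatures_def)
    then show "mass (Et_norm n (\<iota> ` A)) = 1 / fact n"
      unfolding mass pos by simp
  qed
qed

end
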